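(* Let $\{X_{1}(t)\mid 0\leq t\leq 1\}$ and $\{X_{2}(t)\mid 0\leq t\leq 1\}$ be two independent continuous centered Gaussian processes with $X_1(0)=X_2(0)=0$ and with covariance functions $R_1$ and $R_2$ respectively. Let $p,q\ge 1$, suppose that $R_1$ has finite $p$-variation on $[0,1]^2$ and that $R_2$ has finite $q$-variation on $[0,1]^2$, and assume $p^{-1}+q^{-1}>1$. Let $H$ be the Hilbert space associated with the pair $(X_1,X_2)$, let $f^{\mathcal L}$ be the Lévy kernel and let $\{f_n\}_{n\ge1}$ be its dyadic step-function approximations (all defined in the context). Then $\{f_n\}_{n\ge 1}$ is a Cauchy sequence in $H^{\otimes 2}$. Moreover, denoting its limit by $\hat f^{\mathcal L}$, one has $$\langle \hat f^{\mathcal L},g\rangle_{H^{\otimes 2}}=\sum_{i,j=1}^{2}\iiiint_{[0,1]^{4}}f_{ij}^{\mathcal L}(s,u)\,g_{ij}(t,v)\,dR_{i}(s,t)\,dR_{j}(u,v)$$ for all step functions $g\in H^{\otimes 2}$.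
   Context: **Rectangular increments and $p$-variation.** For a function $R$ on $[0,1]^2$ write $R\binom{a}{b},\binom{c}{d}:=R(b,d)-R(b,c)-R(a,d)+R(a,c)$ for its rectangular increment over $[a,b]\times[c,d]$. For $p\ge1$, $R$ has finite $p$-variation on $[0,1]^2$ if $$V_p^2(R,[0,1]^2):=\sup_{D,D'}\Big(\sum_{t_i\in D,\,t'_j\in D'}|R(t_{i+1},t'_{j+1})-R(t_{i+1},t'_j)-R(t_i,t'_{j+1})+R(t_i,t'_j)|^p\Big)^{1/p}<\infty,$$ the supremum being over all pairs of finite partitions $D,D'$ of $[0,1]$. **Hilbert spaces.** Let $\mathcal E$ be the set of step functions $\phi=\sum_{k=1}^n a_k\mathbf 1_{(t_k,t_{k+1}]}$ on $[0,1]$, $a_k\in\mathbb R$. For $i=1,2$, $H_i$ is the completion of $\mathcal E$ (after identifying elements at zero distance) under the inner product $\langle\phi_1,\phi_2\rangle_{H_i}=\iint_{[0,1]^2}\phi_1(s)\phi_2(t)\,dR_i(s,t)$, where $dR_i$ assigns to a rectangle the rectangular increment of $R_i$ over it (so $\iint_{(0,u]\times(0,v]}dR_i=R_i(u,v)$; by continuity of $R_i$ it is immaterial whether endpoints are included). $H$ is the Hilbert space obtained by completing the set $\mathcal E_2$ of functions $f$ on $[0,1]\times\{1,2\}$ with $f(\cdot,1),f(\cdot,2)\in\mathcal E$ under $\langle f,g\rangle=\langle f(\cdot,1),g(\cdot,1)\rangle_{H_1}+\langle f(\cdot,2),g(\cdot,2)\rangle_{H_2}$; thus $H\cong H_1\oplus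 H_2$. $H^{\otimes2}$ is the Hilbert tensor square; via $H^{\otimes 2}\cong\bigoplus_{i,j=1}^2 H_i\otimes H_j$ its elements are identified with $2\times2$ matrices $f=(f_{ij})$, $f_{ij}\in H_i\otimes H_j$, with $\langle f,g\rangle_{H^{\otimes2}}=\sum_{i,j}\langle f_{ij},g_{ij}\rangle_{H_i\otimes H_j}$. A step function in $H^{\otimes2}$ is an element $g$ all of whose entries $g_{ij}$ lie in $\mathcal E^{\otimes2}=\mathcal E\otimes\mathcal E$ (algebraic tensor product), where $\phi\otimes\psi$ is identified with the function $(s,t)\mapsto\phi(s)\psi(t)$. For a function $f$ on $([0,1]\times\{1,2\})^2$ write $f_{ij}(s,t)=f((s,i),(t,j))$. **Lévy kernel.** Let $T_1=\{(s,t)\in[0,1]^2\mid s<t\}$, $T_2=\{(s,t)\in[0,1]^2\mid s>t\}$. Then $f^{\mathcal L}_{11}=f^{\mathcal L}_{22}=0$, $f^{\mathcal L}_{12}=\frac12(\mathbf 1_{T_1}-\mathbf 1_{T_2})$, $f^{\mathcal L}_{21}=\frac12(\mathbf 1_{T_2}-\mathbf 1_{T_1})$. **Approximations.** With $t_k^n=k2^{-n}$ and $I_k^n=(t_k^n,t_{k+1}^n]$ for $0\le k\le 2^n-1$, put $T_1^n=\bigcup_{k<l}I_k^n\times I_l^n$ and $T_2^n=\bigcup_{k>l}I_k^n\times I_l^n$. Then $(f_n)_{11}=(f_n)_{22}=0$, $(f_n)_{12}=\frac12(\mathbf 1_{T_1^n}-\mathbf 1_{T_2^n})$, $(f_n)_{21}=\frac12(\mathbf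 1_{T_2^n}-\mathbf 1_{T_1^n})$. **Quadruple integrals.** They are iterated integrals $\iint\big(\iint f^{\mathcal L}_{ij}(s,u)g_{ij}(t,v)\,dR_i(s,t)\big)dR_j(u,v)$. For fixed $(u,v)$ the inner integrand is piecewise constant on finitely many rectangles in $(s,t)$, and the inner integral is the corresponding finite linear combination of rectangular increments of $R_i$. The outer integral is a Young–Stieltjes integral, i.e. the limit, as the meshes of partitions tend to zero, of Riemann–Stieltjes sums formed with rectangular increments of $R_j$, taken separately over the finitely many rectangles on which the inner integral is continuous in $(u,v)$ and summed. *)

theory Defs
  imports "HOL-Probability.Probability"
begin

(* The index set {1,2} is the two-element type 2 of HOL-Library.Numeral_Type, with
   elements 1 and 2. A pair (X_1, X_2) is a function on this type, and a function on
   [0,1] x {1,2} is a function on real \<times> 2; only its values over [0,1] matter. *)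

subsection \<open>Gaussian processes on the unit interval\<close>

(* The degenerate law (point mass at 0) counts as centred Gaussian. *)
definition centered_gaussian_rv :: "'w measure \<Rightarrow> ('w \<Rightarrow> real) \<Rightarrow> bool" where
  "centered_gaussian_rv M Y \<longleftrightarrow>
     (AE \<omega> in M. Y \<omega> = 0) \<or> (\<exists>\<sigma>>0. distributed M lborel Y (normal_density 0 \<sigma>))"

definition centered_gaussian_process :: "'w measure \<Rightarrow> (real \<Rightarrow> 'w \<Rightarrow> real) \<Rightarrow> bool" where
  "centered_gaussian_process M X \<longleftrightarrow>
     (\<forall>t\<in>{0..1}. X t \<in> borel_measurable M) \<and>
     (\<forall>(n::nat) \<tau> c. (\<forall>k<n. \<tau> k \<in> {0..1}) \<longrightarrow>
        centered_gaussian_rv M (\<lambda>\<omega>. \<Sum>k<n. c k * X (\<tau> k) \<omega>))"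

definition continuous_process :: "'w measure \<Rightarrow> (real \<Rightarrow> 'w \<Rightarrow> real) \<Rightarrow> bool" where
  "continuous_process M X \<longleftrightarrow> (AE \<omega> in M. continuous_on {0..1} (\<lambda>t. X t \<omega>))"

(* Independence of the two families of random variables, as random elements of
   the product space of real functions on [0,1]. *)
definition independent_processes ::
    "'w measure \<Rightarrow> (real \<Rightarrow> 'w \<Rightarrow> real) \<Rightarrow> (real \<Rightarrow> 'w \<Rightarrow> real) \<Rightarrow> bool" where
  "independent_processes M X Y \<longleftrightarrow>
     prob_space.indep_var M
       (PiM {0..1} (\<lambda>_. borel)) (\<lambda>\<omega>. \<lambda>t\<in>{0..1}. X t \<omega>)
       (PiM {0..1} (\<lambda>_. borel)) (\<lambda>\<omega>. \<lambda>t\<in>{0..1}. Y t \<omega>)"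

definition covariance :: "'w measure \<Rightarrow> ('w \<Rightarrow> real) \<Rightarrow> ('w \<Rightarrow> real) \<Rightarrow> real" where
  "covariance M Y Z =
     (\<integral>\<omega>. (Y \<omega> - (\<integral>\<omega>'. Y \<omega>' \<partial>M)) * (Z \<omega> - (\<integral>\<omega>'. Z \<omega>' \<partial>M)) \<partial>M)"

definition is_covariance_function ::
    "'w measure \<Rightarrow> (real \<Rightarrow> 'w \<Rightarrow> real) \<Rightarrow> (real \<Rightarrow> real \<Rightarrow> real) \<Rightarrow> bool" where
  "is_covariance_function M X R \<longleftrightarrow>
     (\<forall>s\<in>{0..1}. \<forall>t\<in>{0..1}. R s t = covariance M (X s) (X t))"

subsection \<open>Rectangular increments and p-variation\<close>

(* Increment of R over [a,b] x [c,d]. *)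
definition rect_incr :: "(real \<Rightarrow> real \<Rightarrow> real) \<Rightarrow> real \<Rightarrow> real \<Rightarrow> real \<Rightarrow> real \<Rightarrow> real" where
  "rect_incr R a b c d = R b d - R b c - R a d + R a c"

definition is_partition :: "real \<Rightarrow> real \<Rightarrow> nat \<Rightarrow> (nat \<Rightarrow> real) \<Rightarrow> bool" where
  "is_partition a b n t \<longleftrightarrow> t 0 = a \<and> t n = b \<and> (\<forall>k<n. t k < t (Suc k))"

definition variation2 :: "real \<Rightarrow> (real \<Rightarrow> real \<Rightarrow> real) \<Rightarrow> ereal" where
  "variation2 p R =
     Sup {ereal ((\<Sum>k<n. \<Sum>l<m. \<bar>rect_incr R (t k) (t (Suc k)) (u l) (u (Suc l))\<bar> powr p) powr (1 / p))
          | n t m u. is_partition 0 1 n t \<and> is_partition 0 1 m u}"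

definition finite_variation2 :: "real \<Rightarrow> (real \<Rightarrow> real \<Rightarrow> real) \<Rightarrow> bool" where
  "finite_variation2 p R \<longleftrightarrow> variation2 p R < \<infinity>"

subsection \<open>Integrals of piecewise constant functions against dR\<close>

(* F on [0,1]^2 is constant on each open cell of a finite grid; the integral is the
   matching linear combination of rectangular increments. Values on the grid lines are
   disregarded, as the continuous R charges no line. The value does not depend on
   the grid (pass to a common refinement). *)
definition has_pc_integral ::
    "(real \<Rightarrow> real \<Rightarrow> real) \<Rightarrow> (real \<Rightarrow> real \<Rightarrow> real) \<Rightarrow> real \<Rightarrow> bool" where
  "has_pc_integral R F I \<longleftrightarrow>
     (\<exists>n t m u c. is_partition 0 1 n t \<and> is_partition 0 1 m u \<and>
        (\<forall>k<n. \<forall>l<m. \<forall>x\<in>{t k<..<t (Suc k)}. \<forall>y\<in>{u l<..<u (Suc l)}. F x y = c k l) \<and>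
        I = (\<Sum>k<n. \<Sum>l<m. c k l * rect_incr R (t k) (t (Suc k)) (u l) (u (Suc l))))"

definition pc_integral :: "(real \<Rightarrow> real \<Rightarrow> real) \<Rightarrow> (real \<Rightarrow> real \<Rightarrow> real) \<Rightarrow> real" where
  "pc_integral R F = (THE I. has_pc_integral R F I)"

subsection \<open>Two-dimensional Young--Stieltjes integrals\<close>

(* Partition of [a,b] with mesh below \<delta> and a tag \<xi> k in each closed subinterval. *)
definition fine_tagged :: "real \<Rightarrow> real \<Rightarrow> real \<Rightarrow> nat \<Rightarrow> (nat \<Rightarrow> real) \<Rightarrow> (nat \<Rightarrow> real) \<Rightarrow> bool" where
  "fine_tagged \<delta> a b n t \<xi> \<longleftrightarrow> is_partition a b n t \<and>
     (\<forall>k<n. t (Suc k) - t k < \<delta> \<and> \<xi> k \<in> {t k..t (Suc k)})"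

(* The tag of the (k,l)-th cell is (\<xi> k, \<eta> l): tags that could be chosen freely in every
   cell would destroy convergence in the Young regime. *)
definition has_rs_integral ::
    "(real \<Rightarrow> real \<Rightarrow> real) \<Rightarrow> real \<Rightarrow> real \<Rightarrow> real \<Rightarrow> real \<Rightarrow> (real \<Rightarrow> real \<Rightarrow> real) \<Rightarrow> real \<Rightarrow> bool" where
  "has_rs_integral R a b c d G I \<longleftrightarrow>
     (\<forall>\<epsilon>>0. \<exists>\<delta>>0. \<forall>n t \<xi> m u \<eta>. fine_tagged \<delta> a b n t \<xi> \<and> fine_tagged \<delta> c d m u \<eta> \<longrightarrow>
        \<bar>(\<Sum>k<n. \<Sum>l<m. G (\<xi> k) (\<eta> l) * rect_incr R (t k) (t (Suc k)) (u l) (u (Suc l))) - I\<bar> < \<epsilon>)"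

(* G agrees, on each open cell of a finite grid of [0,1]^2, with a function G' k l that
   is continuous on the closed cell; the integrals of the G' k l over the cells are summed. *)
definition has_young_integral ::
    "(real \<Rightarrow> real \<Rightarrow> real) \<Rightarrow> (real \<Rightarrow> real \<Rightarrow> real) \<Rightarrow> real \<Rightarrow> bool" where
  "has_young_integral R G I \<longleftrightarrow>
     (\<exists>n t m u G' J. is_partition 0 1 n t \<and> is_partition 0 1 m u \<and>
        (\<forall>k<n. \<forall>l<m.
           continuous_on ({t k..t (Suc k)} \<times> {u l..u (Suc l)}) (\<lambda>(x, y). G' k l x y) \<and>
           (\<forall>x\<in>{t k<..<t (Suc k)}. \<forall>y\<in>{u l<..<u (Suc l)}. G x y = G' k l x y) \<and>
           has_rs_integral R (t k) (t (Suc k)) (u l) (u (Suc l)) (G' k l) (J k l)) \<and>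
        I = (\<Sum>k<n. \<Sum>l<m. J k l))"

(* Iterated integral of F(s,u) g(t,v) d\<rho>(s,t) d\<sigma>(u,v), inner integral in (s,t). *)
definition has_quad_integral ::
    "(real \<Rightarrow> real \<Rightarrow> real) \<Rightarrow> (real \<Rightarrow> real \<Rightarrow> real) \<Rightarrow>
     (real \<Rightarrow> real \<Rightarrow> real) \<Rightarrow> (real \<Rightarrow> real \<Rightarrow> real) \<Rightarrow> real \<Rightarrow> bool" where
  "has_quad_integral \<rho> \<sigma> F g I \<longleftrightarrow>
     (\<exists>G. (\<forall>u\<in>{0..1}. \<forall>v\<in>{0..1}. has_pc_integral \<rho> (\<lambda>s t. F s u * g t v) (G u v)) \<and>
          has_young_integral \<sigma> G I)"

definition quad_integrable ::
    "(real \<Rightarrow> real \<Rightarrow> real) \<Rightarrow> (real \<Rightarrow> real \<Rightarrow> real) \<Rightarrow>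
     (real \<Rightarrow> real \<Rightarrow> real) \<Rightarrow> (real \<Rightarrow> real \<Rightarrow> real) \<Rightarrow> bool" where
  "quad_integrable \<rho> \<sigma> F g \<longleftrightarrow> (\<exists>I. has_quad_integral \<rho> \<sigma> F g I)"

definition quad_integral ::
    "(real \<Rightarrow> real \<Rightarrow> real) \<Rightarrow> (real \<Rightarrow> real \<Rightarrow> real) \<Rightarrow>
     (real \<Rightarrow> real \<Rightarrow> real) \<Rightarrow> (real \<Rightarrow> real \<Rightarrow> real) \<Rightarrow> real" where
  "quad_integral \<rho> \<sigma> F g = (THE I. has_quad_integral \<rho> \<sigma> F g I)"

subsection \<open>Step functions and the Hilbert spaces\<close>

definition step_functions :: "(real \<Rightarrow> real) set" where
  "step_functions = {\<phi>. \<exists>n t a. (\<forall>k\<le>n. t k \<in> {0..1}) \<and> (\<forall>k<n. t k < t (Suc k)) \<and>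
     \<phi> = (\<lambda>s. \<Sum>k<n. a k * indicator {t k<..t (Suc k)} s)}"

definition step_functions2 :: "(real \<times> 2 \<Rightarrow> real) set" where
  "step_functions2 = {f. \<forall>i. (\<lambda>s. f (s, i)) \<in> step_functions}"

(* The inner product of H_1 (for R = R_1) resp. H_2 on step functions. *)
definition step_inner :: "(real \<Rightarrow> real \<Rightarrow> real) \<Rightarrow> (real \<Rightarrow> real) \<Rightarrow> (real \<Rightarrow> real) \<Rightarrow> real" where
  "step_inner R \<phi> \<psi> = pc_integral R (\<lambda>s t. \<phi> s * \<psi> t)"

definition step_inner2 ::
    "(2 \<Rightarrow> real \<Rightarrow> real \<Rightarrow> real) \<Rightarrow> (real \<times> 2 \<Rightarrow> real) \<Rightarrow> (real \<times> 2 \<Rightarrow> real) \<Rightarrow> real" where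
  "step_inner2 R f g = (\<Sum>i\<in>UNIV. step_inner (R i) (\<lambda>s. f (s, i)) (\<lambda>s. g (s, i)))"

(* The Hilbert space 'h, together with the canonical map \<iota>, is the completion of the linear
   space V of functions under the semi-inner product B; \<iota> kills the elements of
   zero length. Its values outside V are irrelevant. *)
definition hilbert_completion ::
    "('a \<Rightarrow> real) set \<Rightarrow> (('a \<Rightarrow> real) \<Rightarrow> ('a \<Rightarrow> real) \<Rightarrow> real) \<Rightarrow>
     (('a \<Rightarrow> real) \<Rightarrow> 'h::{real_inner, complete_space}) \<Rightarrow> bool" where
  "hilbert_completion V B \<iota> \<longleftrightarrow>
     (\<forall>f\<in>V. \<forall>g\<in>V. \<iota> (\<lambda>x. f x + g x) = \<iota> f + \<iota> g) \<and>
     (\<forall>c. \<forall>f\<in>V. \<iota> (\<lambda>x. c * f x) = c *\<^sub>R \<iota> f) \<and>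
     (\<forall>f\<in>V. \<forall>g\<in>V. inner (\<iota> f) (\<iota> g) = B f g) \<and>
     closure (\<iota> ` V) = UNIV"

(* The Hilbert space 'k, together with the bilinear map T, is the Hilbert tensor square
   of 'h: the span of the elementary tensors, with the product inner product, is dense. *)
definition hilbert_tensor_square ::
    "('h::{real_inner, complete_space} \<Rightarrow> 'h \<Rightarrow> 'k::{real_inner, complete_space}) \<Rightarrow> bool" where
  "hilbert_tensor_square T \<longleftrightarrow>
     bilinear T \<and>
     (\<forall>a b c d. inner (T a b) (T c d) = inner a c * inner b d) \<and>
     closure (span {T a b | a b. True}) = UNIV"

subsection \<open>Step functions in the tensor square\<close>

definition entry :: "((real \<times> 2) \<times> (real \<times> 2) \<Rightarrow> real) \<Rightarrow> 2 \<Rightarrow> 2 \<Rightarrow> real \<Rightarrow> real \<Rightarrow> real" where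
  "entry f i j s t = f ((s, i), (t, j))"

definition tensor_step_functions :: "(real \<Rightarrow> real \<Rightarrow> real) set" where
  "tensor_step_functions = {h. \<exists>(n::nat) \<phi> \<psi>.
     (\<forall>k<n. \<phi> k \<in> step_functions \<and> \<psi> k \<in> step_functions) \<and>
     h = (\<lambda>s t. \<Sum>k<n. \<phi> k s * \<psi> k t)}"

definition tensor_step_functions2 :: "((real \<times> 2) \<times> (real \<times> 2) \<Rightarrow> real) set" where
  "tensor_step_functions2 = {g. \<forall>i j. entry g i j \<in> tensor_step_functions}"

(* The element of the tensor square identified with the function f: a sum of
   \<phi> \<otimes> \<psi> with \<phi>, \<psi> in step_functions2 is identified with the function
   (x,y) \<mapsto> \<phi> x * \<psi> y. The result does not depend on how f is written as such a sum. *)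
definition tensor_embed ::
    "((real \<times> 2 \<Rightarrow> real) \<Rightarrow> 'h) \<Rightarrow> ('h \<Rightarrow> 'h \<Rightarrow> 'k) \<Rightarrow>
     ((real \<times> 2) \<times> (real \<times> 2) \<Rightarrow> real) \<Rightarrow> 'k::comm_monoid_add" where
  "tensor_embed \<iota> T f = (THE x. \<exists>(n::nat) \<phi> \<psi>.
     (\<forall>k<n. \<phi> k \<in> step_functions2 \<and> \<psi> k \<in> step_functions2) \<and>
     f = (\<lambda>(y, z). \<Sum>k<n. \<phi> k y * \<psi> k z) \<and>
     x = (\<Sum>k<n. T (\<iota> (\<phi> k)) (\<iota> (\<psi> k))))"

subsection \<open>The Levy kernel and its approximations\<close>

(* Entries: f_11 = f_22 = 0, f_12 = (1_A - 1_B)/2, f_21 = (1_B - 1_A)/2. *)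
definition area_kernel ::
    "(real \<times> real) set \<Rightarrow> (real \<times> real) set \<Rightarrow> (real \<times> 2) \<times> (real \<times> 2) \<Rightarrow> real" where
  "area_kernel A B = (\<lambda>((s, i), (t, j)).
     if i = 1 \<and> j = 2 then (indicator A (s, t) - indicator B (s, t)) / 2
     else if i = 2 \<and> j = 1 then (indicator B (s, t) - indicator A (s, t)) / 2
     else 0)"

definition levy_kernel :: "(real \<times> 2) \<times> (real \<times> 2) \<Rightarrow> real" where
  "levy_kernel = area_kernel
     {(s, t). s \<in> {0..1} \<and> t \<in> {0..1} \<and> s < t}
     {(s, t). s \<in> {0..1} \<and> t \<in> {0..1} \<and> s > t}"

definition dyadic_interval :: "nat \<Rightarrow> nat \<Rightarrow> real set" where
  "dyadic_interval n k = {real k / 2 ^ n<..real (Suc k) / 2 ^ n}"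

definition levy_approx :: "nat \<Rightarrow> (real \<times> 2) \<times> (real \<times> 2) \<Rightarrow> real" where
  "levy_approx n = area_kernel
     (\<Union>l<2 ^ n. \<Union>k<l. dyadic_interval n k \<times> dyadic_interval n l)
     (\<Union>k<2 ^ n. \<Union>l<k. dyadic_interval n k \<times> dyadic_interval n l)"

end

theory Submission
  imports Defs
begin

text \<open>
Let \<open>e\<^sub>i(u)\<close> be the element of the Hilbert space represented by the indicator of \<open>(0,u]\<close> on
component \<open>i\<close>. The inner product of two increments of \<open>e\<^sub>i\<close> is a rectangular increment of \<open>R i\<close>, so
\<open>e\<^sub>i\<close> is a Hilbert-space copy of the process \<open>X i\<close> (it is called \<open>curve \<iota> i\<close> below). With
\<open>t\<^sub>l = l / 2\<^sup>n\<close>, summation over the first variable turns the (1,2)-entry of \<open>f\<^sub>n\<close> into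
\[ \frac12 \sum_l (e_1(t_l) + e_1(t_{l+1}) - e_1(1)) \otimes (e_2(t_{l+1}) - e_2(t_l)), \]
the mean of a left and a right Riemann sum for the tensor-valued integral
\<open>\<integral> e\<^sub>1 \<otimes> de\<^sub>2\<close>, up to a fixed boundary term; the (2,1)-entry is the same expression with the
components exchanged and the opposite sign. Everything therefore reduces to one statement,
\<open>tensor_integral_exists\<close>: the tagged Riemann sums of \<open>\<integral> e\<^sub>i \<otimes> de\<^sub>j\<close> converge in norm as the mesh
tends to zero.

This is an inequality of Young type (\<open>young_removal\<close>, \<open>young_refinement_bound\<close>). Deleting a set \<open>S\<close> of
pairwise non-neighbouring points from a partition changes the left Riemann sum by
\[ \sum_{x\in S} (e_i(x) - e_i(x^-)) \otimes (e_j(x^+) - e_j(x)), \]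
where the two superscripts denote the neighbours of \<open>x\<close>, and the squared norm of this element is a
double sum over \<open>S\<close> of products of increments of \<open>R i\<close> and \<open>R j\<close>. Young's choice of a single cheap
point is too weak here: the curves themselves have only finite \<open>2p\<close>- and \<open>2q\<close>-variation, and
\<open>1/(2p) + 1/(2q)\<close> need not exceed 1. Deleting many points at once keeps the cancellation in the
tensor product. Of \<open>N\<close> removable points, at least a quarter are pairwise non-neighbouring and have row
sums of \<open>|\<Delta>R i|\<^sup>p\<close> and \<open>|\<Delta>R j|\<^sup>q\<close> at most \<open>4/N\<close> times the total variation; for these, Hoelder's
inequality bounds the change by a constant times \<open>N\<close> to the power \<open>-(1/p + 1/q - 1)/2\<close>. Since \<open>N\<close> drops
by at least a fixed factor in every round, the costs sum up to a bound that does not depend on the number of points.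
The bound becomes small on fine partitions because \<open>p\<close> can be replaced by a slightly larger \<open>p'\<close>:
the \<open>p'\<close>-th powers are \<open>p\<close>-th powers times a power of the largest increment, which
uniform continuity of \<open>e\<^sub>i\<close> makes small.

Continuity of \<open>e\<^sub>i\<close> means mean-square continuity of \<open>X i\<close>. For centred Gaussian variables it follows from
continuity of the paths, because the variance can be read off from the characteristic function
(\<open>gaussian_process_L2_continuous\<close>).

For the quadruple integral let \<open>g\<^sub>i\<^sub>j = \<Sum>\<^sub>k \<phi>\<^sub>k \<otimes> \<psi>\<^sub>k\<close>. Up to the orientation sign, the inner integral at
\<open>(u,v)\<close> equals \<open>\<Sum>\<^sub>k \<psi>\<^sub>k(v) \<langle>e\<^sub>i(u) - e\<^sub>i(1)/2, \<phi>\<^sub>k\<rangle>\<close>. Integrating it against \<open>R j\<close> leads to Riemann sums that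
are inner products of tagged sums of \<open>\<integral> e\<^sub>i \<otimes> de\<^sub>j\<close> with fixed tensors, so norm convergence yields
both the existence of the Young integral and its value (\<open>levy_quad_integral\<close>). All integrals
and embeddings are defined by unique description; uniqueness is obtained by passing to a common
refinement of the grids involved.
\<close>

section \<open>Finite partitions as sets of points\<close>

text \<open>Partitions are handled as finite sets of points, and a sum over the
  intervals of a partition as a sum over pairs of neighbouring points. Deleting points and passing to
  common refinements then become set difference and union.\<close>

definition gaps :: "real set \<Rightarrow> (real \<times> real) set" where
  "gaps P = {(x, y). x \<in> P \<and> y \<in> P \<and> x < y \<and> P \<inter> {x<..<y} = {}}"

definition gap_sum :: "real set \<Rightarrow> (real \<Rightarrow> real \<Rightarrow> 'v) \<Rightarrow> 'v::comm_monoid_add" where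
  "gap_sum P h = (\<Sum>(x, y)\<in>gaps P. h x y)"

lemma gapsD:
  assumes "(x, y) \<in> gaps P"
  shows "x \<in> P" "y \<in> P" "x < y" "\<And>z. z \<in> P \<Longrightarrow> z \<le> x \<or> y \<le> z"
  using assms by (force simp: gaps_def)+

lemma gapsI:
  assumes "x \<in> P" "y \<in> P" "x < y" "\<And>z. z \<in> P \<Longrightarrow> z \<le> x \<or> y \<le> z"
  shows "(x, y) \<in> gaps P"
  using assms by (force simp: gaps_def)

lemma finite_gaps [simp]: "finite P \<Longrightarrow> finite (gaps P)"
  by (rule finite_subset[of _ "P \<times> P"]) (auto dest: gapsD)

lemma gaps_disjoint:
  assumes "(x, y) \<in> gaps P" "(x', y') \<in> gaps P" "(x, y) \<noteq> (x', y')"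
  shows "y \<le> x' \<or> y' \<le> x"
  using gapsD[OF assms(1)] gapsD[OF assms(2)] assms(3) by (metis antisym linorder_not_le)

lemma gap_containing:
  assumes "finite P" "x0 \<in> P" "x0 < z" "y0 \<in> P" "z \<le> y0"
  obtains x y where "(x, y) \<in> gaps P" "x < z" "z \<le> y"
proof
  let ?A = "{x\<in>P. x < z}" and ?B = "{y\<in>P. z \<le> y}"
  have A: "Max ?A \<in> ?A" using assms by (intro Max_in) auto
  have B: "Min ?B \<in> ?B" using assms by (intro Min_in) auto
  show "Max ?A < z" "z \<le> Min ?B" using A B by auto
  show "(Max ?A, Min ?B) \<in> gaps P"
  proof (rule gapsI)
    fix u assume "u \<in> P"
    then show "u \<le> Max ?A \<or> Min ?B \<le> u"
      using assms(1) by (cases "u < z") (auto intro: Max_ge Min_le)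
  qed (use A B in auto)
qed

lemma gap_in_coarser:
  assumes "finite P" "Q \<subseteq> P" "a \<in> Q" "b \<in> Q" "P \<subseteq> {a..b}" "(x, y) \<in> gaps P"
  obtains w z where "(w, z) \<in> gaps Q" "w \<le> x" "y \<le> z"
proof -
  note D = gapsD[OF assms(6)]
  have "a < y" "y \<le> b" using D assms by force+
  then obtain w z where wz: "(w, z) \<in> gaps Q" "w < y" "y \<le> z"
    using gap_containing[of Q a y b] finite_subset[OF assms(2,1)] assms by auto
  moreover have "w \<le> x" using D(4)[of w] gapsD(1)[OF wz(1)] wz assms(2) by auto
  ultimately show thesis using that by blast
qed

lemma gap_below:
  assumes "finite P" "z \<in> P" "x0 \<in> P" "x0 < z"
  obtains x where "(x, z) \<in> gaps P"
proof -
  from gap_containing[OF assms(1,3,4,2)] obtain x y where "(x, y) \<in> gaps P" "x < z" "z \<le> y" by auto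
  moreover from this have "y = z" using gapsD[of x y P] assms(2) by force
  ultimately show thesis using that by auto
qed

lemma gap_above:
  assumes "finite P" "z \<in> P" "y0 \<in> P" "z < y0"
  obtains y where "(z, y) \<in> gaps P"
proof -
  let ?B = "{y\<in>P. z < y}"
  have B: "Min ?B \<in> ?B" using assms by (intro Min_in) auto
  have "(z, Min ?B) \<in> gaps P"
  proof (rule gapsI)
    fix u assume "u \<in> P"
    then show "u \<le> z \<or> Min ?B \<le> u"
      using assms(1) by (cases "z < u") (auto intro: Max_ge Min_le)
  qed (use B assms in auto)
  then show thesis by (rule that)
qed

lemma partition_strict_mono:
  assumes "is_partition a b n t" "k < l" "l \<le> n"
  shows "t k < t l"
  using assms(2,3)
proof (induction l)
  case (Suc l)
  then have "t l < t (Suc l)" using assms(1) by (auto simp: is_partition_def)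
  then show ?case using Suc by (cases "k = l") auto
qed simp

lemma partition_mono:
  assumes "is_partition a b n t" "k \<le> l" "l \<le> n"
  shows "t k \<le> t l"
  using partition_strict_mono[OF assms(1), of k l] assms by (cases "k = l") auto

lemma partition_bounds:
  assumes "is_partition a b n t" "k \<le> n"
  shows "a \<le> t k" "t k \<le> b"
  using partition_mono[OF assms(1), of 0 k] partition_mono[OF assms(1), of k n] assms
  by (auto simp: is_partition_def)

lemma gaps_partition:
  assumes t: "is_partition a b n t"
  shows "gaps (t ` {..n}) = (\<lambda>k. (t k, t (Suc k))) ` {..<n}"
proof (intro equalityI subsetI)
  fix g assume g: "g \<in> gaps (t ` {..n})"
  obtain x y where [simp]: "g = (x, y)" by (cases g)
  have "x \<in> t ` {..n}" "y \<in> t ` {..n}" using g gapsD(1,2) by auto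
  then obtain k l where k: "k \<le> n" "x = t k" and l: "l \<le> n" "y = t l" by auto
  have "k < l" using gapsD(3)[of x y] g k l partition_mono[OF t, of l k] by force
  moreover have "\<not> Suc k < l"
  proof
    assume "Suc k < l"
    with partition_strict_mono[OF t, of k "Suc k"] partition_strict_mono[OF t, of "Suc k" l] k l
    have "t (Suc k) \<in> t ` {..n}" "x < t (Suc k)" "t (Suc k) < y" by auto
    then show False using gapsD(4)[of x y] g by force
  qed
  ultimately have "l = Suc k" by simp
  then show "g \<in> (\<lambda>k. (t k, t (Suc k))) ` {..<n}" using k l by auto
next
  fix g assume "g \<in> (\<lambda>k. (t k, t (Suc k))) ` {..<n}"
  then obtain k where k: "k < n" "g = (t k, t (Suc k))" by auto
  have "(t k, t (Suc k)) \<in> gaps (t ` {..n})"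
  proof (rule gapsI)
    show "t k < t (Suc k)" using partition_strict_mono[OF t, of k "Suc k"] k by simp
    fix z assume "z \<in> t ` {..n}"
    then obtain l where "l \<le> n" "z = t l" by auto
    then show "z \<le> t k \<or> t (Suc k) \<le> z"
      using partition_mono[OF t, of l k] partition_mono[OF t, of "Suc k" l] k
      by (cases "l \<le> k") auto
  qed (use k in auto)
  then show "g \<in> gaps (t ` {..n})" using k by simp
qed

lemma gap_sum_partition:
  assumes t: "is_partition a b n t"
  shows "gap_sum (t ` {..n}) h = (\<Sum>k<n. h (t k) (t (Suc k)))"
proof -
  have "inj_on (\<lambda>k. (t k, t (Suc k))) {..<n}"
    by (intro inj_onI) (metis Pair_inject lessThan_iff less_imp_le linorder_neqE_nat
        order_less_irrefl partition_strict_mono[OF t])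
  then show ?thesis
    by (simp add: gap_sum_def gaps_partition[OF t] sum.reindex)
qed

lemma partition_of_set:
  assumes "finite P" "a \<in> P" "b \<in> P" "P \<subseteq> {a..b}"
  obtains n t where "is_partition a b n t" "t ` {..n} = P"
proof
  let ?xs = "sorted_list_of_set P" and ?n = "card P - 1"
  have xs: "sorted_wrt (<) ?xs" "set ?xs = P" "length ?xs = card P"
    using assms(1) by auto
  have pos: "card P > 0" using assms by (auto simp: card_gt_0_iff)
  have mono: "?xs ! i \<le> ?xs ! j" if "i \<le> j" "j < card P" for i j
    using sorted_wrt_nth_less[OF xs(1), of i j] that xs(3) by (cases "i = j") auto
  have mem: "?xs ! i \<in> P" if "i < card P" for i using xs that by (metis nth_mem)
  obtain i where i: "i < card P" "?xs ! i = a" using assms(2) xs by (metis in_set_conv_nth)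
  obtain j where j: "j < card P" "?xs ! j = b" using assms(3) xs by (metis in_set_conv_nth)
  have "?xs ! 0 = a" using mono[of 0 i] mem[of 0] i assms(4) pos by force
  moreover have "?xs ! ?n = b" using mono[of j ?n] mem[of ?n] j assms(4) pos by force
  ultimately show "is_partition a b ?n ((!) ?xs)"
    using sorted_wrt_nth_less[OF xs(1)] xs(3) by (auto simp: is_partition_def)
  have "{..?n} = {..<card P}" using pos by auto
  then show "((!) ?xs) ` {..?n} = P" using xs
    by (metis nth_image lessThan_atLeast0 order_refl take_all)
qed

text \<open>Splitting one interval at a new point leaves all other intervals unchanged.\<close>

lemma gap_sum_insert:
  fixes h :: "real \<Rightarrow> real \<Rightarrow> 'v::ab_group_add"
  assumes "finite P" "(w, y) \<in> gaps P" "w < z" "z < y"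
  shows "gap_sum (insert z P) h = gap_sum P h - h w y + h w z + h z y"
proof -
  have z: "z \<notin> P" using gapsD(4)[OF assms(2), of z] assms by auto
  have eq: "gaps (insert z P) = insert (w, z) (insert (z, y) (gaps P - {(w, y)}))"
  proof (intro equalityI subsetI)
    fix g assume g: "g \<in> gaps (insert z P)"
    obtain a b where [simp]: "g = (a, b)" by (cases g)
    note D = gapsD[of a b "insert z P", OF g[simplified]] and E = gapsD[OF assms(2)]
    consider "a = z" | "b = z" | "a \<in> P" "b \<in> P" using D by auto
    then show "g \<in> insert (w, z) (insert (z, y) (gaps P - {(w, y)}))"
    proof cases
      case 1
      with D E assms z have "b \<in> P" by auto
      have "b = y" using D(4)[of y] E(4)[OF \<open>b \<in> P\<close>] E D 1 assms by auto
      then show ?thesis using 1 by simp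
    next
      case 2
      with D E assms z have "a \<in> P" by auto
      have "a = w" using D(4)[of w] E(4)[OF \<open>a \<in> P\<close>] E D 2 assms by auto
      then show ?thesis using 2 by simp
    next
      case 3
      then have "(a, b) \<in> gaps P" using D by (auto intro: gapsI)
      moreover have "(a, b) \<noteq> (w, y)" using D(4)[of z] assms by auto
      ultimately show ?thesis by simp
    qed
  next
    fix g assume g: "g \<in> insert (w, z) (insert (z, y) (gaps P - {(w, y)}))"
    note E = gapsD[OF assms(2)]
    have "(w, z) \<in> gaps (insert z P)" "(z, y) \<in> gaps (insert z P)"
      using E assms by (force intro!: gapsI)+
    moreover have "g \<in> gaps (insert z P)" if "g \<in> gaps P - {(w, y)}"
    proof -
      obtain a b where [simp]: "g = (a, b)" by (cases g)
      have "b \<le> w \<or> y \<le> a" using gaps_disjoint[of a b P w y] that assms(2) by auto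
      then show ?thesis using gapsD[of a b P] that assms by (auto intro!: gapsI)
    qed
    ultimately show "g \<in> gaps (insert z P)" using g by auto
  qed
  have nw: "(w, z) \<notin> insert (z, y) (gaps P - {(w, y)})" "(z, y) \<notin> gaps P - {(w, y)}"
    using z assms(3,4) by (auto dest: gapsD)
  have "gap_sum P h = h w y + (\<Sum>(a, b)\<in>gaps P - {(w, y)}. h a b)"
    using assms(1,2) by (simp add: gap_sum_def sum.remove)
  then show ?thesis using nw assms(1)
    by (simp add: gap_sum_def eq)
qed

lemma gap_sum_telescope:
  fixes f :: "real \<Rightarrow> 'v::ab_group_add"
  assumes "finite P" "a \<in> P" "b \<in> P" "P \<subseteq> {a..b}"
  shows "gap_sum P (\<lambda>x y. f y - f x) = f b - f a"
proof -
  obtain n t where t: "is_partition a b n t" "t ` {..n} = P" using partition_of_set[OF assms] .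
  show ?thesis using gap_sum_partition[OF t(1), of "\<lambda>x y. f y - f x"] t
      sum_lessThan_telescope[of "\<lambda>k. f (t k)" n]
    by (simp add: is_partition_def)
qed

lemma gap_sum_cong:
  assumes "\<And>x y. (x, y) \<in> gaps P \<Longrightarrow> h x y = h' x y"
  shows "gap_sum P h = gap_sum P h'"
  unfolding gap_sum_def using assms by (auto intro: sum.cong)

text \<open>The removed points may not be neighbours of each other: then every deletion still merges the two
  intervals at \<open>x\<close> that were there initially, and the changes add up independently.\<close>

lemma gap_sum_remove:
  fixes h :: "real \<Rightarrow> real \<Rightarrow> 'v::ab_group_add"
  assumes "finite P" "S \<subseteq> P"
    and "\<And>x. x \<in> S \<Longrightarrow> (lo x, x) \<in> gaps P \<and> (x, hi x) \<in> gaps P"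
    and "\<And>x. x \<in> S \<Longrightarrow> lo x \<notin> S \<and> hi x \<notin> S"
  shows "gap_sum P h - gap_sum (P - S) h = (\<Sum>x\<in>S. h (lo x) x + h x (hi x) - h (lo x) (hi x))"
proof -
  have "finite S" using assms finite_subset by blast
  then show ?thesis using assms(2-)
  proof (induction S)
    case (insert x S)
    let ?P = "P - insert x S"
    have IH: "gap_sum P h - gap_sum (P - S) h = (\<Sum>x\<in>S. h (lo x) x + h x (hi x) - h (lo x) (hi x))"
      by (rule insert.IH) (use insert.prems in auto)
    have eq: "P - S = insert x ?P" using insert by auto
    have l: "(lo x, x) \<in> gaps P" "(x, hi x) \<in> gaps P" "lo x \<notin> insert x S" "hi x \<notin> insert x S"
      using insert.prems(2,3)[of x] by auto
    have "(lo x, hi x) \<in> gaps ?P"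
    proof (rule gapsI)
      fix z assume "z \<in> ?P"
      then show "z \<le> lo x \<or> hi x \<le> z"
        using gapsD(4)[OF l(1), of z] gapsD(4)[OF l(2), of z] by auto
    qed (use l gapsD[OF l(1)] gapsD[OF l(2)] in auto)
    then have "gap_sum (P - S) h = gap_sum ?P h - h (lo x) (hi x) + h (lo x) x + h x (hi x)"
      unfolding eq using gapsD[OF l(1)] gapsD[OF l(2)] assms(1) by (intro gap_sum_insert) auto
    then show ?case using IH insert.hyps by (simp add: algebra_simps)
  qed simp
qed

text \<open>Additivity of \<open>h\<close> is only demanded inside the intervals of the coarse partition, so that the
  lemma applies to integrands that are constant on those intervals.\<close>

lemma gap_sum_refine:
  fixes h :: "real \<Rightarrow> real \<Rightarrow> 'v::ab_group_add"
  assumes "finite P'" "P \<subseteq> P'" "a \<in> P" "b \<in> P" "P' \<subseteq> {a..b}"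
    and add: "\<And>x y u v w. (x, y) \<in> gaps P \<Longrightarrow> x \<le> u \<Longrightarrow> u < v \<Longrightarrow> v < w \<Longrightarrow> w \<le> y \<Longrightarrow>
      h u w = h u v + h v w"
  shows "gap_sum P' h = gap_sum P h"
proof -
  have P: "finite P" "P \<subseteq> {a..b}" using assms finite_subset by blast+
  have "gap_sum (P \<union> Z) h = gap_sum P h" if "finite Z" "Z \<subseteq> {a..b} - P" for Z
    using that
  proof (induction Z rule: finite_induct)
    case (insert z Z)
    let ?Q = "P \<union> Z"
    have z: "a < z" "z < b" "z \<notin> ?Q" using insert assms(3,4) by (auto simp: less_le)
    obtain w y where wy: "(w, y) \<in> gaps ?Q" "w < z" "z \<le> y"
      using gap_containing[of ?Q a z b] P insert z assms by auto
    have "z < y" using wy z gapsD(2)[OF wy(1)] by (auto simp: less_le)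
    obtain w' y' where wy': "(w', y') \<in> gaps P" "w' < z" "z \<le> y'"
      using gap_containing[of P a z b] P z assms by auto
    have "w' \<le> w" "y \<le> y'"
      using gapsD(4)[OF wy(1), of w'] gapsD(4)[OF wy(1), of y'] gapsD(1,2)[OF wy'(1)] wy wy' by auto
    then have "h w y = h w z + h z y" using add[OF wy'(1), of w z y] wy \<open>z < y\<close> by auto
    moreover have "gap_sum (insert z ?Q) h = gap_sum ?Q h - h w y + h w z + h z y"
      using P insert wy \<open>z < y\<close> by (intro gap_sum_insert) auto
    ultimately show ?case using insert by (simp add: algebra_simps)
  qed simp
  from this[of "P' - P"] show ?thesis using assms by (auto simp: Un_absorb1)
qed

section \<open>Variation over disjoint families of intervals\<close>

text \<open>The \<open>p\<close>-th power of the \<open>p\<close>-variation, which is the quantity that bounds sums.\<close>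

definition pvar :: "real \<Rightarrow> (real \<Rightarrow> real \<Rightarrow> real) \<Rightarrow> real" where
  "pvar p R = real_of_ereal (variation2 p R) powr p"

definition disjoint_intervals :: "'i set \<Rightarrow> ('i \<Rightarrow> real) \<Rightarrow> ('i \<Rightarrow> real) \<Rightarrow> bool" where
  "disjoint_intervals I a b \<longleftrightarrow>
     (\<forall>i\<in>I. 0 \<le> a i \<and> a i \<le> b i \<and> b i \<le> 1) \<and>
     (\<forall>i\<in>I. \<forall>j\<in>I. i \<noteq> j \<longrightarrow> b i \<le> a j \<or> b j \<le> a i)"

lemma pvar_nonneg: "0 \<le> pvar p R"
  by (simp add: pvar_def)

lemma partition_sum_le_pvar:
  assumes "finite_variation2 p R" "p \<ge> 1" "is_partition 0 1 n t" "is_partition 0 1 m u"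
  shows "(\<Sum>k<n. \<Sum>l<m. \<bar>rect_incr R (t k) (t (Suc k)) (u l) (u (Suc l))\<bar> powr p) \<le> pvar p R"
    (is "?S \<le> _")
proof -
  have "ereal (?S powr (1 / p)) \<le> variation2 p R"
    unfolding variation2_def using assms(3,4) by (intro Sup_upper) blast
  with assms(1) have "?S powr (1 / p) \<le> real_of_ereal (variation2 p R)"
    unfolding finite_variation2_def
    by (cases "variation2 p R") auto
  then have "(?S powr (1 / p)) powr p \<le> pvar p R"
    unfolding pvar_def using assms(2) by (intro powr_mono2) auto
  moreover have "?S \<ge> 0" by (intro sum_nonneg) auto
  ultimately show ?thesis using assms(2) by (simp add: powr_powr)
qed

lemma sum_le_gap_sum:
  fixes h :: "real \<Rightarrow> real \<Rightarrow> real"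
  assumes "finite P" "\<And>i. i \<in> I \<Longrightarrow> (a i, b i) \<in> gaps P" "inj_on (\<lambda>i. (a i, b i)) I"
    and "\<And>x y. (x, y) \<in> gaps P \<Longrightarrow> 0 \<le> h x y"
  shows "(\<Sum>i\<in>I. h (a i) (b i)) \<le> gap_sum P h"
proof -
  have "(\<Sum>i\<in>I. h (a i) (b i)) = (\<Sum>(x, y)\<in>(\<lambda>i. (a i, b i)) ` I. h x y)"
    using assms(3) by (simp add: sum.reindex)
  also have "\<dots> \<le> gap_sum P h"
    unfolding gap_sum_def using assms by (intro sum_mono2) auto
  finally show ?thesis .
qed

lemma rect_incr_degenerate [simp]: "rect_incr R x x c d = 0" "rect_incr R a b x x = 0"
  by (simp_all add: rect_incr_def)

text \<open>The supremum in the definition of the variation runs over full partitions of the unit interval. Any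
  finite family of disjoint intervals consists of intervals of one such partition, namely the one formed by all
  endpoints; degenerate intervals contribute nothing.\<close>

lemma disjoint_sum_le_pvar:
  assumes R: "finite_variation2 p R" "p \<ge> 1" and I: "finite I" "disjoint_intervals I a b"
  shows "(\<Sum>i\<in>I. \<Sum>j\<in>I. \<bar>rect_incr R (a i) (b i) (a j) (b j)\<bar> powr p) \<le> pvar p R"
proof -
  \<comment> \<open>Degenerate intervals would not be gaps of the partition formed by the endpoints.\<close>
  define J where "J = {i\<in>I. a i < b i}"
  define P where "P = {0, 1} \<union> a ` J \<union> b ` J"
  have dis: "b i \<le> a j \<or> b j \<le> a i" if "i \<in> I" "j \<in> I" "i \<noteq> j" for i j
    using I(2) that by (auto simp: disjoint_intervals_def)
  have bd: "0 \<le> a i" "a i \<le> b i" "b i \<le> 1" if "i \<in> I" for i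
    using I(2) that by (auto simp: disjoint_intervals_def)
  have P: "finite P" "0 \<in> P" "1 \<in> P" "P \<subseteq> {0..1}"
    using I(1) bd by (force simp: P_def J_def)+
  obtain n t where t: "is_partition 0 1 n t" "t ` {..n} = P" using partition_of_set[OF P] .
  have gap: "(a i, b i) \<in> gaps P" if i: "i \<in> J" for i
  proof (rule gapsI)
    fix z assume "z \<in> P"
    then consider "z = 0" | "z = 1" | j where "j \<in> J" "z = a j" | j where "j \<in> J" "z = b j"
      by (auto simp: P_def)
    then show "z \<le> a i \<or> b i \<le> z"
    proof cases
      case 3 then show ?thesis using dis[of i j] bd[of i] bd[of j] i by (cases "i = j") (auto simp: J_def)
    next
      case 4 then show ?thesis using dis[of i j] bd[of i] bd[of j] i by (cases "i = j") (auto simp: J_def)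
    qed (use bd[of i] i in \<open>auto simp: J_def\<close>)
  qed (use i in \<open>auto simp: P_def J_def\<close>)
  have inj: "inj_on (\<lambda>i. (a i, b i)) J"
    using dis by (force intro!: inj_onI simp: J_def)
  define h where "h x y x' y' = \<bar>rect_incr R x y x' y'\<bar> powr p" for x y x' y'
  have h: "h x y x' y' \<ge> 0" for x y x' y' by (simp add: h_def)
  have "(\<Sum>i\<in>I. \<Sum>j\<in>I. h (a i) (b i) (a j) (b j)) = (\<Sum>i\<in>J. \<Sum>j\<in>J. h (a i) (b i) (a j) (b j))"
  proof -
    have deg: "h (a i) (b i) x y = 0" "h x y (a i) (b i) = 0" if "i \<in> I - J" for i x y
      using that bd[of i] by (auto simp: J_def h_def)
    have sub: "J \<subseteq> I" by (auto simp: J_def)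
    have "(\<Sum>i\<in>I. \<Sum>j\<in>I. h (a i) (b i) (a j) (b j)) = (\<Sum>i\<in>J. \<Sum>j\<in>I. h (a i) (b i) (a j) (b j))"
      by (rule sum.mono_neutral_right[OF I(1) sub]) (simp add: deg)
    also have "\<dots> = (\<Sum>i\<in>J. \<Sum>j\<in>J. h (a i) (b i) (a j) (b j))"
      by (rule sum.cong[OF refl], rule sum.mono_neutral_right[OF I(1) sub]) (simp add: deg)
    finally show ?thesis .
  qed
  also have "\<dots> \<le> (\<Sum>i\<in>J. gap_sum P (h (a i) (b i)))"
    using P gap inj h by (intro sum_mono sum_le_gap_sum) auto
  also have "\<dots> \<le> gap_sum P (\<lambda>x y. gap_sum P (h x y))"
    using P gap inj h by (intro sum_le_gap_sum) (auto simp: gap_sum_def intro!: sum_nonneg)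
  also have "\<dots> = (\<Sum>k<n. \<Sum>l<n. h (t k) (t (Suc k)) (t l) (t (Suc l)))"
    unfolding t(2)[symmetric] gap_sum_partition[OF t(1)] ..
  also have "\<dots> \<le> pvar p R"
    unfolding h_def by (rule partition_sum_le_pvar[OF R t(1) t(1)])
  finally show ?thesis by (simp add: h_def)
qed

text \<open>Raising the exponent makes the sum small as soon as all increments are small.\<close>

lemma disjoint_sum_powr_le_interpolation:
  assumes R: "finite_variation2 p R" "p \<ge> 1" and I: "finite I" "disjoint_intervals I a b"
    and "p \<le> p'" and small: "\<And>i j. i \<in> I \<Longrightarrow> j \<in> I \<Longrightarrow> \<bar>rect_incr R (a i) (b i) (a j) (b j)\<bar> \<le> w"
  shows "(\<Sum>i\<in>I. \<Sum>j\<in>I. \<bar>rect_incr R (a i) (b i) (a j) (b j)\<bar> powr p')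
           \<le> w powr (p' - p) * pvar p R"
proof -
  let ?r = "\<lambda>i j. \<bar>rect_incr R (a i) (b i) (a j) (b j)\<bar>"
  have "?r i j powr p' \<le> w powr (p' - p) * ?r i j powr p" if "i \<in> I" "j \<in> I" for i j
  proof -
    have "?r i j powr p' = ?r i j powr (p' - p) * ?r i j powr p"
      by (simp flip: powr_add)
    also have "\<dots> \<le> w powr (p' - p) * ?r i j powr p"
      using small[OF that] assms by (intro mult_right_mono powr_mono2) auto
    finally show ?thesis .
  qed
  then have "(\<Sum>i\<in>I. \<Sum>j\<in>I. ?r i j powr p') \<le> (\<Sum>i\<in>I. \<Sum>j\<in>I. w powr (p' - p) * ?r i j powr p)"
    by (intro sum_mono) auto
  also have "\<dots> = w powr (p' - p) * (\<Sum>i\<in>I. \<Sum>j\<in>I. ?r i j powr p)"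
    by (simp add: sum_distrib_left)
  also have "\<dots> \<le> w powr (p' - p) * pvar p R"
    by (intro mult_left_mono disjoint_sum_le_pvar R I) auto
  finally show ?thesis .
qed

lemma weighted_am_gm:
  fixes u v :: real
  assumes "0 \<le> u" "0 \<le> v" "0 \<le> \<alpha>" "0 \<le> \<beta>" "\<alpha> + \<beta> = 1"
  shows "u powr \<alpha> * v powr \<beta> \<le> \<alpha> * u + \<beta> * v"
proof (cases "u = 0 \<or> v = 0")
  case False
  then show ?thesis using assms by (intro Youngs_inequality_0) auto
qed (use assms in auto)

text \<open>Hoelder's inequality for exponents with \<open>1/p + 1/q \<ge> 1\<close>. After normalisation all terms
  \<open>x\<^sup>p / A\<close> and \<open>y\<^sup>q / B\<close> are at most 1, so lowering their exponents \<open>1/p\<close> and \<open>1/q\<close> to a pair with sum 1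
  only increases the products.\<close>

lemma sum_mult_le_powr:
  fixes x y :: "'i \<Rightarrow> real"
  assumes "p \<ge> 1" "q \<ge> 1" "1 / p + 1 / q \<ge> 1"
    and "\<And>i. i \<in> I \<Longrightarrow> 0 \<le> x i" "\<And>i. i \<in> I \<Longrightarrow> 0 \<le> y i"
    and "(\<Sum>i\<in>I. x i powr p) \<le> A" "(\<Sum>i\<in>I. y i powr q) \<le> B" "0 < A" "0 < B"
  shows "(\<Sum>i\<in>I. x i * y i) \<le> A powr (1 / p) * B powr (1 / q)"
proof (cases "finite I")
  case fin: True
  define \<theta> where "\<theta> = 1 / p + 1 / q"
  define \<alpha> where "\<alpha> = 1 / p / \<theta>"
  define \<beta> where "\<beta> = 1 / q / \<theta>"
  have \<theta>: "\<theta> \<ge> 1" and ab: "\<alpha> \<ge> 0" "\<beta> \<ge> 0" "\<alpha> + \<beta> = 1" "\<alpha> \<le> 1 / p" "\<beta> \<le> 1 / q"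
    using assms(1-3) by (auto simp: \<theta>_def[symmetric] \<alpha>_def \<beta>_def field_simps)
      (simp add: \<theta>_def field_simps)
  let ?C = "A powr (1 / p) * B powr (1 / q)"
  have pointwise: "x i * y i \<le> ?C * (\<alpha> * (x i powr p / A) + \<beta> * (y i powr q / B))" if i: "i \<in> I" for i
  proof -
    let ?u = "x i powr p / A" and ?v = "y i powr q / B"
    have "x i powr p \<le> (\<Sum>i\<in>I. x i powr p)" "y i powr q \<le> (\<Sum>i\<in>I. y i powr q)"
      using fin i by (auto intro!: member_le_sum)
    then have u: "0 \<le> ?u" "?u \<le> 1" and v: "0 \<le> ?v" "?v \<le> 1" using assms by auto
    have "x i = A powr (1 / p) * ?u powr (1 / p)" "y i = B powr (1 / q) * ?v powr (1 / q)"
      using assms i by (simp_all add: powr_divide powr_powr)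
    then have "x i * y i = (A powr (1 / p) * ?u powr (1 / p)) * (B powr (1 / q) * ?v powr (1 / q))"
      by (rule arg_cong2)
    also have "\<dots> = ?C * (?u powr (1 / p) * ?v powr (1 / q))"
      by (simp only: mult_ac)
    also have "\<dots> \<le> ?C * (?u powr \<alpha> * ?v powr \<beta>)"
      using u v ab by (intro mult_left_mono mult_mono powr_mono') auto
    also have "\<dots> \<le> ?C * (\<alpha> * ?u + \<beta> * ?v)"
      proof (intro mult_left_mono)
      show "?u powr \<alpha> * ?v powr \<beta> \<le> \<alpha> * ?u + \<beta> * ?v"
        using u v ab by (intro weighted_am_gm)
    qed auto
    finally show ?thesis .
  qed
  have "(\<Sum>i\<in>I. x i * y i) \<le> (\<Sum>i\<in>I. ?C * (\<alpha> * (x i powr p / A) + \<beta> * (y i powr q / B)))"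
    using pointwise by (rule sum_mono)
  also have "\<dots> = ?C * (\<alpha> * ((\<Sum>i\<in>I. x i powr p) / A) + \<beta> * ((\<Sum>i\<in>I. y i powr q) / B))"
    by (simp add: sum_distrib_left sum.distrib sum_divide_distrib distrib_left)
  also have "\<dots> \<le> ?C * (\<alpha> * 1 + \<beta> * 1)"
    using assms ab by (intro mult_left_mono add_mono) auto
  finally show ?thesis using ab by simp
qed simp

section \<open>The Young estimate in the tensor square\<close>

text \<open>The Hilbert-space picture of a process with covariance function \<open>R\<close>. Since increments alone are
  prescribed, the curve is determined up to isometry and translation.\<close>

definition increment_curve :: "(real \<Rightarrow> 'h::real_inner) \<Rightarrow> (real \<Rightarrow> real \<Rightarrow> real) \<Rightarrow> bool" where
  "increment_curve e R \<longleftrightarrow> (\<forall>a\<in>{0..1}. \<forall>b\<in>{0..1}. \<forall>c\<in>{0..1}. \<forall>d\<in>{0..1}.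
     inner (e b - e a) (e d - e c) = rect_incr R a b c d)"

lemma gaps_disjoint_intervals:
  assumes "P \<subseteq> {0..1}" "\<And>i. i \<in> I \<Longrightarrow> (a i, b i) \<in> gaps P" "inj_on (\<lambda>i. (a i, b i)) I"
  shows "disjoint_intervals I a b"
  unfolding disjoint_intervals_def
proof (intro conjI ballI impI)
  fix i j assume "i \<in> I" "j \<in> I" "i \<noteq> j"
  then show "b i \<le> a j \<or> b j \<le> a i"
    using gaps_disjoint[OF assms(2,2)] assms(3) by (auto dest: inj_onD)
qed (use assms(1) gapsD[OF assms(2)] in \<open>force+\<close>)

lemma gaps_mesh:
  assumes "finite P" "Q \<subseteq> P" "a \<in> Q" "b \<in> Q" "P \<subseteq> {a..b}"
    and "\<And>x y. (x, y) \<in> gaps Q \<Longrightarrow> y - x < \<delta>" "(x, y) \<in> gaps P"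
  shows "y - x < \<delta>"
proof -
  from gap_in_coarser[OF assms(1-5,7)] obtain w z where "(w, z) \<in> gaps Q" "w \<le> x" "y \<le> z" .
  then show ?thesis using assms(6)[of w z] by linarith
qed

lemma tensor_bilinear: "hilbert_tensor_square T \<Longrightarrow> bilinear T"
  by (simp add: hilbert_tensor_square_def)

lemma tensor_inner:
  "hilbert_tensor_square T \<Longrightarrow> inner (T a b) (T c d) = inner a c * inner b d"
  by (simp add: hilbert_tensor_square_def)

text \<open>Orthogonal expansion of the squared norm: this is where the two-dimensional increments of both covariances
  enter, and with them the cancellation that the triangle inequality would lose.\<close>

lemma norm_tensor_sum_le:
  assumes T: "hilbert_tensor_square T"
    and e: "increment_curve e R1" and f: "increment_curve f R2"
    and I: "disjoint_intervals I a b" "disjoint_intervals I c d"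
  shows "(norm (\<Sum>i\<in>I. T (e (b i) - e (a i)) (f (d i) - f (c i))))\<^sup>2 \<le>
    (\<Sum>i\<in>I. \<Sum>j\<in>I. \<bar>rect_incr R1 (a i) (b i) (a j) (b j)\<bar> * \<bar>rect_incr R2 (c i) (d i) (c j) (d j)\<bar>)"
proof -
  have 1: "a i \<in> {0..1}" "b i \<in> {0..1}" "c i \<in> {0..1}" "d i \<in> {0..1}" if "i \<in> I" for i
    using I that by (auto simp: disjoint_intervals_def intro: order_trans)
  have "(norm (\<Sum>i\<in>I. T (e (b i) - e (a i)) (f (d i) - f (c i))))\<^sup>2 =
    (\<Sum>i\<in>I. \<Sum>j\<in>I. rect_incr R1 (a i) (b i) (a j) (b j) * rect_incr R2 (c i) (d i) (c j) (d j))"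
    unfolding power2_norm_eq_inner inner_sum_left inner_sum_right tensor_inner[OF T]
    using e f 1 by (subst sum.swap, intro sum.cong refl) (simp add: increment_curve_def)
  also have "\<dots> \<le> (\<Sum>i\<in>I. \<Sum>j\<in>I. \<bar>rect_incr R1 (a i) (b i) (a j) (b j)\<bar> * \<bar>rect_incr R2 (c i) (d i) (c j) (d j)\<bar>)"
    by (intro sum_mono) (metis abs_ge_self abs_mult)
  finally show ?thesis .
qed

text \<open>Markov's inequality for the counting measure.\<close>

lemma card_above_average:
  fixes \<alpha> :: "'i \<Rightarrow> real"
  assumes "finite U" "\<And>x. x \<in> U \<Longrightarrow> 0 \<le> \<alpha> x" "sum \<alpha> U \<le> A" "0 < A" "U \<noteq> {}"
  shows "4 * card {x\<in>U. \<alpha> x > 4 * A / card U} \<le> card U"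
proof -
  let ?B = "{x\<in>U. \<alpha> x > 4 * A / card U}"
  have N: "card U > 0" using assms by (simp add: card_gt_0_iff)
  have "card ?B * (4 * A / card U) \<le> sum \<alpha> ?B"
    using sum_bounded_below[of ?B "4 * A / card U" \<alpha>] by simp
  also have "\<dots> \<le> sum \<alpha> U" using assms by (intro sum_mono2) auto
  finally have "card ?B * (4 * A / card U) \<le> A" using assms by simp
  then have "A * (4 * card ?B) \<le> A * card U" using N by (simp add: field_simps)
  then have "real (4 * card ?B) \<le> card U" using assms(4) by (subst (asm) mult_le_cancel_left_pos) auto
  then show ?thesis by linarith
qed

definition left_sum ::
    "('h::real_vector \<Rightarrow> 'h \<Rightarrow> 'k::real_vector) \<Rightarrow> (real \<Rightarrow> 'h) \<Rightarrow> (real \<Rightarrow> 'h) \<Rightarrow> real set \<Rightarrow> 'k" where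
  "left_sum T e f P = gap_sum P (\<lambda>x y. T (e x) (f y - f x))"

text \<open>One round of simultaneous removal. The set \<open>S\<close> consists of points of \<open>P - Q\<close> whose row sums for both
  covariances are at most four times the average. At most half of the points violate one of the two bounds, and
  of the remaining ones at least half have the same parity of position in \<open>P\<close>, which excludes neighbours.\<close>

lemma young_removal:
  fixes p q A B :: real and P Q :: "real set"
  defines "\<theta> \<equiv> 1 / p + 1 / q"
  defines "C \<equiv> sqrt (A powr (1 / p) * B powr (1 / q) * 4 powr \<theta>)"
  assumes T: "hilbert_tensor_square T"
    and e: "increment_curve e R1" and f: "increment_curve f R2"
    and pq: "p \<ge> 1" "q \<ge> 1" "\<theta> > 1" and AB: "0 < A" "0 < B"
    and P: "finite P" "Q \<subseteq> P" "a \<in> Q" "b \<in> Q" "P \<subseteq> {a..b}" "0 \<le> a" "b \<le> 1"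
    and mesh: "\<And>x y. (x, y) \<in> gaps P \<Longrightarrow> y - x < \<delta>"
    and R1: "\<And>(S::real set) u v. finite S \<Longrightarrow> disjoint_intervals S u v \<Longrightarrow> (\<And>x. x \<in> S \<Longrightarrow> v x - u x < \<delta>) \<Longrightarrow>
      (\<Sum>x\<in>S. \<Sum>y\<in>S. \<bar>rect_incr R1 (u x) (v x) (u y) (v y)\<bar> powr p) \<le> A"
    and R2: "\<And>(S::real set) u v. finite S \<Longrightarrow> disjoint_intervals S u v \<Longrightarrow>
      (\<Sum>x\<in>S. \<Sum>y\<in>S. \<bar>rect_incr R2 (u x) (v x) (u y) (v y)\<bar> powr q) \<le> B"
    and ne: "P \<noteq> Q"
  obtains S where "S \<subseteq> P - Q" "card (P - Q) \<le> 4 * card S"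
    "norm (left_sum T e f P - left_sum T e f (P - S)) \<le> C * card (P - Q) powr (- ((\<theta> - 1) / 2))"
proof -
  define U where "U = P - Q"
  define N where "N = card U"
  have fin: "finite U" using P by (simp add: U_def)
  have "U \<noteq> {}" using P ne by (auto simp: U_def)
  then have N: "N > 0" using fin by (simp add: N_def card_gt_0_iff)
  have "\<exists>l h. (l, x) \<in> gaps P \<and> (x, h) \<in> gaps P" if "x \<in> U" for x
  proof -
    have x: "a < x" "x < b" "x \<in> P" using that P by (force simp: U_def less_le)+
    obtain l where "(l, x) \<in> gaps P" using gap_below[of P x a] x P by auto
    moreover obtain h where "(x, h) \<in> gaps P" using gap_above[of P x b] x P by auto
    ultimately show ?thesis by blast
  qed
  then obtain lo hi where lohi: "\<And>x. x \<in> U \<Longrightarrow> (lo x, x) \<in> gaps P" "\<And>x. x \<in> U \<Longrightarrow> (x, hi x) \<in> gaps P"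
    by metis
  have P01: "P \<subseteq> {0..1}" using P by auto
  have dis: "disjoint_intervals S lo (\<lambda>x. x)" "disjoint_intervals S (\<lambda>x. x) hi" if "S \<subseteq> U" for S
    using that lohi by (auto intro!: gaps_disjoint_intervals[OF P01] inj_onI)
  define r1 where "r1 x y = \<bar>rect_incr R1 (lo x) x (lo y) y\<bar>" for x y
  define r2 where "r2 x y = \<bar>rect_incr R2 x (hi x) y (hi y)\<bar>" for x y
  define \<alpha> where "\<alpha> x = (\<Sum>y\<in>U. r1 x y powr p)" for x
  define \<beta> where "\<beta> x = (\<Sum>y\<in>U. r2 x y powr q)" for x
  have "sum \<alpha> U \<le> A"
    unfolding \<alpha>_def r1_def by (rule R1) (use fin dis lohi mesh in auto)
  moreover have "sum \<beta> U \<le> B"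
    unfolding \<beta>_def r2_def by (rule R2) (use fin dis in auto)
  moreover have ab0: "\<alpha> x \<ge> 0" "\<beta> x \<ge> 0" for x by (auto simp: \<alpha>_def \<beta>_def intro!: sum_nonneg)
  ultimately have bad: "4 * card {x\<in>U. \<alpha> x > 4 * A / N} \<le> N" "4 * card {x\<in>U. \<beta> x > 4 * B / N} \<le> N"
    unfolding N_def using fin AB \<open>U \<noteq> {}\<close> by (auto intro!: card_above_average)
  define G where "G = {x\<in>U. \<alpha> x \<le> 4 * A / N \<and> \<beta> x \<le> 4 * B / N}"
  have "U = G \<union> ({x\<in>U. \<alpha> x > 4 * A / N} \<union> {x\<in>U. \<beta> x > 4 * B / N})"
    by (auto simp: G_def)
  then have "N \<le> card G + (card {x\<in>U. \<alpha> x > 4 * A / N} + card {x\<in>U. \<beta> x > 4 * B / N})"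
    unfolding N_def by (metis (no_types, lifting) card_Un_le add_left_mono order_trans)
  with bad have G: "N \<le> 2 * card G" by linarith
  \<comment> \<open>The position of a point in \<open>P\<close>; neighbouring points have positions of opposite parity.\<close>
  define rk where "rk x = card {y\<in>P. y < x}" for x
  have rk: "rk y = Suc (rk x)" if "(x, y) \<in> gaps P" for x y
  proof -
    have "{z\<in>P. z < y} = insert x {z\<in>P. z < x}" using gapsD[OF that] by force
    then show ?thesis using P(1) by (simp add: rk_def)
  qed
  have finG: "finite G" using fin by (simp add: G_def)
  have "G = {x\<in>G. even (rk x)} \<union> {x\<in>G. odd (rk x)}" by auto
  then have "card G \<le> card {x\<in>G. even (rk x)} + card {x\<in>G. odd (rk x)}"
    by (metis card_Un_le)
  then have "N \<le> 4 * card {x\<in>G. even (rk x)} \<or> N \<le> 4 * card {x\<in>G. odd (rk x)}"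
    using G by linarith
  then obtain z where z: "N \<le> 4 * card {x\<in>G. even (rk x) = z}"
    by (elim disjE) (use that[of True] that[of False] in simp_all)
  define S where "S = {x\<in>G. even (rk x) = z}"
  have S: "S \<subseteq> G" "S \<subseteq> U" "finite S" using fin by (auto simp: S_def G_def)
  have nonadj: "lo x \<notin> S \<and> hi x \<notin> S" if "x \<in> S" for x
    using rk[OF lohi(1)[of x]] rk[OF lohi(2)[of x]] that S by (auto simp: S_def)
  note bil = tensor_bilinear[OF T]
  have "left_sum T e f P - left_sum T e f (P - S) =
      (\<Sum>x\<in>S. T (e x - e (lo x)) (f (hi x) - f x))"
    unfolding left_sum_def
  proof (subst gap_sum_remove[where lo = lo and hi = hi])
    show "S \<subseteq> P" using S by (auto simp: U_def)
    show "(lo x, x) \<in> gaps P \<and> (x, hi x) \<in> gaps P" if "x \<in> S" for x using lohi that S by auto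
    show "(\<Sum>x\<in>S. T (e (lo x)) (f x - f (lo x)) + T (e x) (f (hi x) - f x) - T (e (lo x)) (f (hi x) - f (lo x))) =
        (\<Sum>x\<in>S. T (e x - e (lo x)) (f (hi x) - f x))"
      by (intro sum.cong refl) (simp add: bilinear_lsub[OF bil] bilinear_rsub[OF bil])
  qed (use nonadj P(1) in auto)
  then have "(norm (left_sum T e f P - left_sum T e f (P - S)))\<^sup>2 \<le> (\<Sum>x\<in>S. \<Sum>y\<in>S. r1 x y * r2 x y)"
    using norm_tensor_sum_le[OF T e f dis[OF S(2)]] by (simp add: r1_def r2_def)
  also have "\<dots> \<le> (\<Sum>x\<in>S. (4 * A / N) powr (1 / p) * (4 * B / N) powr (1 / q))"
  proof (rule sum_mono)
    fix x assume x: "x \<in> S"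
    \<comment> \<open>Hoelder is applied row by row; the row bounds then give the extra factor \<open>N\<close> to the power \<open>1 - \<theta>\<close>.\<close>
    have "(\<Sum>y\<in>S. r1 x y powr p) \<le> \<alpha> x" "(\<Sum>y\<in>S. r2 x y powr q) \<le> \<beta> x"
      unfolding \<alpha>_def \<beta>_def using S fin by (auto intro!: sum_mono2)
    moreover have "\<alpha> x \<le> 4 * A / N" "\<beta> x \<le> 4 * B / N" using x S by (auto simp: G_def)
    ultimately show "(\<Sum>y\<in>S. r1 x y * r2 x y) \<le> (4 * A / N) powr (1 / p) * (4 * B / N) powr (1 / q)"
      using pq AB N by (intro sum_mult_le_powr) (auto simp: \<theta>_def r1_def r2_def)
  qed
  also have "\<dots> \<le> N * ((4 * A / N) powr (1 / p) * (4 * B / N) powr (1 / q))"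
    using card_mono[OF fin S(2)] by (simp add: N_def mult_right_mono)
  also have "\<dots> = (C * N powr (- ((\<theta> - 1) / 2)))\<^sup>2"
  proof -
    have "(C * N powr (- ((\<theta> - 1) / 2)))\<^sup>2 = C\<^sup>2 * N powr (1 - \<theta>)"
      using N by (simp add: power_mult_distrib power2_eq_square flip: powr_add)
    also have "C\<^sup>2 = A powr (1 / p) * B powr (1 / q) * (4 powr (1 / p) * 4 powr (1 / q))"
      by (simp add: C_def \<theta>_def powr_add)
    also have "N powr (1 - \<theta>) = N / (N powr (1 / p) * N powr (1 / q))"
      using N by (simp add: \<theta>_def powr_diff powr_add)
    finally show ?thesis using AB N by (simp add: powr_mult powr_divide)
  qed
  finally have "norm (left_sum T e f P - left_sum T e f (P - S)) \<le> C * N powr (- ((\<theta> - 1) / 2))"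
    by (rule power2_le_imp_le) (use AB in \<open>auto simp: C_def\<close>)
  then show thesis using that[of S] S z by (auto simp: U_def N_def S_def)
qed

lemma summable_Suc_powr: "\<gamma> > 0 \<Longrightarrow> summable (\<lambda>i. real (Suc i) powr - (1 + \<gamma>))"
  by (subst summable_Suc_iff) (simp add: summable_real_powr_iff)

text \<open>Iterated removal leads from \<open>P\<close> down to \<open>Q\<close>. A round that reduces the number of removable points from \<open>N\<close> to
  \<open>M \<le> 3N/4\<close> costs a multiple of \<open>N\<close> to the power \<open>-\<gamma>\<close>; it is charged to the segment from \<open>M\<close> to \<open>N\<close> of the
  convergent series of the powers \<open>i\<close> to \<open>-(1 + \<gamma>)\<close>, so the total cost is bounded by the whole series.
  The bounds \<open>R1\<close> and \<open>R2\<close> are stated for families of intervals because the partition changes during the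
  induction; \<open>A\<close> need only bound families of short intervals.\<close>

lemma young_refinement_bound:
  fixes p q A B :: real and P Q :: "real set"
  defines "\<theta> \<equiv> 1 / p + 1 / q"
  defines "C \<equiv> sqrt (A powr (1 / p) * B powr (1 / q) * 4 powr \<theta>)"
  assumes T: "hilbert_tensor_square T"
    and e: "increment_curve e R1" and f: "increment_curve f R2"
    and pq: "p \<ge> 1" "q \<ge> 1" "\<theta> > 1" and AB: "0 < A" "0 < B"
    and P: "finite P" "Q \<subseteq> P" "a \<in> Q" "b \<in> Q" "P \<subseteq> {a..b}" "0 \<le> a" "b \<le> 1"
    and mesh: "\<And>x y. (x, y) \<in> gaps Q \<Longrightarrow> y - x < \<delta>"
    and R1: "\<And>(S::real set) u v. finite S \<Longrightarrow> disjoint_intervals S u v \<Longrightarrow> (\<And>x. x \<in> S \<Longrightarrow> v x - u x < \<delta>) \<Longrightarrow>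
      (\<Sum>x\<in>S. \<Sum>y\<in>S. \<bar>rect_incr R1 (u x) (v x) (u y) (v y)\<bar> powr p) \<le> A"
    and R2: "\<And>(S::real set) u v. finite S \<Longrightarrow> disjoint_intervals S u v \<Longrightarrow>
      (\<Sum>x\<in>S. \<Sum>y\<in>S. \<bar>rect_incr R2 (u x) (v x) (u y) (v y)\<bar> powr q) \<le> B"
  shows "norm (left_sum T e f P - left_sum T e f Q) \<le> 4 * C * (\<Sum>i. real (Suc i) powr - (1 + (\<theta> - 1) / 2))"
proof -
  define \<gamma> where "\<gamma> = (\<theta> - 1) / 2"
  define s where "s N = (\<Sum>i<N. real (Suc i) powr - (1 + \<gamma>))" for N :: nat
  have C: "C \<ge> 0" using AB by (simp add: C_def)
  have "norm (left_sum T e f P - left_sum T e f Q) \<le> 4 * C * s (card (P - Q))"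
    using P(1,2,5)
  proof (induction "card (P - Q)" arbitrary: P rule: less_induct)
    case (less P)
    show ?case
    proof (cases "P = Q")
      case False
      have "\<And>x y. (x, y) \<in> gaps P \<Longrightarrow> y - x < \<delta>"
        by (rule gaps_mesh[of P Q a b]) (use less.prems P(3,4) mesh in auto)
      from young_removal[OF T e f pq[unfolded \<theta>_def] AB less.prems(1,2) P(3,4) less.prems(3) P(6,7) this R1 R2 False]
      obtain S where S: "S \<subseteq> P - Q" "card (P - Q) \<le> 4 * card S"
        "norm (left_sum T e f P - left_sum T e f (P - S)) \<le> C * card (P - Q) powr (- \<gamma>)"
        unfolding \<theta>_def[symmetric] C_def[symmetric] \<gamma>_def by blast
      let ?N = "card (P - Q)" and ?M = "card (P - S - Q)"
      have fin: "finite S" using S(1) less.prems(1) finite_subset by blast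
      have eq: "P - S - Q = P - Q - S" by auto
      have M: "?M = ?N - card S" "card S \<le> ?N"
        unfolding eq using S(1) less.prems(1) fin by (auto intro: card_mono card_Diff_subset)
      have "?N > 0" using False less.prems by (auto simp: card_gt_0_iff)
      with S(2) M have "?M < ?N" by linarith
      then have "norm (left_sum T e f (P - S) - left_sum T e f Q) \<le> 4 * C * s ?M"
        using less.prems S(1) by (intro less.hyps) auto
      then have "norm (left_sum T e f P - left_sum T e f Q) \<le> 4 * C * s ?M + C * ?N powr (- \<gamma>)"
        using S(3) norm_triangle_ineq[of "left_sum T e f P - left_sum T e f (P - S)"
            "left_sum T e f (P - S) - left_sum T e f Q"] by simp
      also have "\<dots> \<le> 4 * C * s ?N"
      proof -
        have "(?N / 4) * ?N powr - (1 + \<gamma>) \<le> (\<Sum>i\<in>{?M..<?N}. ?N powr - (1 + \<gamma>))"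
        proof -
          have "real ?N / 4 \<le> card S" using S(2) by linarith
          then have "?N / 4 * ?N powr - (1 + \<gamma>) \<le> card S * ?N powr - (1 + \<gamma>)"
            by (rule mult_right_mono) simp
          then show ?thesis using M by simp
        qed
        also have "\<dots> \<le> (\<Sum>i\<in>{?M..<?N}. real (Suc i) powr - (1 + \<gamma>))"
          using pq by (intro sum_mono powr_mono2') (auto simp: \<gamma>_def)
        also have "\<dots> = s ?N - s ?M"
          using sum_diff_nat_ivl[of 0 ?M ?N "\<lambda>i. real (Suc i) powr - (1 + \<gamma>)"] \<open>?M < ?N\<close>
          by (simp add: s_def lessThan_atLeast0)
        also have "(?N / 4) * ?N powr - (1 + \<gamma>) = ?N powr - \<gamma> / 4"
          using \<open>?N > 0\<close> by (simp add: powr_diff powr_minus field_simps powr_add)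
        finally have "?N powr - \<gamma> \<le> 4 * (s ?N - s ?M)" by simp
        from mult_left_mono[OF this C] show ?thesis by (simp add: algebra_simps)
      qed
      finally show ?thesis .
    qed (simp add: s_def)
  qed
  also have "\<dots> \<le> 4 * C * (\<Sum>i. real (Suc i) powr - (1 + \<gamma>))"
  proof -
    have "summable (\<lambda>i. real (Suc i) powr - (1 + \<gamma>))"
      using pq by (intro summable_Suc_powr) (simp add: \<gamma>_def)
    then have "s (card (P - Q)) \<le> (\<Sum>i. real (Suc i) powr - (1 + \<gamma>))"
      unfolding s_def by (rule sum_le_suminf) auto
    then show ?thesis using C by (intro mult_left_mono) auto
  qed
  finally show ?thesis by (simp add: \<gamma>_def)
qed

section \<open>Norm convergence of tensor-valued Riemann sums\<close>

definition tagged_sum :: "('h::real_vector \<Rightarrow> 'h \<Rightarrow> 'k::real_vector) \<Rightarrow> (real \<Rightarrow> 'h) \<Rightarrow> (real \<Rightarrow> 'h) \<Rightarrow>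
    nat \<Rightarrow> (nat \<Rightarrow> real) \<Rightarrow> (nat \<Rightarrow> real) \<Rightarrow> 'k" where
  "tagged_sum T e f n t \<xi> = (\<Sum>k<n. T (e (\<xi> k)) (f (t (Suc k)) - f (t k)))"

text \<open>\<open>L\<close> is the integral of \<open>e\<close> against \<open>df\<close> over \<open>[a,b]\<close>, with the tensor product as multiplication.\<close>

definition has_tensor_integral :: "('h::real_normed_vector \<Rightarrow> 'h \<Rightarrow> 'k::real_normed_vector) \<Rightarrow>
    (real \<Rightarrow> 'h) \<Rightarrow> (real \<Rightarrow> 'h) \<Rightarrow> real \<Rightarrow> real \<Rightarrow> 'k \<Rightarrow> bool" where
  "has_tensor_integral T e f a b L \<longleftrightarrow>
     (\<forall>\<epsilon>>0. \<exists>\<delta>>0. \<forall>n t \<xi>. fine_tagged \<delta> a b n t \<xi> \<longrightarrow> norm (tagged_sum T e f n t \<xi> - L) < \<epsilon>)"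

lemma left_sum_partition:
  "is_partition a b n t \<Longrightarrow> left_sum T e f (t ` {..n}) = tagged_sum T e f n t t"
  by (simp add: left_sum_def tagged_sum_def gap_sum_partition)

lemma uniform_partition:
  fixes a b :: real and n :: nat
  assumes "a < b" "n > 0"
  shows "is_partition a b n (\<lambda>k. a + (b - a) * k / n)"
  using assms by (auto simp: is_partition_def field_simps)

lemma fine_tagged_uniform:
  fixes a b :: real and n :: nat
  assumes "a < b" "n > 0" "(b - a) / n < \<delta>"
  shows "fine_tagged \<delta> a b n (\<lambda>k. a + (b - a) * k / n) (\<lambda>k. a + (b - a) * k / n)"
proof -
  have "a + (b - a) * real (Suc k) / n - (a + (b - a) * k / n) = (b - a) / n" for k
    by (simp add: add_divide_distrib diff_divide_distrib algebra_simps)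
  then show ?thesis
    using assms uniform_partition[OF assms(1,2)] by (auto simp: fine_tagged_def divide_right_mono)
qed

lemma fine_tagged_mono: "fine_tagged \<delta> a b n t \<xi> \<Longrightarrow> \<delta> \<le> \<delta>' \<Longrightarrow> fine_tagged \<delta>' a b n t \<xi>"
  by (force simp: fine_tagged_def)

text \<open>The limit is found along the uniform partitions.\<close>

lemma convergent_if_cauchy_mesh:
  fixes S :: "nat \<Rightarrow> (nat \<Rightarrow> real) \<Rightarrow> (nat \<Rightarrow> real) \<Rightarrow> 'k::{real_normed_vector, complete_space}"
  assumes "a < b"
    and cauchy: "\<And>\<epsilon>. \<epsilon> > 0 \<Longrightarrow> \<exists>\<delta>>0. \<forall>n t \<xi> m u \<eta>. fine_tagged \<delta> a b n t \<xi> \<longrightarrow> fine_tagged \<delta> a b m u \<eta> \<longrightarrow>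
      norm (S n t \<xi> - S m u \<eta>) \<le> \<epsilon>"
  shows "\<exists>L. \<forall>\<epsilon>>0. \<exists>\<delta>>0. \<forall>n t \<xi>. fine_tagged \<delta> a b n t \<xi> \<longrightarrow> norm (S n t \<xi> - L) < \<epsilon>"
proof -
  define t where "t m k = a + (b - a) * real k / real (Suc m)" for m k
  define x where "x m = S (Suc m) (t m) (t m)" for m
  have ev: "eventually (\<lambda>m. fine_tagged \<delta> a b (Suc m) (t m) (t m)) sequentially" if "\<delta> > 0" for \<delta>
  proof -
    have "(\<lambda>m. (b - a) / real (Suc m)) \<longlonglongrightarrow> 0"
      by (rule real_tendsto_divide_at_top[OF tendsto_const])
        (rule filterlim_compose[OF filterlim_real_sequentially filterlim_Suc])
    then have "eventually (\<lambda>m. (b - a) / real (Suc m) < \<delta>) sequentially"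
      using that by (rule order_tendstoD)
    then show ?thesis
      unfolding t_def
      by eventually_elim (rule fine_tagged_uniform[OF assms(1)], simp_all)
  qed
  have "Cauchy x"
  proof (rule metric_CauchyI)
    fix \<epsilon> :: real assume "\<epsilon> > 0"
    then obtain \<delta> where \<delta>: "\<delta> > 0" "\<And>n t \<xi> m u \<eta>. fine_tagged \<delta> a b n t \<xi> \<Longrightarrow> fine_tagged \<delta> a b m u \<eta> \<Longrightarrow>
      norm (S n t \<xi> - S m u \<eta>) \<le> \<epsilon> / 2" using cauchy[of "\<epsilon> / 2"] by auto
    obtain M where "\<And>m. m \<ge> M \<Longrightarrow> fine_tagged \<delta> a b (Suc m) (t m) (t m)"
      using ev[OF \<delta>(1)] by (auto simp: eventually_sequentially)
    then have "dist (x m) (x n) < \<epsilon>" if "m \<ge> M" "n \<ge> M" for m n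
      using \<delta>(2)[of "Suc m" "t m" "t m" "Suc n" "t n" "t n"] that \<open>\<epsilon> > 0\<close>
      by (fastforce simp: x_def dist_norm)
    then show "\<exists>M. \<forall>m\<ge>M. \<forall>n\<ge>M. dist (x m) (x n) < \<epsilon>" by blast
  qed
  then obtain L where L: "x \<longlonglongrightarrow> L" using Cauchy_convergent unfolding convergent_def by blast
  show ?thesis
  proof (intro exI[of _ L] allI impI)
    fix \<epsilon> :: real assume "\<epsilon> > 0"
    then obtain \<delta> where \<delta>: "\<delta> > 0" "\<And>n t \<xi> m u \<eta>. fine_tagged \<delta> a b n t \<xi> \<Longrightarrow> fine_tagged \<delta> a b m u \<eta> \<Longrightarrow>
      norm (S n t \<xi> - S m u \<eta>) \<le> \<epsilon> / 2" using cauchy[of "\<epsilon> / 2"] by auto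
    have "norm (S n s \<xi> - L) \<le> \<epsilon> / 2" if s: "fine_tagged \<delta> a b n s \<xi>" for n s \<xi>
    proof (rule tendsto_upperbound)
      show "(\<lambda>m. norm (S n s \<xi> - x m)) \<longlonglongrightarrow> norm (S n s \<xi> - L)" by (intro tendsto_intros L)
      show "eventually (\<lambda>m. norm (S n s \<xi> - x m) \<le> \<epsilon> / 2) sequentially"
        using ev[OF \<delta>(1)] by eventually_elim (use \<delta>(2)[OF s] in \<open>simp add: x_def\<close>)
    qed simp
    then have "\<forall>n t \<xi>. fine_tagged \<delta> a b n t \<xi> \<longrightarrow> norm (S n t \<xi> - L) < \<epsilon>"
      using \<open>\<epsilon> > 0\<close> by fastforce
    then show "\<exists>\<delta>>0. \<forall>n t \<xi>. fine_tagged \<delta> a b n t \<xi> \<longrightarrow> norm (S n t \<xi> - L) < \<epsilon>"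
      using \<delta>(1) by blast
  qed
qed

lemma increment_curve_small:
  assumes e: "increment_curve e R" "continuous_on {0..1} e" and "w > 0"
  obtains \<delta> where "\<delta> > 0"
    "\<And>a b c d. a \<in> {0..1} \<Longrightarrow> b \<in> {0..1} \<Longrightarrow> c \<in> {0..1} \<Longrightarrow> d \<in> {0..1} \<Longrightarrow> \<bar>b - a\<bar> < \<delta> \<Longrightarrow> \<bar>d - c\<bar> < \<delta> \<Longrightarrow>
       \<bar>rect_incr R a b c d\<bar> \<le> w"
proof -
  have "uniformly_continuous_on {0..1} e"
    using e(2) by (intro compact_uniformly_continuous) auto
  then obtain \<delta> where \<delta>: "\<delta> > 0" "\<And>x y. x \<in> {0..1} \<Longrightarrow> y \<in> {0..1} \<Longrightarrow> dist y x < \<delta> \<Longrightarrow> dist (e y) (e x) < sqrt w"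
    unfolding uniformly_continuous_on_def using assms(3) by (metis real_sqrt_gt_zero)
  show thesis
  proof (rule that[OF \<delta>(1)])
    fix a b c d :: real
    assume *: "a \<in> {0..1}" "b \<in> {0..1}" "c \<in> {0..1}" "d \<in> {0..1}" "\<bar>b - a\<bar> < \<delta>" "\<bar>d - c\<bar> < \<delta>"
    have "\<bar>rect_incr R a b c d\<bar> = \<bar>inner (e b - e a) (e d - e c)\<bar>"
      using e(1) * by (simp add: increment_curve_def)
    also have "\<dots> \<le> norm (e b - e a) * norm (e d - e c)" by (rule Cauchy_Schwarz_ineq2)
    also have "\<dots> \<le> sqrt w * sqrt w"
      using \<delta>(2)[of a b] \<delta>(2)[of c d] * assms(3)
      by (intro mult_mono) (auto simp: dist_norm intro: less_imp_le)
    finally show "\<bar>rect_incr R a b c d\<bar> \<le> w" using assms(3) by simp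
  qed
qed

lemma disjoint_intervals_shrink:
  assumes "disjoint_intervals I a b" "\<And>i. i \<in> I \<Longrightarrow> a i \<le> b' i \<and> b' i \<le> b i"
  shows "disjoint_intervals I a b'"
  using assms unfolding disjoint_intervals_def by (meson order_trans)

lemma norm_four_quarters:
  fixes a b c d :: "'a::real_normed_vector"
  assumes "norm a \<le> \<epsilon> / 4" "norm b \<le> \<epsilon> / 4" "norm c \<le> \<epsilon> / 4" "norm d \<le> \<epsilon> / 4"
  shows "norm (a - b + (c - d)) \<le> \<epsilon>"
  using norm_triangle_ineq[of "a - b" "c - d"] norm_triangle_ineq4[of a b] norm_triangle_ineq4[of c d] assms
  by linarith

text \<open>Two tagged sums are compared in four steps: each with the left sum of its own partition, and both left sums
  with that of the common refinement. The first kind of step is a single application of Hoelder's inequality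
  to the intervals between left endpoints and tags, the second kind is the refinement bound.\<close>

lemma tagged_sums_close:
  assumes T: "hilbert_tensor_square T"
    and e: "increment_curve e R1" "continuous_on {0..1} e" and f: "increment_curve f R2"
    and pq: "p \<ge> 1" "q \<ge> 1" "1 / p + 1 / q > 1"
    and R: "finite_variation2 p R1" "finite_variation2 q R2"
    and ab: "0 \<le> a" "a < b" "b \<le> 1" and "\<epsilon> > 0"
  shows "\<exists>\<delta>>0. \<forall>n t \<xi> m u \<eta>. fine_tagged \<delta> a b n t \<xi> \<longrightarrow> fine_tagged \<delta> a b m u \<eta> \<longrightarrow>
      norm (tagged_sum T e f n t \<xi> - tagged_sum T e f m u \<eta>) \<le> \<epsilon>"
proof -
  define x where "x = 1 / p"
  define y where "y = 1 / q"
  have xy: "0 < x" "x \<le> 1" "0 < y" "y \<le> 1" "x + y > 1" using pq by (auto simp: x_def y_def)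
  \<comment> \<open>The exponent \<open>p' > p\<close> is chosen so that \<open>1/p'\<close> is the midpoint of \<open>1 - 1/q\<close> and \<open>1/p\<close>.\<close>
  define r where "r = (x + (1 - y)) / 2"
  define p' where "p' = 1 / r"
  have r: "0 < r" "r < 1 / p" "r > 1 - 1 / q" "r \<le> 1"
    using xy unfolding r_def x_def[symmetric] y_def[symmetric] by auto
  have p': "p < p'" "p' \<ge> 1" "1 / p' + 1 / q > 1"
    using r pq by (auto simp: p'_def field_simps)
  define \<theta> where "\<theta> = 1 / p' + 1 / q"
  define B where "B = pvar q R2 + 1"
  define Z where "Z = (\<Sum>i. real (Suc i) powr - (1 + (\<theta> - 1) / 2))"
  have B: "B > 0" using pvar_nonneg[of q R2] by (simp add: B_def)
  have Z: "Z \<ge> 0"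
    unfolding Z_def using p'(3) by (intro suminf_nonneg summable_Suc_powr) (auto simp: \<theta>_def)
  \<comment> \<open>Both kinds of steps cost at most \<open>\<kappa>\<close> times the square root of \<open>A\<close> to the power \<open>1/p'\<close>; the constants
    \<open>\<eta>\<close>, \<open>A\<close> and the size \<open>w\<close> of the increments are chosen backwards from this.\<close>
  define \<kappa> where "\<kappa> = 4 * sqrt (B powr (1 / q) * 4 powr \<theta>) * Z + sqrt (B powr (1 / q))"
  have \<kappa>: "\<kappa> \<ge> 0" using Z by (simp add: \<kappa>_def)
  define \<eta> where "\<eta> = \<epsilon> / 4 / (\<kappa> + 1)"
  have \<eta>: "\<eta> > 0" "\<eta> * \<kappa> \<le> \<epsilon> / 4" using \<open>\<epsilon> > 0\<close> \<kappa> by (auto simp: \<eta>_def field_simps)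
  define A where "A = \<eta> powr (2 * p')"
  have A: "A > 0" "A powr (1 / p') = \<eta>\<^sup>2"
    using \<eta> p' by (auto simp: A_def powr_powr)
  define w where "w = (A / (pvar p R1 + 1)) powr (1 / (p' - p))"
  have pv: "pvar p R1 + 1 > 0" using pvar_nonneg[of p R1] by simp
  have w: "w > 0" "w powr (p' - p) * pvar p R1 \<le> A"
  proof -
    show "w > 0" using A pv by (simp add: w_def)
    have "w powr (p' - p) = A / (pvar p R1 + 1)" using A pv p' by (simp add: w_def powr_powr)
    then have "w powr (p' - p) * pvar p R1 + w powr (p' - p) = A" using pv by (simp add: field_simps)
    then show "w powr (p' - p) * pvar p R1 \<le> A" using powr_ge_zero[of w "p' - p"] by linarith
  qed
  from increment_curve_small[OF e w(1)] obtain \<delta> where \<delta>: "\<delta> > 0"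
    "\<And>a b c d. a \<in> {0..1} \<Longrightarrow> b \<in> {0..1} \<Longrightarrow> c \<in> {0..1} \<Longrightarrow> d \<in> {0..1} \<Longrightarrow> \<bar>b - a\<bar> < \<delta> \<Longrightarrow> \<bar>d - c\<bar> < \<delta> \<Longrightarrow>
       \<bar>rect_incr R1 a b c d\<bar> \<le> w" by blast
  have smallA: "(\<Sum>x\<in>S. \<Sum>y\<in>S. \<bar>rect_incr R1 (u x) (v x) (u y) (v y)\<bar> powr p') \<le> A"
    if "finite S" "disjoint_intervals S u v" "\<And>x. x \<in> S \<Longrightarrow> v x - u x < \<delta>" for S :: "'i set" and u v
  proof -
    have *: "u x \<in> {0..1} \<and> v x \<in> {0..1} \<and> \<bar>v x - u x\<bar> < \<delta>" if "x \<in> S" for x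
      using \<open>disjoint_intervals S u v\<close> that \<open>\<And>x. x \<in> S \<Longrightarrow> v x - u x < \<delta>\<close>[OF that]
      by (fastforce simp: disjoint_intervals_def)
    have "(\<Sum>x\<in>S. \<Sum>y\<in>S. \<bar>rect_incr R1 (u x) (v x) (u y) (v y)\<bar> powr p') \<le> w powr (p' - p) * pvar p R1"
      using p' * by (intro disjoint_sum_powr_le_interpolation R pq that(1,2) \<delta>(2)) auto
    then show ?thesis using w(2) by linarith
  qed
  have smallB: "(\<Sum>x\<in>S. \<Sum>y\<in>S. \<bar>rect_incr R2 (u x) (v x) (u y) (v y)\<bar> powr q) \<le> B"
    if "finite S" "disjoint_intervals S u v" for S :: "'i set" and u v
    using disjoint_sum_le_pvar[OF R(2) pq(2) that] by (simp add: B_def)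
  have refine: "norm (left_sum T e f P - left_sum T e f Q) \<le> \<epsilon> / 4"
    if "finite P" "Q \<subseteq> P" "a \<in> Q" "b \<in> Q" "P \<subseteq> {a..b}" "\<And>x y. (x, y) \<in> gaps Q \<Longrightarrow> y - x < \<delta>" for P Q
  proof -
    have "norm (left_sum T e f P - left_sum T e f Q)
        \<le> 4 * sqrt (A powr (1 / p') * B powr (1 / q) * 4 powr \<theta>) * Z"
      unfolding Z_def \<theta>_def
      by (rule young_refinement_bound[OF T e(1) f p'(2) pq(2) p'(3) A(1) B that(1-5) ab(1,3) that(6) smallA smallB])
    also have "\<dots> = \<eta> * (4 * sqrt (B powr (1 / q) * 4 powr \<theta>) * Z)"
      using A(2) \<eta>(1) by (simp add: real_sqrt_mult)
    also have "\<dots> \<le> \<eta> * \<kappa>" using \<eta>(1) by (intro mult_left_mono) (auto simp: \<kappa>_def)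
    finally show ?thesis using \<eta>(2) by linarith
  qed
  have tags: "norm (tagged_sum T e f n t \<xi> - left_sum T e f (t ` {..n})) \<le> \<epsilon> / 4"
    if t: "fine_tagged \<delta> a b n t \<xi>" for n t \<xi>
  proof -
    have part: "is_partition a b n t" using t by (simp add: fine_tagged_def)
    have tag: "t k \<le> \<xi> k" "\<xi> k \<le> t (Suc k)" "t (Suc k) - t k < \<delta>" if "k < n" for k
      using t that by (auto simp: fine_tagged_def)
    have d2: "disjoint_intervals {..<n} t (\<lambda>k. t (Suc k))"
      unfolding disjoint_intervals_def
    proof (intro conjI ballI impI)
      fix k l assume "k \<in> {..<n}" "l \<in> {..<n}" "k \<noteq> l"
      then show "t (Suc k) \<le> t l \<or> t (Suc l) \<le> t k"
        using partition_mono[OF part, of "Suc k" l] partition_mono[OF part, of "Suc l" k]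
        by (cases "k < l") auto
    next
      fix k assume "k \<in> {..<n}"
      then show "0 \<le> t k" "t k \<le> t (Suc k)" "t (Suc k) \<le> 1"
        using partition_bounds[OF part, of k] partition_bounds[OF part, of "Suc k"] ab
          partition_mono[OF part, of k "Suc k"] by auto
    qed
    then have d1: "disjoint_intervals {..<n} t \<xi>"
      by (rule disjoint_intervals_shrink) (use tag in auto)
    note bil = tensor_bilinear[OF T]
    have "tagged_sum T e f n t \<xi> - left_sum T e f (t ` {..n}) =
        (\<Sum>k<n. T (e (\<xi> k) - e (t k)) (f (t (Suc k)) - f (t k)))"
      by (simp add: left_sum_partition[OF part] tagged_sum_def bilinear_lsub[OF bil] sum_subtractf)
    then have "(norm (tagged_sum T e f n t \<xi> - left_sum T e f (t ` {..n})))\<^sup>2 \<le>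
      (\<Sum>i<n. \<Sum>j<n. \<bar>rect_incr R1 (t i) (\<xi> i) (t j) (\<xi> j)\<bar> *
         \<bar>rect_incr R2 (t i) (t (Suc i)) (t j) (t (Suc j))\<bar>)"
      using norm_tensor_sum_le[OF T e(1) f d1 d2] by simp
    also have "\<dots> = (\<Sum>(i, j)\<in>{..<n} \<times> {..<n}. \<bar>rect_incr R1 (t i) (\<xi> i) (t j) (\<xi> j)\<bar> *
         \<bar>rect_incr R2 (t i) (t (Suc i)) (t j) (t (Suc j))\<bar>)"
      by (simp add: sum.cartesian_product)
    also have "\<dots> \<le> A powr (1 / p') * B powr (1 / q)"
    proof -
      have "(\<Sum>(i, j)\<in>{..<n} \<times> {..<n}. \<bar>rect_incr R1 (t i) (\<xi> i) (t j) (\<xi> j)\<bar> powr p') \<le> A"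
        using smallA[OF _ d1] tag unfolding sum.cartesian_product[symmetric] by fastforce
      moreover have "(\<Sum>(i, j)\<in>{..<n} \<times> {..<n}. \<bar>rect_incr R2 (t i) (t (Suc i)) (t j) (t (Suc j))\<bar> powr q) \<le> B"
        using smallB[OF _ d2] unfolding sum.cartesian_product[symmetric] by simp
      ultimately show ?thesis
        using sum_mult_le_powr[of p' q "{..<n} \<times> {..<n}" "\<lambda>(i, j). \<bar>rect_incr R1 (t i) (\<xi> i) (t j) (\<xi> j)\<bar>"
            "\<lambda>(i, j). \<bar>rect_incr R2 (t i) (t (Suc i)) (t j) (t (Suc j))\<bar>" A B] p' pq A B
        by (simp add: case_prod_unfold)
    qed
    also have "\<dots> = (\<eta> * sqrt (B powr (1 / q)))\<^sup>2"
      using A(2) by (simp add: power_mult_distrib)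
    also have "\<dots> \<le> (\<eta> * \<kappa>)\<^sup>2"
      using \<eta>(1) Z by (intro power_mono mult_left_mono) (auto simp: \<kappa>_def)
    finally have "norm (tagged_sum T e f n t \<xi> - left_sum T e f (t ` {..n})) \<le> \<eta> * \<kappa>"
      by (rule power2_le_imp_le) (use \<eta> \<kappa> in auto)
    then show ?thesis using \<eta>(2) by linarith
  qed
  show ?thesis
  proof (intro exI[of _ \<delta>] conjI \<delta>(1) allI impI)
    fix n t \<xi> m u \<zeta>
    assume t: "fine_tagged \<delta> a b n t \<xi>" and u: "fine_tagged \<delta> a b m u \<zeta>"
    let ?P = "t ` {..n}" and ?Q = "u ` {..m}"
    have *: "finite (s ` {..k})" "a \<in> s ` {..k}" "b \<in> s ` {..k}" "s ` {..k} \<subseteq> {a..b}"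
      "\<And>x y. (x, y) \<in> gaps (s ` {..k}) \<Longrightarrow> y - x < \<delta>" if "fine_tagged \<delta> a b k s \<zeta>" for s k \<zeta>
    proof -
      have part: "is_partition a b k s" using that by (simp add: fine_tagged_def)
      then have "s 0 = a" "s k = b" by (auto simp: is_partition_def)
      then show "a \<in> s ` {..k}" "b \<in> s ` {..k}" by force+
      show "s ` {..k} \<subseteq> {a..b}" using partition_bounds[OF part] by auto
      show "y - x < \<delta>" if "(x, y) \<in> gaps (s ` {..k})" for x y
        using that \<open>fine_tagged \<delta> a b k s \<zeta>\<close> by (auto simp: gaps_partition[OF part] fine_tagged_def)
    qed simp
    have "norm (left_sum T e f (?P \<union> ?Q) - left_sum T e f ?P) \<le> \<epsilon> / 4"
      "norm (left_sum T e f (?P \<union> ?Q) - left_sum T e f ?Q) \<le> \<epsilon> / 4"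
      by (rule refine; use *(1-4)[OF t] *(1-4)[OF u] *(5)[OF t] *(5)[OF u] in \<open>simp; fail\<close>)+
    moreover have "tagged_sum T e f n t \<xi> - tagged_sum T e f m u \<zeta> =
        (tagged_sum T e f n t \<xi> - left_sum T e f ?P) - (left_sum T e f (?P \<union> ?Q) - left_sum T e f ?P) +
        ((left_sum T e f (?P \<union> ?Q) - left_sum T e f ?Q) - (tagged_sum T e f m u \<zeta> - left_sum T e f ?Q))"
      by simp
    ultimately show "norm (tagged_sum T e f n t \<xi> - tagged_sum T e f m u \<zeta>) \<le> \<epsilon>"
      using tags[OF t] tags[OF u] by (simp only: norm_four_quarters)
  qed
qed

theorem tensor_integral_exists:
  fixes T :: "'h::{real_inner, complete_space} \<Rightarrow> 'h \<Rightarrow> 'k::{real_inner, complete_space}"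
  assumes "hilbert_tensor_square T"
    and "increment_curve e R1" "continuous_on {0..1} e" "increment_curve f R2"
    and "p \<ge> 1" "q \<ge> 1" "1 / p + 1 / q > 1"
    and "finite_variation2 p R1" "finite_variation2 q R2"
    and "0 \<le> a" "a < b" "b \<le> 1"
  obtains L where "has_tensor_integral T e f a b L"
proof -
  have "\<exists>L. has_tensor_integral T e f a b L"
    unfolding has_tensor_integral_def
    by (rule convergent_if_cauchy_mesh[OF \<open>a < b\<close> tagged_sums_close[OF assms]])
  then show thesis using that by blast
qed

section \<open>Uniqueness of the piecewise constant and the Young integral\<close>

definition grid :: "real set \<Rightarrow> bool" where
  "grid P \<longleftrightarrow> finite P \<and> 0 \<in> P \<and> 1 \<in> P \<and> P \<subseteq> {0..1}"

abbreviation mid :: "real \<Rightarrow> real \<Rightarrow> real" where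
  "mid x y \<equiv> (x + y) / 2"

text \<open>The Riemann sum with midpoint tags. Midpoints avoid the grid lines, on which the integrands are not
  controlled.\<close>

definition grid_sum :: "(real \<Rightarrow> real \<Rightarrow> real) \<Rightarrow> real set \<Rightarrow> real set \<Rightarrow> (real \<Rightarrow> real \<Rightarrow> real) \<Rightarrow> real" where
  "grid_sum R P Q F =
     gap_sum P (\<lambda>x y. gap_sum Q (\<lambda>x' y'. F (mid x y) (mid x' y') * rect_incr R x y x' y'))"

definition cellwise_constant :: "real set \<Rightarrow> real set \<Rightarrow> (real \<Rightarrow> real \<Rightarrow> real) \<Rightarrow> bool" where
  "cellwise_constant P Q F \<longleftrightarrow>
     (\<forall>x y x' y' s t. (x, y) \<in> gaps P \<longrightarrow> (x', y') \<in> gaps Q \<longrightarrow>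
        s \<in> {x<..<y} \<longrightarrow> t \<in> {x'<..<y'} \<longrightarrow> F s t = F (mid x y) (mid x' y'))"

lemma grid_Un: "grid P \<Longrightarrow> grid Q \<Longrightarrow> grid (P \<union> Q)"
  by (auto simp: grid_def)

lemma grid_insert: "grid P \<Longrightarrow> x \<in> {0..1} \<Longrightarrow> grid (insert x P)"
  by (auto simp: grid_def)

lemma grid_partition: "is_partition 0 1 n t \<Longrightarrow> grid (t ` {..n})"
proof -
  assume t: "is_partition 0 1 n t"
  then have "t 0 = 0" "t n = 1" by (auto simp: is_partition_def)
  then have "0 \<in> t ` {..n}" "1 \<in> t ` {..n}" by force+
  then show ?thesis using partition_bounds[OF t] by (auto simp: grid_def)
qed

lemma grid_gap_in_coarser:
  assumes "grid P" "grid Q" "Q \<subseteq> P" "(x, y) \<in> gaps P"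
  obtains w z where "(w, z) \<in> gaps Q" "w \<le> x" "y \<le> z"
  using gap_in_coarser[of P Q 0 1 x y] assms by (auto simp: grid_def)

lemma cellwise_constantD:
  assumes "cellwise_constant P Q F" "(x, y) \<in> gaps P" "(x', y') \<in> gaps Q"
    "x < s" "s < y" "x' < t" "t < y'" "x < s'" "s' < y" "x' < t'" "t' < y'"
  shows "F s t = F s' t'"
proof -
  note c = assms(1)[unfolded cellwise_constant_def, rule_format, OF assms(2,3)]
  have "F s t = F (mid x y) (mid x' y')" by (rule c) (use assms in simp_all)
  also have "\<dots> = F s' t'" by (rule c[symmetric]) (use assms in simp_all)
  finally show ?thesis .
qed

lemma cellwise_constant_mono:
  assumes "cellwise_constant P Q F" "grid P" "grid Q" "grid P'" "grid Q'" "P \<subseteq> P'" "Q \<subseteq> Q'"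
  shows "cellwise_constant P' Q' F"
  unfolding cellwise_constant_def
proof (intro allI impI)
  fix x y x' y' s t
  assume g: "(x, y) \<in> gaps P'" "(x', y') \<in> gaps Q'" and st: "s \<in> {x<..<y}" "t \<in> {x'<..<y'}"
  obtain w z where 1: "(w, z) \<in> gaps P" "w \<le> x" "y \<le> z"
    using grid_gap_in_coarser[OF assms(4,2,6) g(1)] .
  obtain w' z' where 2: "(w', z') \<in> gaps Q" "w' \<le> x'" "y' \<le> z'"
    using grid_gap_in_coarser[OF assms(5,3,7) g(2)] .
  show "F s t = F (mid x y) (mid x' y')"
    by (rule cellwise_constantD[OF assms(1) 1(1) 2(1)]) (use 1 2 st in auto)
qed

lemma has_pc_integral_iff:
  "has_pc_integral R F I \<longleftrightarrow>
     (\<exists>P Q. grid P \<and> grid Q \<and> cellwise_constant P Q F \<and> I = grid_sum R P Q F)"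
proof
  assume "has_pc_integral R F I"
  then obtain n t m u c where t: "is_partition 0 1 n t" and u: "is_partition 0 1 m u"
    and c: "\<forall>k<n. \<forall>l<m. \<forall>x\<in>{t k<..<t (Suc k)}. \<forall>y\<in>{u l<..<u (Suc l)}. F x y = c k l"
    and I: "I = (\<Sum>k<n. \<Sum>l<m. c k l * rect_incr R (t k) (t (Suc k)) (u l) (u (Suc l)))"
    unfolding has_pc_integral_def by (elim exE conjE) (rule that)
  have mid: "F (mid (t k) (t (Suc k))) (mid (u l) (u (Suc l))) = c k l" if "k < n" "l < m" for k l
    using c t u that by (simp add: is_partition_def)
  have "cellwise_constant (t ` {..n}) (u ` {..m}) F"
    using c mid by (auto simp: cellwise_constant_def gaps_partition[OF t] gaps_partition[OF u])
  moreover have "I = grid_sum R (t ` {..n}) (u ` {..m}) F"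
    using mid by (simp add: I grid_sum_def gap_sum_partition[OF t] gap_sum_partition[OF u])
  ultimately show "\<exists>P Q. grid P \<and> grid Q \<and> cellwise_constant P Q F \<and> I = grid_sum R P Q F"
    using grid_partition[OF t] grid_partition[OF u] by blast
next
  assume "\<exists>P Q. grid P \<and> grid Q \<and> cellwise_constant P Q F \<and> I = grid_sum R P Q F"
  then obtain P Q where P: "grid P" and Q: "grid Q" and F: "cellwise_constant P Q F"
    and I: "I = grid_sum R P Q F" by blast
  obtain n t where t: "is_partition 0 1 n t" "t ` {..n} = P"
    using partition_of_set[of P 0 1] P by (auto simp: grid_def)
  obtain m u where u: "is_partition 0 1 m u" "u ` {..m} = Q"
    using partition_of_set[of Q 0 1] Q by (auto simp: grid_def)
  let ?c = "\<lambda>k l. F (mid (t k) (t (Suc k))) (mid (u l) (u (Suc l)))"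
  have "\<forall>k<n. \<forall>l<m. \<forall>x\<in>{t k<..<t (Suc k)}. \<forall>y\<in>{u l<..<u (Suc l)}. F x y = ?c k l"
    using F unfolding cellwise_constant_def t(2)[symmetric] u(2)[symmetric]
      gaps_partition[OF t(1)] gaps_partition[OF u(1)] by simp
  moreover have "I = (\<Sum>k<n. \<Sum>l<m. ?c k l * rect_incr R (t k) (t (Suc k)) (u l) (u (Suc l)))"
    unfolding I grid_sum_def t(2)[symmetric] u(2)[symmetric]
      gap_sum_partition[OF t(1)] gap_sum_partition[OF u(1)] ..
  ultimately show "has_pc_integral R F I"
    unfolding has_pc_integral_def using t(1) u(1)
    by (intro exI[of _ n] exI[of _ t] exI[of _ m] exI[of _ u] exI[of _ ?c] conjI)
qed

lemma grid_sum_refine: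
  assumes g: "grid P" "grid Q" "grid P'" "grid Q'" "P \<subseteq> P'" "Q \<subseteq> Q'"
    and F: "cellwise_constant P Q F"
  shows "grid_sum R P' Q' F = grid_sum R P Q F"
proof -
  have "grid_sum R P' Q' F = grid_sum R P' Q F"
    unfolding grid_sum_def
  proof (rule gap_sum_cong)
    fix x y assume xy: "(x, y) \<in> gaps P'"
    note F' = cellwise_constant_mono[OF F g(1,2,3,2,5) order_refl]
    show "gap_sum Q' (\<lambda>x' y'. F (mid x y) (mid x' y') * rect_incr R x y x' y') =
      gap_sum Q (\<lambda>x' y'. F (mid x y) (mid x' y') * rect_incr R x y x' y')"
    proof (rule gap_sum_refine[where a = 0 and b = 1])
      fix x' y' u v w assume *: "(x', y') \<in> gaps Q" "x' \<le> u" "u < v" "v < w" "w \<le> y'"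
      have "F (mid x y) (mid u w) = F (mid x y) (mid u v)" "F (mid x y) (mid u w) = F (mid x y) (mid v w)"
        by (rule cellwise_constantD[OF F' xy *(1)]; use * gapsD(3)[OF xy] in simp)+
      then show "F (mid x y) (mid u w) * rect_incr R x y u w =
        F (mid x y) (mid u v) * rect_incr R x y u v + F (mid x y) (mid v w) * rect_incr R x y v w"
        by (simp add: rect_incr_def flip: distrib_left)
    qed (use g in \<open>auto simp: grid_def\<close>)
  qed
  also have "\<dots> = grid_sum R P Q F"
    unfolding grid_sum_def
  proof (rule gap_sum_refine[where a = 0 and b = 1])
    fix x y u v w assume *: "(x, y) \<in> gaps P" "x \<le> u" "u < v" "v < w" "w \<le> y"
    have "F (mid u w) (mid x' y') = F (mid u v) (mid x' y')" "F (mid u w) (mid x' y') = F (mid v w) (mid x' y')"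
      if "(x', y') \<in> gaps Q" for x' y'
      by (rule cellwise_constantD[OF F *(1) that]; use * gapsD(3)[OF that] in simp)+
    then have "gap_sum Q (\<lambda>x' y'. F (mid u w) (mid x' y') * rect_incr R u w x' y') =
      gap_sum Q (\<lambda>x' y'. F (mid u v) (mid x' y') * rect_incr R u v x' y' +
         F (mid v w) (mid x' y') * rect_incr R v w x' y')"
      by (intro gap_sum_cong) (simp add: rect_incr_def flip: distrib_left)
    then show "gap_sum Q (\<lambda>x' y'. F (mid u w) (mid x' y') * rect_incr R u w x' y') =
      gap_sum Q (\<lambda>x' y'. F (mid u v) (mid x' y') * rect_incr R u v x' y') +
      gap_sum Q (\<lambda>x' y'. F (mid v w) (mid x' y') * rect_incr R v w x' y')"
      by (simp add: gap_sum_def case_prod_unfold sum.distrib)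
  qed (use g in \<open>auto simp: grid_def\<close>)
  finally show ?thesis .
qed

text \<open>Both values are sums over a grid on whose cells the integrand is constant; refining such a grid does not change
  the sum, so both equal the sum over the common refinement.\<close>

lemma has_pc_integral_unique:
  assumes "has_pc_integral R F I" "has_pc_integral R F I'"
  shows "I = I'"
proof -
  obtain P Q where 1: "grid P" "grid Q" "cellwise_constant P Q F" "I = grid_sum R P Q F"
    using assms(1) unfolding has_pc_integral_iff by blast
  obtain P' Q' where 2: "grid P'" "grid Q'" "cellwise_constant P' Q' F" "I' = grid_sum R P' Q' F"
    using assms(2) unfolding has_pc_integral_iff by blast
  have "grid_sum R (P \<union> P') (Q \<union> Q') F = I"
    unfolding 1(4) using 1 2 by (intro grid_sum_refine grid_Un) auto
  moreover have "grid_sum R (P \<union> P') (Q \<union> Q') F = I'"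
    unfolding 2(4) using 1 2 by (intro grid_sum_refine grid_Un) auto
  ultimately show ?thesis by simp
qed

lemma pc_integral_eq: "has_pc_integral R F I \<Longrightarrow> pc_integral R F = I"
  unfolding pc_integral_def by (blast intro: has_pc_integral_unique)

lemma gap_sum_split:
  assumes t: "is_partition a b n t" and P: "finite P" "t ` {..n} \<subseteq> P" "P \<subseteq> {a..b}"
  shows "gap_sum P h = (\<Sum>k<n. gap_sum (P \<inter> {t k..t (Suc k)}) h)"
proof -
  let ?P = "\<lambda>k. P \<inter> {t k..t (Suc k)}"
  have ends: "a \<in> t ` {..n}" "b \<in> t ` {..n}" using t by (force simp: is_partition_def)+
  have "gaps P = (\<Union>k<n. gaps (?P k))"
  proof (intro equalityI subsetI)
    fix g assume g: "g \<in> gaps P"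
    obtain x y where [simp]: "g = (x, y)" by (cases g)
    from gap_in_coarser[OF P(1,2) ends P(3) g[unfolded \<open>g = (x, y)\<close>]]
    obtain w z where "(w, z) \<in> gaps (t ` {..n})" "w \<le> x" "y \<le> z" .
    then obtain k where "k < n" "t k \<le> x" "y \<le> t (Suc k)" by (auto simp: gaps_partition[OF t])
    then have "g \<in> gaps (?P k)" using gapsD[of x y P] g by (auto intro!: gapsI)
    then show "g \<in> (\<Union>k<n. gaps (?P k))" using \<open>k < n\<close> by auto
  next
    fix g assume "g \<in> (\<Union>k<n. gaps (?P k))"
    then obtain k where k: "k < n" "g \<in> gaps (?P k)" by auto
    obtain x y where [simp]: "g = (x, y)" by (cases g)
    note D = gapsD[of x y, OF k(2)[simplified]]
    show "g \<in> gaps P" unfolding \<open>g = (x, y)\<close>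
    proof (rule gapsI)
      fix z assume "z \<in> P"
      then show "z \<le> x \<or> y \<le> z" using D(1,2) D(4)[of z] by (cases "z \<in> {t k..t (Suc k)}") auto
    qed (use D in auto)
  qed
  moreover have "gaps (?P k) \<inter> gaps (?P l) = {}" if "k < n" "l < n" "k \<noteq> l" for k l
  proof (rule ccontr)
    assume "gaps (?P k) \<inter> gaps (?P l) \<noteq> {}"
    then obtain x y where "(x, y) \<in> gaps (?P k)" "(x, y) \<in> gaps (?P l)" by auto
    then have "x < y" "t k \<le> x" "y \<le> t (Suc k)" "t l \<le> x" "y \<le> t (Suc l)" by (auto dest: gapsD)
    then show False using partition_mono[OF t, of "Suc k" l] partition_mono[OF t, of "Suc l" k] that
      by (cases "k < l") auto
  qed
  ultimately show ?thesis
    using P(1) unfolding gap_sum_def by (simp add: sum.UNION_disjoint)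
qed

text \<open>A Young integral over a grid of cells is a limit of midpoint sums over partitions of the whole square that contain
  the grid: such a sum splits into sums over the cells, where the midpoints are interior tags, so the
  given function may be replaced by its continuous versions. In this form the value no longer refers to the
  choice of the cells and of the continuous versions, which gives uniqueness.\<close>

lemma young_integral_midpoint_sums:
  assumes "has_young_integral R G I" "\<epsilon> > 0"
  obtains \<delta> P0 where "\<delta> > 0" "grid P0"
    "\<And>P. grid P \<Longrightarrow> P0 \<subseteq> P \<Longrightarrow> (\<And>x y. (x, y) \<in> gaps P \<Longrightarrow> y - x < \<delta>) \<Longrightarrow> \<bar>grid_sum R P P G - I\<bar> < \<epsilon>"
proof -
  obtain n t m u G' J where t: "is_partition 0 1 n t" and u: "is_partition 0 1 m u"
    and cells: "\<forall>k<n. \<forall>l<m.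
           continuous_on ({t k..t (Suc k)} \<times> {u l..u (Suc l)}) (\<lambda>(x, y). G' k l x y) \<and>
           (\<forall>x\<in>{t k<..<t (Suc k)}. \<forall>y\<in>{u l<..<u (Suc l)}. G x y = G' k l x y) \<and>
           has_rs_integral R (t k) (t (Suc k)) (u l) (u (Suc l)) (G' k l) (J k l)"
    and I: "I = (\<Sum>k<n. \<Sum>l<m. J k l)"
    using assms(1) unfolding has_young_integral_def by (elim exE conjE) (rule that)
  have G': "G x y = G' k l x y"
    if "k < n" "l < m" "x \<in> {t k<..<t (Suc k)}" "y \<in> {u l<..<u (Suc l)}" for k l x y
    using cells that by simp
  have J: "has_rs_integral R (t k) (t (Suc k)) (u l) (u (Suc l)) (G' k l) (J k l)"
    if "k < n" "l < m" for k l using cells that by simp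
  define \<eta> where "\<eta> = \<epsilon> / (real n * real m + 1)"
  have nm: "real n * real m + 1 > 0" by (simp add: add_nonneg_pos)
  have \<eta>: "\<eta> > 0" "real n * real m * \<eta> < \<epsilon>"
    using assms(2) nm by (auto simp: \<eta>_def field_simps)
  define good where "good k l d \<longleftrightarrow> d > 0 \<and> (\<forall>n' t' \<xi> m' u' \<zeta>.
      fine_tagged d (t k) (t (Suc k)) n' t' \<xi> \<and> fine_tagged d (u l) (u (Suc l)) m' u' \<zeta> \<longrightarrow>
      \<bar>(\<Sum>i<n'. \<Sum>j<m'. G' k l (\<xi> i) (\<zeta> j) * rect_incr R (t' i) (t' (Suc i)) (u' j) (u' (Suc j))) - J k l\<bar> < \<eta>)"
    for k l d
  have "\<exists>d. good k l d" if "k < n" "l < m" for k l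
    using J[OF that, unfolded has_rs_integral_def, rule_format, OF \<eta>(1)] unfolding good_def by simp
  then obtain \<delta> where good: "\<And>k l. k < n \<Longrightarrow> l < m \<Longrightarrow> good k l (\<delta> k l)"
    by metis
  have \<delta>: "\<delta> k l > 0" if "k < n" "l < m" for k l using good[OF that] by (simp add: good_def)
  define \<delta>0 where "\<delta>0 = Min (insert 1 ((\<lambda>(k, l). \<delta> k l) ` ({..<n} \<times> {..<m})))"
  have \<delta>0: "\<delta>0 > 0" "\<And>k l. k < n \<Longrightarrow> l < m \<Longrightarrow> \<delta>0 \<le> \<delta> k l"
    unfolding \<delta>0_def using \<delta> by (auto intro!: Min_le)
  show thesis
  proof (rule that[OF \<delta>0(1) grid_Un[OF grid_partition[OF t] grid_partition[OF u]]])
    fix P assume P: "grid P" "t ` {..n} \<union> u ` {..m} \<subseteq> P" and mesh: "\<And>x y. (x, y) \<in> gaps P \<Longrightarrow> y - x < \<delta>0"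
    have Pf: "finite P" "P \<subseteq> {0..1}" using P by (auto simp: grid_def)
    \<comment> \<open>The part of \<open>P\<close> in one grid interval is a fine partition of that interval with interior midpoints.\<close>
    have block: "\<exists>m s. is_partition (r k) (r (Suc k)) m s \<and> s ` {..m} = P \<inter> {r k..r (Suc k)} \<and>
        fine_tagged \<delta>0 (r k) (r (Suc k)) m s (\<lambda>i. mid (s i) (s (Suc i))) \<and>
        (\<forall>i<m. mid (s i) (s (Suc i)) \<in> {r k<..<r (Suc k)})"
      if r: "is_partition 0 1 N r" "r ` {..N} \<subseteq> P" and k: "k < N" for r N k
    proof -
      have "r k < r (Suc k)" using r(1) k by (simp add: is_partition_def)
      moreover have "r k \<in> P" "r (Suc k) \<in> P" using r(2) k by auto
      ultimately obtain m s where s: "is_partition (r k) (r (Suc k)) m s" "s ` {..m} = P \<inter> {r k..r (Suc k)}"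
        by (elim partition_of_set[of "P \<inter> {r k..r (Suc k)}" "r k" "r (Suc k)", rotated 4]) (use Pf in auto)
      have gap: "(s i, s (Suc i)) \<in> gaps (P \<inter> {r k..r (Suc k)})" if "i < m" for i
        using gaps_partition[OF s(1)] s(2) that by auto
      have "(s i, s (Suc i)) \<in> gaps P" if "i < m" for i
      proof (rule gapsI)
        fix z assume "z \<in> P"
        then show "z \<le> s i \<or> s (Suc i) \<le> z"
          using gapsD[OF gap[OF that]] by (cases "z \<in> {r k..r (Suc k)}") force+
      qed (use gapsD[OF gap[OF that]] in auto)
      then have "s (Suc i) - s i < \<delta>0" "s i < s (Suc i)" if "i < m" for i using mesh that gapsD(3) by blast+
      moreover have "r k \<le> s i" "s (Suc i) \<le> r (Suc k)" if "i < m" for i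
        using gapsD[OF gap[OF that]] by auto
      ultimately show ?thesis using s by (intro exI[of _ m] exI[of _ s]) (force simp: fine_tagged_def)
    qed
    have cell: "\<bar>grid_sum R (P \<inter> {t k..t (Suc k)}) (P \<inter> {u l..u (Suc l)}) G - J k l\<bar> \<le> \<eta>"
      if kl: "k < n" "l < m" for k l
    proof -
      obtain n' t' where t': "is_partition (t k) (t (Suc k)) n' t'" "t' ` {..n'} = P \<inter> {t k..t (Suc k)}"
        "fine_tagged \<delta>0 (t k) (t (Suc k)) n' t' (\<lambda>i. mid (t' i) (t' (Suc i)))"
        "\<And>i. i < n' \<Longrightarrow> mid (t' i) (t' (Suc i)) \<in> {t k<..<t (Suc k)}"
        using block[OF t _ kl(1)] P(2) by blast
      obtain m' u' where u': "is_partition (u l) (u (Suc l)) m' u'" "u' ` {..m'} = P \<inter> {u l..u (Suc l)}"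
        "fine_tagged \<delta>0 (u l) (u (Suc l)) m' u' (\<lambda>i. mid (u' i) (u' (Suc i)))"
        "\<And>i. i < m' \<Longrightarrow> mid (u' i) (u' (Suc i)) \<in> {u l<..<u (Suc l)}"
        using block[OF u _ kl(2)] P(2) by blast
      have "grid_sum R (P \<inter> {t k..t (Suc k)}) (P \<inter> {u l..u (Suc l)}) G =
        (\<Sum>i<n'. \<Sum>j<m'. G' k l (mid (t' i) (t' (Suc i))) (mid (u' j) (u' (Suc j))) *
           rect_incr R (t' i) (t' (Suc i)) (u' j) (u' (Suc j)))"
        unfolding grid_sum_def t'(2)[symmetric] u'(2)[symmetric]
          gap_sum_partition[OF t'(1)] gap_sum_partition[OF u'(1)]
        using G'[OF kl t'(4) u'(4)] by simp
      moreover have fine: "fine_tagged (\<delta> k l) (t k) (t (Suc k)) n' t' (\<lambda>i. mid (t' i) (t' (Suc i)))"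
        "fine_tagged (\<delta> k l) (u l) (u (Suc l)) m' u' (\<lambda>i. mid (u' i) (u' (Suc i)))"
        using fine_tagged_mono[OF t'(3)] fine_tagged_mono[OF u'(3)] \<delta>0(2)[OF kl] by auto
      ultimately show ?thesis
        using good[OF kl, unfolded good_def, THEN conjunct2, rule_format, OF conjI[OF fine]] by simp
    qed
    have "grid_sum R P P G = (\<Sum>k<n. \<Sum>l<m. grid_sum R (P \<inter> {t k..t (Suc k)}) (P \<inter> {u l..u (Suc l)}) G)"
    proof -
      have "grid_sum R P P G = (\<Sum>k<n. gap_sum (P \<inter> {t k..t (Suc k)}) (\<lambda>x y. \<Sum>l<m.
          gap_sum (P \<inter> {u l..u (Suc l)}) (\<lambda>x' y'. G (mid x y) (mid x' y') * rect_incr R x y x' y')))"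
        unfolding grid_sum_def using P Pf by (subst gap_sum_split[OF t], simp_all add: gap_sum_split[OF u])
      then show ?thesis
        by (simp add: grid_sum_def gap_sum_def case_prod_unfold sum.swap[of _ "{..<m}"])
    qed
    then have "\<bar>grid_sum R P P G - I\<bar> \<le>
      (\<Sum>k<n. \<Sum>l<m. \<bar>grid_sum R (P \<inter> {t k..t (Suc k)}) (P \<inter> {u l..u (Suc l)}) G - J k l\<bar>)"
      unfolding I by (simp flip: sum_subtractf) (rule order_trans[OF sum_abs sum_mono[OF sum_abs]])
    also have "\<dots> \<le> (\<Sum>k<n. \<Sum>l<m. \<eta>)" by (intro sum_mono cell) auto
    also have "\<dots> < \<epsilon>" using \<eta>(2) by simp
    finally show "\<bar>grid_sum R P P G - I\<bar> < \<epsilon>" .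
  qed
qed

lemma fine_grid_exists:
  assumes "grid Q" "\<delta> > 0"
  obtains P where "grid P" "Q \<subseteq> P" "\<And>x y. (x, y) \<in> gaps P \<Longrightarrow> y - x < \<delta>"
proof -
  obtain n where n: "n > 0" "1 / real n < \<delta>"
    using reals_Archimedean[OF assms(2)] by (metis inverse_eq_divide zero_less_Suc)
  let ?u = "\<lambda>k. 0 + (1 - 0) * real k / real n"
  have fine: "fine_tagged \<delta> 0 1 n ?u ?u" using n by (intro fine_tagged_uniform) auto
  then have u: "is_partition 0 1 n ?u" by (simp add: fine_tagged_def)
  note U = grid_partition[OF u]
  show thesis
  proof (rule that[OF grid_Un[OF assms(1) U]])
    fix x y assume "(x, y) \<in> gaps (Q \<union> ?u ` {..n})"
    from grid_gap_in_coarser[OF grid_Un[OF assms(1) U] U Un_upper2 this]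
    obtain w z where "(w, z) \<in> gaps (?u ` {..n})" "w \<le> x" "y \<le> z" .
    then show "y - x < \<delta>" using fine unfolding gaps_partition[OF u] fine_tagged_def by auto
  qed simp
qed

lemma grid_gap_bounds:
  assumes "grid P" "(x, y) \<in> gaps P"
  shows "0 \<le> x" "x < y" "y \<le> 1" "x \<in> {0..1}" "y \<in> {0..1}" "mid x y \<in> {0..1}"
  using gapsD[OF assms(2)] assms(1) by (auto simp: grid_def subset_iff)

text \<open>The inner integral is determined on the unit square, and the midpoint sums do not evaluate it elsewhere.\<close>

lemma has_quad_integral_unique:
  assumes "has_quad_integral \<rho> \<sigma> F g I" "has_quad_integral \<rho> \<sigma> F g I'"
  shows "I = I'"
proof (rule ccontr)
  assume "I \<noteq> I'"
  define \<epsilon> where "\<epsilon> = \<bar>I - I'\<bar> / 2"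
  have \<epsilon>: "\<epsilon> > 0" using \<open>I \<noteq> I'\<close> by (simp add: \<epsilon>_def)
  obtain G where G: "\<And>u v. u \<in> {0..1} \<Longrightarrow> v \<in> {0..1} \<Longrightarrow> has_pc_integral \<rho> (\<lambda>s t. F s u * g t v) (G u v)"
    "has_young_integral \<sigma> G I" using assms(1) unfolding has_quad_integral_def by blast
  obtain G' where G': "\<And>u v. u \<in> {0..1} \<Longrightarrow> v \<in> {0..1} \<Longrightarrow> has_pc_integral \<rho> (\<lambda>s t. F s u * g t v) (G' u v)"
    "has_young_integral \<sigma> G' I'" using assms(2) unfolding has_quad_integral_def by blast
  obtain \<delta> P0 where 1: "\<delta> > 0" "grid P0"
    "\<And>P. grid P \<Longrightarrow> P0 \<subseteq> P \<Longrightarrow> (\<And>x y. (x, y) \<in> gaps P \<Longrightarrow> y - x < \<delta>) \<Longrightarrow> \<bar>grid_sum \<sigma> P P G - I\<bar> < \<epsilon>"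
    using young_integral_midpoint_sums[OF G(2) \<epsilon>] by metis
  obtain \<delta>' P0' where 2: "\<delta>' > 0" "grid P0'"
    "\<And>P. grid P \<Longrightarrow> P0' \<subseteq> P \<Longrightarrow> (\<And>x y. (x, y) \<in> gaps P \<Longrightarrow> y - x < \<delta>') \<Longrightarrow> \<bar>grid_sum \<sigma> P P G' - I'\<bar> < \<epsilon>"
    using young_integral_midpoint_sums[OF G'(2) \<epsilon>] by metis
  obtain P where P: "grid P" "P0 \<union> P0' \<subseteq> P" "\<And>x y. (x, y) \<in> gaps P \<Longrightarrow> y - x < min \<delta> \<delta>'"
    using fine_grid_exists[OF grid_Un[OF 1(2) 2(2)], of "min \<delta> \<delta>'"] 1 2 by auto
  have "grid_sum \<sigma> P P G = grid_sum \<sigma> P P G'"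
    unfolding grid_sum_def
    using has_pc_integral_unique[OF G(1) G'(1)] grid_gap_bounds(6)[OF P(1)]
    by (intro gap_sum_cong) auto
  moreover have "\<bar>grid_sum \<sigma> P P G - I\<bar> < \<epsilon>" using P by (intro 1(3)) fastforce+
  moreover have "\<bar>grid_sum \<sigma> P P G' - I'\<bar> < \<epsilon>" using P by (intro 2(3)) fastforce+
  moreover have "\<epsilon> + \<epsilon> = \<bar>I - I'\<bar>" by (simp add: \<epsilon>_def)
  ultimately show False by linarith
qed

lemma quad_integral_eq:
  assumes "has_quad_integral \<rho> \<sigma> F g I"
  shows "quad_integrable \<rho> \<sigma> F g" "quad_integral \<rho> \<sigma> F g = I"
  using assms unfolding quad_integrable_def quad_integral_def
  by (blast, intro the_equality has_quad_integral_unique[OF _ assms])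

section \<open>Step functions and their embedding\<close>

text \<open>Step functions are recorded by grids on whose half-open intervals they are constant. Unlike a
  representation by coefficients this is stable under refinement of the grid, so that finitely many step functions can
  be treated on one common grid.\<close>

definition adapted :: "real set \<Rightarrow> (real \<Rightarrow> real) \<Rightarrow> bool" where
  "adapted P \<phi> \<longleftrightarrow> (\<forall>s. s \<notin> {0<..1} \<longrightarrow> \<phi> s = 0) \<and>
     (\<forall>x y s. (x, y) \<in> gaps P \<longrightarrow> x < s \<longrightarrow> s \<le> y \<longrightarrow> \<phi> s = \<phi> y)"

lemma adaptedD:
  assumes "adapted P \<phi>" shows "(x, y) \<in> gaps P \<Longrightarrow> x < s \<Longrightarrow> s \<le> y \<Longrightarrow> \<phi> s = \<phi> y"
  using assms unfolding adapted_def by blast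

lemma adapted_mono:
  assumes "adapted P \<phi>" "grid P" "grid P'" "P \<subseteq> P'"
  shows "adapted P' \<phi>"
  unfolding adapted_def
proof (intro conjI allI impI)
  fix x y s assume xy: "(x, y) \<in> gaps P'" "x < s" "s \<le> y"
  obtain w z where wz: "(w, z) \<in> gaps P" "w \<le> x" "y \<le> z"
    using grid_gap_in_coarser[OF assms(3,2,4) xy(1)] .
  have "\<phi> s = \<phi> z" by (rule adaptedD[OF assms(1) wz(1)]) (use xy wz in auto)
  moreover have "\<phi> y = \<phi> z" by (rule adaptedD[OF assms(1) wz(1)]) (use xy wz in auto)
  ultimately show "\<phi> s = \<phi> y" by simp
qed (use assms(1) in \<open>auto simp: adapted_def\<close>)

lemma adapted_zero: "adapted P (\<lambda>s. 0)"
  by (simp add: adapted_def)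

lemma adapted_add:
  assumes "adapted P \<phi>" "adapted P \<psi>"
  shows "adapted P (\<lambda>s. \<phi> s + \<psi> s)"
  unfolding adapted_def
proof (intro conjI allI impI)
  show "\<phi> s + \<psi> s = 0" if "s \<notin> {0<..1}" for s
    using assms that by (simp add: adapted_def)
  show "\<phi> s + \<psi> s = \<phi> y + \<psi> y" if "(x, y) \<in> gaps P" "x < s" "s \<le> y" for x y s
    by (rule arg_cong2[OF adaptedD[OF assms(1) that] adaptedD[OF assms(2) that]])
qed

lemma adapted_scale:
  assumes "adapted P \<phi>"
  shows "adapted P (\<lambda>s. c * \<phi> s)"
  unfolding adapted_def
proof (intro conjI allI impI)
  show "c * \<phi> s = 0" if "s \<notin> {0<..1}" for s
    using assms that by (simp add: adapted_def)
  show "c * \<phi> s = c * \<phi> y" if "(x, y) \<in> gaps P" "x < s" "s \<le> y" for x y s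
    by (rule arg_cong[OF adaptedD[OF assms(1) that]])
qed

lemma adapted_indicator:
  assumes "a \<in> P" "b \<in> P" "grid P"
  shows "adapted P (indicator {a<..b})"
  unfolding adapted_def
proof (intro conjI allI impI)
  fix s :: real assume "s \<notin> {0<..1}"
  then show "indicator {a<..b} s = (0::real)" using assms by (auto simp: grid_def indicator_def subset_iff)
next
  fix x y s :: real assume xy: "(x, y) \<in> gaps P" "x < s" "s \<le> y"
  then have "a \<le> x \<or> y \<le> a" "b \<le> x \<or> y \<le> b" using gapsD(4)[OF xy(1)] assms by auto
  then show "indicator {a<..b} s = (indicator {a<..b} y :: real)"
    using xy by (auto simp: indicator_def)
qed

lemma adapted_expand:
  assumes P: "grid P" and \<phi>: "adapted P \<phi>"
  shows "\<phi> s = gap_sum P (\<lambda>x y. \<phi> y * indicator {x<..y} s)"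
proof (cases "s \<in> {0<..1}")
  case False
  then have "\<phi> y * indicator {x<..y} s = 0" if "(x, y) \<in> gaps P" for x y
    using grid_gap_bounds[OF P that] by (auto simp: indicator_def)
  then have "gap_sum P (\<lambda>x y. \<phi> y * indicator {x<..y} s) = gap_sum P (\<lambda>x y. 0)"
    by (rule gap_sum_cong)
  then show ?thesis using False \<phi> by (simp add: gap_sum_def adapted_def)
next
  case True
  obtain x y where xy: "(x, y) \<in> gaps P" "x < s" "s \<le> y"
    using gap_containing[of P 0 s 1] P True by (auto simp: grid_def)
  have "gap_sum P (\<lambda>x y. \<phi> y * indicator {x<..y} s) = (\<Sum>(a, b)\<in>{(x, y)}. \<phi> b * indicator {a<..b} s)"
    unfolding gap_sum_def
  proof (rule sum.mono_neutral_right)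
    show "\<forall>g\<in>gaps P - {(x, y)}. (case g of (a, b) \<Rightarrow> \<phi> b * indicator {a<..b} s) = 0"
    proof
      fix g assume g: "g \<in> gaps P - {(x, y)}"
      obtain a b where ab: "g = (a, b)" by (cases g)
      have "b \<le> x \<or> y \<le> a" using gaps_disjoint[of a b P x y] g xy(1) ab by auto
      then show "(case g of (a, b) \<Rightarrow> \<phi> b * indicator {a<..b} s) = 0"
        using xy ab by (auto simp: indicator_def)
    qed
  qed (use xy P in \<open>auto simp: grid_def\<close>)
  then show ?thesis using adaptedD[OF \<phi> xy] xy by simp
qed

lemma step_functions_iff: "\<phi> \<in> step_functions \<longleftrightarrow> (\<exists>P. grid P \<and> adapted P \<phi>)"
proof
  assume "\<phi> \<in> step_functions"
  then obtain n t a where t: "\<And>k. k \<le> n \<Longrightarrow> t k \<in> {0..1}" "\<And>k. k < n \<Longrightarrow> t k < t (Suc k)"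
    and \<phi>: "\<phi> = (\<lambda>s. \<Sum>k<n. a k * indicator {t k<..t (Suc k)} s)"
    unfolding step_functions_def by auto
  have P: "grid ({0, 1} \<union> t ` {..n})" using t(1) by (auto simp: grid_def)
  have "adapted ({0, 1} \<union> t ` {..n}) (\<lambda>s. \<Sum>k<m. a k * indicator {t k<..t (Suc k)} s)" if "m \<le> n" for m
    using that
  proof (induction m)
    case (Suc m)
    then show ?case
      unfolding sum.lessThan_Suc
      by (intro adapted_add adapted_scale adapted_indicator P Suc.IH) auto
  qed (simp add: adapted_zero)
  then show "\<exists>P. grid P \<and> adapted P \<phi>" using P \<phi> by blast
next
  assume "\<exists>P. grid P \<and> adapted P \<phi>"
  then obtain P where P: "grid P" "adapted P \<phi>" by blast
  obtain n t where t: "is_partition 0 1 n t" "t ` {..n} = P"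
    using partition_of_set[of P 0 1] P by (auto simp: grid_def)
  have "\<phi> s = (\<Sum>k<n. \<phi> (t (Suc k)) * indicator {t k<..t (Suc k)} s)" for s
    using adapted_expand[OF P, of s] unfolding t(2)[symmetric] gap_sum_partition[OF t(1)] .
  then have "\<phi> = (\<lambda>s. \<Sum>k<n. \<phi> (t (Suc k)) * indicator {t k<..t (Suc k)} s)" by (rule ext)
  moreover have "\<forall>k\<le>n. t k \<in> {0..1}" using partition_bounds[OF t(1)] by auto
  moreover have "\<forall>k<n. t k < t (Suc k)" using t(1) by (simp add: is_partition_def)
  ultimately show "\<phi> \<in> step_functions"
    unfolding step_functions_def mem_Collect_eq
    by (intro exI[of _ n] exI[of _ t] exI[of _ "\<lambda>k. \<phi> (t (Suc k))"] conjI)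
qed

lemma common_grid:
  assumes "finite I" "\<And>k. k \<in> I \<Longrightarrow> \<phi> k \<in> step_functions"
  shows "\<exists>P. grid P \<and> (\<forall>k\<in>I. adapted P (\<phi> k))"
  using assms
proof (induction I rule: finite_induct)
  case empty
  have "grid {0, 1}" by (auto simp: grid_def)
  then show ?case by auto
next
  case (insert k I)
  obtain P where P: "grid P" "\<forall>k\<in>I. adapted P (\<phi> k)" using insert by auto
  obtain Q where Q: "grid Q" "adapted Q (\<phi> k)" using insert.prems step_functions_iff by blast
  have "\<forall>k\<in>insert k I. adapted (P \<union> Q) (\<phi> k)"
    using P Q adapted_mono grid_Un by blast
  then show ?case using grid_Un[OF P(1) Q(1)] by blast
qed

lemma step_zero: "(\<lambda>s. 0) \<in> step_functions"
proof -
  have "grid {0, 1}" by (auto simp: grid_def)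
  then show ?thesis using adapted_zero step_functions_iff by blast
qed

lemma step_add:
  assumes "\<phi> \<in> step_functions" "\<psi> \<in> step_functions"
  shows "(\<lambda>s. \<phi> s + \<psi> s) \<in> step_functions"
proof -
  obtain P Q where "grid P" "adapted P \<phi>" "grid Q" "adapted Q \<psi>" using assms step_functions_iff by blast
  then have "grid (P \<union> Q)" "adapted (P \<union> Q) (\<lambda>s. \<phi> s + \<psi> s)"
    by (auto intro!: grid_Un adapted_add intro: adapted_mono)
  then show ?thesis using step_functions_iff by blast
qed

lemma step_scale: "\<phi> \<in> step_functions \<Longrightarrow> (\<lambda>s. c * \<phi> s) \<in> step_functions"
  using adapted_scale step_functions_iff by blast

lemma step_indicator:
  assumes "a \<in> {0..1}" "b \<in> {0..1}"
  shows "indicator {a<..b} \<in> step_functions"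
proof -
  have "grid {0, a, b, 1}" using assms by (auto simp: grid_def)
  then show ?thesis using adapted_indicator[of a "{0, a, b, 1}" b] step_functions_iff by blast
qed

definition on_component :: "2 \<Rightarrow> (real \<Rightarrow> real) \<Rightarrow> real \<times> 2 \<Rightarrow> real" where
  "on_component i \<phi> = (\<lambda>(s, j). if j = i then \<phi> s else 0)"

lemma on_component_mem: "\<phi> \<in> step_functions \<Longrightarrow> on_component i \<phi> \<in> step_functions2"
proof -
  assume "\<phi> \<in> step_functions"
  then have "(\<lambda>s. if j = i then \<phi> s else 0) \<in> step_functions" for j
    by (cases "j = i") (simp_all add: step_zero)
  then show ?thesis by (simp add: step_functions2_def on_component_def)
qed

lemma step2_zero: "(\<lambda>x. 0) \<in> step_functions2"
  by (simp add: step_functions2_def step_zero)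

lemma step2_add: "f \<in> step_functions2 \<Longrightarrow> g \<in> step_functions2 \<Longrightarrow> (\<lambda>x. f x + g x) \<in> step_functions2"
  by (simp add: step_functions2_def step_add)

lemma step2_scale: "f \<in> step_functions2 \<Longrightarrow> (\<lambda>x. c * f x) \<in> step_functions2"
  by (simp add: step_functions2_def step_scale)

lemma step2_sum:
  assumes "\<And>k. k \<in> I \<Longrightarrow> f k \<in> step_functions2"
  shows "(\<lambda>x. \<Sum>k\<in>I. c k * f k x) \<in> step_functions2"
  using assms
  by (induction I rule: infinite_finite_induct) (simp_all add: step2_zero step2_add step2_scale)

lemma has_pc_integral_cellwise:
  assumes P: "grid P"
    and F: "\<And>x y x' y' s t. (x, y) \<in> gaps P \<Longrightarrow> (x', y') \<in> gaps P \<Longrightarrow> x < s \<Longrightarrow> s < y \<Longrightarrow> x' < t \<Longrightarrow> t < y' \<Longrightarrow>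
      F s t = \<phi> y * \<psi> y'"
  shows "has_pc_integral R F
    (gap_sum P (\<lambda>x y. gap_sum P (\<lambda>x' y'. \<phi> y * \<psi> y' * rect_incr R x y x' y')))"
proof -
  have mid: "F (mid x y) (mid x' y') = \<phi> y * \<psi> y'" if "(x, y) \<in> gaps P" "(x', y') \<in> gaps P" for x y x' y'
    by (rule F[OF that]) (use gapsD(3)[OF that(1)] gapsD(3)[OF that(2)] in auto)
  have "cellwise_constant P P F"
    unfolding cellwise_constant_def using F mid by simp
  moreover have "gap_sum P (\<lambda>x y. gap_sum P (\<lambda>x' y'. \<phi> y * \<psi> y' * rect_incr R x y x' y')) = grid_sum R P P F"
    unfolding grid_sum_def using mid by (intro gap_sum_cong) simp
  ultimately show ?thesis using P unfolding has_pc_integral_iff by blast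
qed

lemma has_pc_integral_product:
  assumes P: "grid P" "adapted P \<phi>" "adapted P \<psi>"
  shows "has_pc_integral R (\<lambda>s t. \<phi> s * \<psi> t)
    (gap_sum P (\<lambda>x y. gap_sum P (\<lambda>x' y'. \<phi> y * \<psi> y' * rect_incr R x y x' y')))"
proof (rule has_pc_integral_cellwise[OF P(1)])
  fix x y x' y' s t
  assume *: "(x, y) \<in> gaps P" "(x', y') \<in> gaps P" "x < s" "s < y" "x' < t" "t < y'"
  show "\<phi> s * \<psi> t = \<phi> y * \<psi> y'"
    by (rule arg_cong2[OF adaptedD[OF P(2) *(1)] adaptedD[OF P(3) *(2)]]) (use * in auto)
qed

lemma step_inner_eq:
  assumes "grid P" "adapted P \<phi>" "adapted P \<psi>"
  shows "step_inner R \<phi> \<psi> =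
    gap_sum P (\<lambda>x y. gap_sum P (\<lambda>x' y'. \<phi> y * \<psi> y' * rect_incr R x y x' y'))"
  unfolding step_inner_def by (rule pc_integral_eq[OF has_pc_integral_product[OF assms]])

lemma gap_sum_zero [simp]: "gap_sum P (\<lambda>x y. 0) = 0"
  by (simp add: gap_sum_def)

lemma step_inner_zero:
  "\<phi> \<in> step_functions \<Longrightarrow> step_inner R \<phi> (\<lambda>s. 0) = 0"
  "\<phi> \<in> step_functions \<Longrightarrow> step_inner R (\<lambda>s. 0) \<phi> = 0"
  using step_functions_iff by (auto simp: step_inner_eq adapted_zero)

lemma step_inner2_on_component:
  assumes "\<phi> \<in> step_functions" "\<psi> \<in> step_functions"
  shows "step_inner2 R (on_component i \<phi>) (on_component j \<psi>) = (if i = j then step_inner (R i) \<phi> \<psi> else 0)"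
proof -
  have "step_inner (R k) (\<lambda>s. on_component i \<phi> (s, k)) (\<lambda>s. on_component j \<psi> (s, k)) =
      (if k = i then if i = j then step_inner (R i) \<phi> \<psi> else 0 else 0)" for k
  proof (cases "k = i")
    case True
    then show ?thesis using assms(1) by (simp add: on_component_def step_inner_zero)
  next
    case False
    moreover have "(\<lambda>s. on_component j \<psi> (s, k)) \<in> step_functions"
      using on_component_mem[OF assms(2)] by (simp add: step_functions2_def)
    ultimately show ?thesis by (simp add: on_component_def[of i] step_inner_zero)
  qed
  then show ?thesis unfolding step_inner2_def by simp
qed

text \<open>On a gap \<open>(x,y)\<close> of a grid containing \<open>s\<close>, multiplication by the indicator of \<open>(0,s]\<close> amounts to truncating both ends
  at \<open>s\<close>. The double sum becomes a telescoping one in both variables.\<close>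

lemma step_inner_indicators:
  assumes "s \<in> {0..1}" "t \<in> {0..1}"
  shows "step_inner R (indicator {0<..s}) (indicator {0<..t}) = rect_incr R 0 s 0 t"
proof -
  define P where "P = {0, s, t, 1}"
  have P: "grid P" "s \<in> P" "t \<in> P" "0 \<in> P" using assms by (auto simp: P_def grid_def)
  have tele: "gap_sum P (\<lambda>x y. f (min y c) - f (min x c)) = f c - f 0" if "c \<in> {0..1}" for c and f :: "real \<Rightarrow> real"
    using gap_sum_telescope[of P 0 1 "\<lambda>z. f (min z c)"] P(1) that by (simp add: grid_def)
  have ind: "indicator {0<..c} y = (if x < c then 1 else 0 :: real)" "x < c \<Longrightarrow> min x c = x \<and> min y c = y"
    "\<not> x < c \<Longrightarrow> min x c = c \<and> min y c = c"
    if "(x, y) \<in> gaps P" "c \<in> P" for x y c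
    using gapsD(3,4)[OF that(1)] gapsD(4)[OF that] grid_gap_bounds[OF P(1) that(1)]
    by (auto simp: indicator_def)
  have "step_inner R (indicator {0<..s}) (indicator {0<..t}) =
    gap_sum P (\<lambda>x y. gap_sum P (\<lambda>x' y'. indicator {0<..s} y * indicator {0<..t} y' * rect_incr R x y x' y'))"
    by (rule step_inner_eq) (use P in \<open>auto intro: adapted_indicator\<close>)
  also have "\<dots> = gap_sum P (\<lambda>x y. gap_sum P (\<lambda>x' y'.
      (R (min y s) (min y' t) - R (min x s) (min y' t)) - (R (min y s) (min x' t) - R (min x s) (min x' t))))"
  proof (intro gap_sum_cong)
    fix x y x' y' assume "(x, y) \<in> gaps P" "(x', y') \<in> gaps P"
    then show "indicator {0<..s} y * indicator {0<..t} y' * rect_incr R x y x' y' =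
      (R (min y s) (min y' t) - R (min x s) (min y' t)) - (R (min y s) (min x' t) - R (min x s) (min x' t))"
      using ind[of x y s] ind[of x' y' t] P by (cases "x < s"; cases "x' < t") (simp_all add: rect_incr_def)
  qed
  also have "\<dots> = gap_sum P (\<lambda>x y. (R (min y s) t - R (min y s) 0) - (R (min x s) t - R (min x s) 0))"
    using tele[OF assms(2), of "\<lambda>z. R (min y s) z - R (min x s) z" for x y] by (intro gap_sum_cong) simp
  also have "\<dots> = rect_incr R 0 s 0 t"
    using tele[OF assms(1), of "\<lambda>z. R z t - R z 0"] by (simp add: rect_incr_def)
  finally show ?thesis .
qed

text \<open>The Hilbert-space counterpart of the process \<open>X i\<close>.\<close>

definition curve :: "((real \<times> 2 \<Rightarrow> real) \<Rightarrow> 'h) \<Rightarrow> 2 \<Rightarrow> real \<Rightarrow> 'h" where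
  "curve \<iota> i u = \<iota> (on_component i (indicator {0<..u}))"

lemma
  assumes "hilbert_completion V B \<iota>"
  shows completion_add: "f \<in> V \<Longrightarrow> g \<in> V \<Longrightarrow> \<iota> (\<lambda>x. f x + g x) = \<iota> f + \<iota> g"
    and completion_scale: "f \<in> V \<Longrightarrow> \<iota> (\<lambda>x. c * f x) = c *\<^sub>R \<iota> f"
    and completion_inner: "f \<in> V \<Longrightarrow> g \<in> V \<Longrightarrow> inner (\<iota> f) (\<iota> g) = B f g"
  using assms unfolding hilbert_completion_def by blast+

lemma completion_sum:
  assumes \<iota>: "hilbert_completion step_functions2 B \<iota>"
    and f: "\<And>k. k \<in> I \<Longrightarrow> f k \<in> step_functions2"
  shows "\<iota> (\<lambda>x. \<Sum>k\<in>I. c k * f k x) = (\<Sum>k\<in>I. c k *\<^sub>R \<iota> (f k))"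
  using f
proof (induction I rule: infinite_finite_induct)
  case (insert k I)
  then show ?case
    using step2_sum[of I f c] step2_scale[of "f k" "c k"]
    by (simp add: completion_add[OF \<iota>] completion_scale[OF \<iota>])
qed (use completion_scale[OF \<iota> step2_zero, of 0] in simp_all)

context
  fixes R :: "2 \<Rightarrow> real \<Rightarrow> real \<Rightarrow> real"
    and \<iota> :: "(real \<times> 2 \<Rightarrow> real) \<Rightarrow> 'h::{real_inner, complete_space}"
  assumes \<iota>: "hilbert_completion step_functions2 (step_inner2 R) \<iota>"
begin

lemma embed_inner:
  assumes "\<phi> \<in> step_functions" "\<psi> \<in> step_functions"
  shows "inner (\<iota> (on_component i \<phi>)) (\<iota> (on_component j \<psi>)) = (if i = j then step_inner (R i) \<phi> \<psi> else 0)"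
  using completion_inner[OF \<iota> on_component_mem on_component_mem] assms
  by (simp add: step_inner2_on_component)

lemma curve_increment:
  assumes "a \<in> {0..1}" "b \<in> {0..1}" "a \<le> b"
  shows "\<iota> (on_component i (indicator {a<..b})) = curve \<iota> i b - curve \<iota> i a"
proof -
  have "on_component i (indicator {0<..b}) =
      (\<lambda>x. on_component i (indicator {0<..a}) x + on_component i (indicator {a<..b}) x)"
    using assms by (auto simp: on_component_def indicator_def fun_eq_iff)
  then show ?thesis
    using assms completion_add[OF \<iota> on_component_mem on_component_mem, of "indicator {0<..a}" "indicator {a<..b}" i i]
    by (simp add: curve_def step_indicator)
qed

lemma curve_zero: "curve \<iota> i 0 = 0"
  using curve_increment[of 0 0 i] completion_scale[OF \<iota> on_component_mem[OF step_zero], of 0 i]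
  by (simp add: curve_def on_component_def indicator_def case_prod_unfold cong: if_cong)

lemma curve_is_increment_curve: "increment_curve (curve \<iota> i) (R i)"
proof -
  have "inner (curve \<iota> i s) (curve \<iota> i t) = rect_incr (R i) 0 s 0 t" if "s \<in> {0..1}" "t \<in> {0..1}" for s t
    using that by (simp add: curve_def embed_inner step_indicator step_inner_indicators)
  then show ?thesis
    unfolding increment_curve_def by (simp add: inner_diff_left inner_diff_right rect_incr_def)
qed

lemma curve_orthogonal:
  assumes "i \<noteq> j" "u \<in> {0..1}" "\<phi> \<in> step_functions"
  shows "inner (curve \<iota> i u) (\<iota> (on_component j \<phi>)) = 0"
  using assms by (simp add: curve_def embed_inner step_indicator)

text \<open>A step function is a combination of indicators of gaps, and these embed as increments of the curve.\<close>

lemma embed_expand: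
  assumes P: "grid P" and \<phi>: "adapted P \<phi>"
  shows "\<iota> (on_component i \<phi>) = gap_sum P (\<lambda>x y. \<phi> y *\<^sub>R (curve \<iota> i y - curve \<iota> i x))"
proof -
  have mem: "indicator {fst g<..snd g} \<in> step_functions" if "g \<in> gaps P" for g
    using that grid_gap_bounds[OF P, of "fst g" "snd g"] by (intro step_indicator) auto
  have "on_component i \<phi> x = (\<Sum>g\<in>gaps P. \<phi> (snd g) * on_component i (indicator {fst g<..snd g}) x)" for x
  proof (cases "snd x = i")
    case True
    then have "on_component i w x = w (fst x)" for w by (simp add: on_component_def case_prod_unfold)
    then show ?thesis
      using adapted_expand[OF P \<phi>, of "fst x"] by (simp only: gap_sum_def case_prod_unfold)
  next
    case False
    then have "on_component i w x = 0" for w by (simp add: on_component_def case_prod_unfold)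
    then show ?thesis by simp
  qed
  then have "on_component i \<phi> =
      (\<lambda>x. \<Sum>g\<in>gaps P. \<phi> (snd g) * on_component i (indicator {fst g<..snd g}) x)" by (rule ext)
  then have "\<iota> (on_component i \<phi>) =
      (\<Sum>g\<in>gaps P. \<phi> (snd g) *\<^sub>R \<iota> (on_component i (indicator {fst g<..snd g})))"
    using completion_sum[OF \<iota>, of "gaps P" "\<lambda>g. on_component i (indicator {fst g<..snd g})" "\<lambda>g. \<phi> (snd g)"]
      mem on_component_mem by simp
  also have "\<dots> = (\<Sum>g\<in>gaps P. \<phi> (snd g) *\<^sub>R (curve \<iota> i (snd g) - curve \<iota> i (fst g)))"
    using grid_gap_bounds[OF P] by (intro sum.cong refl arg_cong2[where f = scaleR] curve_increment) force+
  finally show ?thesis by (simp add: gap_sum_def case_prod_unfold)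
qed

lemma embed_components:
  assumes "f \<in> step_functions2"
  shows "\<iota> f = (\<Sum>i\<in>UNIV. \<iota> (on_component i (\<lambda>s. f (s, i))))"
proof -
  have "f = (\<lambda>x. \<Sum>i\<in>UNIV. 1 * on_component i (\<lambda>s. f (s, i)) x)"
    by (auto simp: fun_eq_iff on_component_def)
  then have "\<iota> f = \<iota> (\<lambda>x. \<Sum>i\<in>UNIV. 1 * on_component i (\<lambda>s. f (s, i)) x)" by simp
  also have "\<dots> = (\<Sum>i\<in>UNIV. 1 *\<^sub>R \<iota> (on_component i (\<lambda>s. f (s, i))))"
    using assms by (intro completion_sum[OF \<iota>] on_component_mem) (auto simp: step_functions2_def)
  finally show ?thesis by simp
qed

lemma embed_sum:
  assumes "\<And>k. k \<in> I \<Longrightarrow> \<phi> k \<in> step_functions"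
  shows "\<iota> (on_component i (\<lambda>s. \<Sum>k\<in>I. c k * \<phi> k s)) = (\<Sum>k\<in>I. c k *\<^sub>R \<iota> (on_component i (\<phi> k)))"
proof -
  have "on_component i (\<lambda>s. \<Sum>k\<in>I. c k * \<phi> k s) = (\<lambda>x. \<Sum>k\<in>I. c k * on_component i (\<phi> k) x)"
    by (auto simp: on_component_def fun_eq_iff)
  then show ?thesis
    using completion_sum[OF \<iota>, of I "\<lambda>k. on_component i (\<phi> k)" c] assms on_component_mem by simp
qed

lemma embed_lincomb:
  assumes "\<phi> \<in> step_functions" "\<psi> \<in> step_functions"
  shows "\<iota> (on_component i (\<lambda>s. a * \<phi> s + b * \<psi> s)) =
    a *\<^sub>R \<iota> (on_component i \<phi>) + b *\<^sub>R \<iota> (on_component i \<psi>)"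
  using embed_sum[of UNIV "\<lambda>k. if k then \<phi> else \<psi>" i "\<lambda>k. if k then a else b"] assms
  by (simp add: UNIV_bool add.commute)

text \<open>On a common grid a sum of elementary tensors depends only on the values of the function that it represents; therefore
  \<open>tensor_embed\<close> is well defined.\<close>

lemma tensor_sum_cells:
  assumes T: "bilinear T" and P: "grid P"
    and "\<And>k i. k \<in> I \<Longrightarrow> adapted P (\<lambda>s. \<phi> k (s, i))" "\<And>k i. k \<in> I \<Longrightarrow> adapted P (\<lambda>s. \<psi> k (s, i))"
  shows "(\<Sum>k\<in>I. T (\<iota> (\<phi> k)) (\<iota> (\<psi> k))) =
    (\<Sum>i\<in>UNIV. \<Sum>j\<in>UNIV. \<Sum>g\<in>gaps P. \<Sum>h\<in>gaps P. (\<Sum>k\<in>I. \<phi> k (snd g, i) * \<psi> k (snd h, j)) *\<^sub>R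
       T (curve \<iota> i (snd g) - curve \<iota> i (fst g)) (curve \<iota> j (snd h) - curve \<iota> j (fst h)))"
proof -
  let ?d = "\<lambda>i g. curve \<iota> i (snd g) - curve \<iota> i (fst g)"
  have exp: "\<iota> f = (\<Sum>i\<in>UNIV. \<Sum>g\<in>gaps P. f (snd g, i) *\<^sub>R ?d i g)"
    if "\<And>i. adapted P (\<lambda>s. f (s, i))" for f
  proof -
    have "f \<in> step_functions2" using that P step_functions_iff by (auto simp: step_functions2_def)
    then show ?thesis using embed_components embed_expand[OF P that] by (simp add: gap_sum_def case_prod_unfold)
  qed
  have "(\<Sum>k\<in>I. T (\<iota> (\<phi> k)) (\<iota> (\<psi> k))) =
    (\<Sum>k\<in>I. \<Sum>i\<in>UNIV. \<Sum>g\<in>gaps P. \<Sum>j\<in>UNIV. \<Sum>h\<in>gaps P.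
       (\<phi> k (snd g, i) * \<psi> k (snd h, j)) *\<^sub>R T (?d i g) (?d j h))"
  proof (rule sum.cong[OF refl])
    fix k assume k: "k \<in> I"
    have l: "linear (\<lambda>x. T x z)" and r: "linear (T z)" for z using T by (auto simp: bilinear_def)
    have "T (\<iota> (\<phi> k)) (\<iota> (\<psi> k)) = (\<Sum>i\<in>UNIV. \<Sum>g\<in>gaps P. \<phi> k (snd g, i) *\<^sub>R T (?d i g) (\<iota> (\<psi> k)))"
      unfolding exp[OF assms(3)[OF k]] by (simp add: linear_sum[OF l] linear_scale[OF l])
    also have "\<dots> = (\<Sum>i\<in>UNIV. \<Sum>g\<in>gaps P. \<Sum>j\<in>UNIV. \<Sum>h\<in>gaps P.
       (\<phi> k (snd g, i) * \<psi> k (snd h, j)) *\<^sub>R T (?d i g) (?d j h))"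
      unfolding exp[OF assms(4)[OF k]] by (simp add: linear_sum[OF r] linear_scale[OF r] scaleR_sum_right)
    finally show "T (\<iota> (\<phi> k)) (\<iota> (\<psi> k)) = \<dots>" .
  qed
  also have "\<dots> = (\<Sum>i\<in>UNIV. \<Sum>g\<in>gaps P. \<Sum>j\<in>UNIV. \<Sum>h\<in>gaps P. \<Sum>k\<in>I.
       (\<phi> k (snd g, i) * \<psi> k (snd h, j)) *\<^sub>R T (?d i g) (?d j h))"
    by (simp add: sum.swap[of _ _ I])
  also have "\<dots> = (\<Sum>i\<in>UNIV. \<Sum>j\<in>UNIV. \<Sum>g\<in>gaps P. \<Sum>h\<in>gaps P. \<Sum>k\<in>I.
       (\<phi> k (snd g, i) * \<psi> k (snd h, j)) *\<^sub>R T (?d i g) (?d j h))"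
    by (rule sum.cong[OF refl], rule sum.swap)
  finally show ?thesis by (simp add: scaleR_sum_left)
qed

lemma tensor_sum_cong:
  assumes T: "bilinear T" and fin: "finite I" "finite J"
    and 1: "\<And>k. k \<in> I \<Longrightarrow> \<phi> k \<in> step_functions2" "\<And>k. k \<in> I \<Longrightarrow> \<psi> k \<in> step_functions2"
    and 2: "\<And>k. k \<in> J \<Longrightarrow> \<phi>' k \<in> step_functions2" "\<And>k. k \<in> J \<Longrightarrow> \<psi>' k \<in> step_functions2"
    and eq: "\<And>y z. (\<Sum>k\<in>I. \<phi> k y * \<psi> k z) = (\<Sum>k\<in>J. \<phi>' k y * \<psi>' k z)"
  shows "(\<Sum>k\<in>I. T (\<iota> (\<phi> k)) (\<iota> (\<psi> k))) = (\<Sum>k\<in>J. T (\<iota> (\<phi>' k)) (\<iota> (\<psi>' k)))"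
proof -
  have *: "\<exists>P. grid P \<and> (\<forall>k\<in>K. \<forall>i. adapted P (\<lambda>s. f k (s, i)))"
    if "finite K" "\<And>k. k \<in> K \<Longrightarrow> f k \<in> step_functions2" for K and f :: "_ \<Rightarrow> real \<times> 2 \<Rightarrow> real"
  proof -
    have "finite (K \<times> (UNIV :: 2 set))" using that(1) by simp
    moreover have "(\<lambda>s. f (fst x) (s, snd x)) \<in> step_functions" if "x \<in> K \<times> (UNIV :: 2 set)" for x
      using that \<open>\<And>k. k \<in> K \<Longrightarrow> f k \<in> step_functions2\<close>[of "fst x"] by (auto simp: step_functions2_def)
    ultimately have "\<exists>P. grid P \<and> (\<forall>x\<in>K \<times> (UNIV :: 2 set). adapted P (\<lambda>s. f (fst x) (s, snd x)))"
      by (rule common_grid)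
    then show ?thesis by auto
  qed
  obtain P1 where P1: "grid P1" "\<forall>k\<in>I. \<forall>i. adapted P1 (\<lambda>s. \<phi> k (s, i))" using *[of I \<phi>, OF fin(1) 1(1)] by blast
  obtain P2 where P2: "grid P2" "\<forall>k\<in>I. \<forall>i. adapted P2 (\<lambda>s. \<psi> k (s, i))" using *[of I \<psi>, OF fin(1) 1(2)] by blast
  obtain P3 where P3: "grid P3" "\<forall>k\<in>J. \<forall>i. adapted P3 (\<lambda>s. \<phi>' k (s, i))" using *[of J \<phi>', OF fin(2) 2(1)] by blast
  obtain P4 where P4: "grid P4" "\<forall>k\<in>J. \<forall>i. adapted P4 (\<lambda>s. \<psi>' k (s, i))" using *[of J \<psi>', OF fin(2) 2(2)] by blast
  define P where "P = P1 \<union> P2 \<union> P3 \<union> P4"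
  have P: "grid P" "P1 \<subseteq> P" "P2 \<subseteq> P" "P3 \<subseteq> P" "P4 \<subseteq> P"
    unfolding P_def using P1 P2 P3 P4 by (auto intro!: grid_Un)
  let ?V = "\<lambda>c. \<Sum>i\<in>UNIV. \<Sum>j\<in>UNIV. \<Sum>g\<in>gaps P. \<Sum>h\<in>gaps P. c (snd g, i) (snd h, j) *\<^sub>R
    T (curve \<iota> i (snd g) - curve \<iota> i (fst g)) (curve \<iota> j (snd h) - curve \<iota> j (fst h))"
  have I: "(\<Sum>k\<in>I. T (\<iota> (\<phi> k)) (\<iota> (\<psi> k))) = ?V (\<lambda>y z. \<Sum>k\<in>I. \<phi> k y * \<psi> k z)"
    by (rule tensor_sum_cells[OF T P(1)]) (use P P1 P2 in \<open>blast intro: adapted_mono\<close>)+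
  have J: "(\<Sum>k\<in>J. T (\<iota> (\<phi>' k)) (\<iota> (\<psi>' k))) = ?V (\<lambda>y z. \<Sum>k\<in>J. \<phi>' k y * \<psi>' k z)"
    by (rule tensor_sum_cells[OF T P(1)]) (use P P3 P4 in \<open>blast intro: adapted_mono\<close>)+
  show ?thesis unfolding I J eq ..
qed

text \<open>Representations over arbitrary finite index sets are admitted, as the natural indices below are pairs.\<close>

lemma tensor_embed_eq:
  assumes T: "bilinear T" and fin: "finite I"
    and "\<And>k. k \<in> I \<Longrightarrow> \<phi> k \<in> step_functions2" "\<And>k. k \<in> I \<Longrightarrow> \<psi> k \<in> step_functions2"
    and f: "\<And>y z. f (y, z) = (\<Sum>k\<in>I. \<phi> k y * \<psi> k z)"
  shows "tensor_embed \<iota> T f = (\<Sum>k\<in>I. T (\<iota> (\<phi> k)) (\<iota> (\<psi> k)))"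
  unfolding tensor_embed_def
proof (rule the_equality)
  obtain h where h: "bij_betw h {0..<card I} I" using ex_bij_betw_nat_finite[OF fin] by blast
  then have hm: "h k \<in> I" if "k < card I" for k using that by (auto simp: bij_betw_def)
  show "\<exists>(n::nat) \<phi>' \<psi>'. (\<forall>k<n. \<phi>' k \<in> step_functions2 \<and> \<psi>' k \<in> step_functions2) \<and>
      f = (\<lambda>(y, z). \<Sum>k<n. \<phi>' k y * \<psi>' k z) \<and>
      (\<Sum>k\<in>I. T (\<iota> (\<phi> k)) (\<iota> (\<psi> k))) = (\<Sum>k<n. T (\<iota> (\<phi>' k)) (\<iota> (\<psi>' k)))"
  proof (rule exI[of _ "card I"], rule exI[of _ "\<lambda>k. \<phi> (h k)"], rule exI[of _ "\<lambda>k. \<psi> (h k)"], intro conjI)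
    show "f = (\<lambda>(y, z). \<Sum>k<card I. \<phi> (h k) y * \<psi> (h k) z)"
      using f sum.reindex_bij_betw[OF h, of "\<lambda>k. \<phi> k y * \<psi> k z" for y z]
      by (auto simp: fun_eq_iff lessThan_atLeast0)
    show "(\<Sum>k\<in>I. T (\<iota> (\<phi> k)) (\<iota> (\<psi> k))) = (\<Sum>k<card I. T (\<iota> (\<phi> (h k))) (\<iota> (\<psi> (h k))))"
      using sum.reindex_bij_betw[OF h, of "\<lambda>k. T (\<iota> (\<phi> k)) (\<iota> (\<psi> k))"] by (simp add: lessThan_atLeast0)
  qed (use hm assms(3,4) in auto)
next
  fix x assume "\<exists>(n::nat) \<phi>' \<psi>'. (\<forall>k<n. \<phi>' k \<in> step_functions2 \<and> \<psi>' k \<in> step_functions2) \<and>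
      f = (\<lambda>(y, z). \<Sum>k<n. \<phi>' k y * \<psi>' k z) \<and> x = (\<Sum>k<n. T (\<iota> (\<phi>' k)) (\<iota> (\<psi>' k)))"
  then obtain n :: nat and \<phi>' \<psi>' where
    m: "\<forall>k<n. \<phi>' k \<in> step_functions2 \<and> \<psi>' k \<in> step_functions2" and
    f': "f = (\<lambda>(y, z). \<Sum>k<n. \<phi>' k y * \<psi>' k z)" and x: "x = (\<Sum>k<n. T (\<iota> (\<phi>' k)) (\<iota> (\<psi>' k)))" by blast
  have "(\<Sum>k<n. \<phi>' k y * \<psi>' k z) = (\<Sum>k\<in>I. \<phi> k y * \<psi> k z)" for y z
    using f[of y z] f' by simp
  then show "x = (\<Sum>k\<in>I. T (\<iota> (\<phi> k)) (\<iota> (\<psi> k)))"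
    unfolding x using m fin assms(3,4) by (intro tensor_sum_cong[OF T]) auto
qed

end

section \<open>Mean-square continuity of Gaussian processes\<close>

lemma (in prob_space) centered_gaussian_rv_moments:
  assumes Y: "centered_gaussian_rv M Y" "random_variable borel Y"
  shows "integrable M (\<lambda>\<omega>. (Y \<omega>)\<^sup>2)" "expectation Y = 0"
    "expectation (\<lambda>\<omega>. cos (Y \<omega>)) = exp (- expectation (\<lambda>\<omega>. (Y \<omega>)\<^sup>2) / 2)"
proof -
  note [measurable] = Y(2)
  consider "AE \<omega> in M. Y \<omega> = 0" | \<sigma> where "\<sigma> > 0" "distributed M lborel Y (normal_density 0 \<sigma>)"
    using Y(1) unfolding centered_gaussian_rv_def by blast
  then have "integrable M (\<lambda>\<omega>. (Y \<omega>)\<^sup>2) \<and> expectation Y = 0 \<and>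
    expectation (\<lambda>\<omega>. cos (Y \<omega>)) = exp (- expectation (\<lambda>\<omega>. (Y \<omega>)\<^sup>2) / 2)"
  proof cases
    case 1
    have "integrable M (\<lambda>\<omega>. (Y \<omega>)\<^sup>2)"
      by (rule integrable_cong_AE_imp[of M "\<lambda>_. 0"]) (use 1 in \<open>auto elim: AE_mp\<close>)
    moreover have "expectation Y = expectation (\<lambda>_. 0)"
      by (rule integral_cong_AE) (use 1 in auto)
    moreover have "expectation (\<lambda>\<omega>. (Y \<omega>)\<^sup>2) = expectation (\<lambda>_. 0)"
      by (rule integral_cong_AE) (use 1 in \<open>auto elim: AE_mp\<close>)
    moreover have "expectation (\<lambda>\<omega>. cos (Y \<omega>)) = expectation (\<lambda>_. 1)"
      by (rule integral_cong_AE) (use 1 in \<open>auto elim: AE_mp\<close>)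
    ultimately show ?thesis by (simp add: prob_space)
  next
    case 2
    note D = 2(2)
    have sq: "integrable M (\<lambda>\<omega>. (Y \<omega>)\<^sup>2)"
      using distributed_integrable[OF D, of "\<lambda>x. x\<^sup>2"] integrable_normal_moment[OF 2(1), of 0 2] by simp
    have mean: "expectation Y = 0" by (rule normal_distributed_expectation[OF 2(1) D])
    have var: "expectation (\<lambda>\<omega>. (Y \<omega>)\<^sup>2) = \<sigma>\<^sup>2"
      using normal_distributed_variance[OF 2(1) D] by (simp add: mean)
    have Z: "distributed M lborel (\<lambda>\<omega>. Y \<omega> / \<sigma>) std_normal_density"
      using normal_standard_normal_convert[OF 2(1), of Y 0] D by simp
    interpret N: real_distribution std_normal_distribution by (rule real_dist_normal_dist)
    have "expectation (\<lambda>\<omega>. cos (Y \<omega>)) = (\<integral>x. std_normal_density x * cos (\<sigma> * x) \<partial>lborel)"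
      using distributed_integral[OF Z, of "\<lambda>x. cos (\<sigma> * x)"] 2(1) by simp
    also have "\<dots> = (\<integral>x. cos (\<sigma> * x) \<partial>std_normal_distribution)"
      by (subst integral_density) auto
    also have "\<dots> = (\<integral>x. Re (iexp (\<sigma> * x)) \<partial>std_normal_distribution)"
      by (simp add: Re_exp)
    also have "\<dots> = Re (char std_normal_distribution \<sigma>)"
      unfolding char_def by (rule integral_Re) (auto intro!: N.integrable_iexp)
    also have "\<dots> = exp (- \<sigma>\<^sup>2 / 2)" by (simp add: char_std_normal_distribution)
    finally show ?thesis using sq mean var by simp
  qed
  then show "integrable M (\<lambda>\<omega>. (Y \<omega>)\<^sup>2)" "expectation Y = 0"
    "expectation (\<lambda>\<omega>. cos (Y \<omega>)) = exp (- expectation (\<lambda>\<omega>. (Y \<omega>)\<^sup>2) / 2)" by auto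
qed

text \<open>Almost sure convergence of \<open>X(t\<^sub>n)\<close> to \<open>X(s)\<close> gives convergence of the expected cosines of the differences to 1 by
  dominated convergence. For a centred Gaussian variable of variance \<open>V\<close> this expectation is \<open>exp(-V/2)\<close>, so the
  variances tend to 0.\<close>

lemma (in prob_space) gaussian_process_L2_continuous:
  assumes gauss: "centered_gaussian_process M X" and cont: "continuous_process M X"
    and R: "is_covariance_function M X R"
    and t: "\<And>n. t n \<in> {0..1}" "s \<in> {0..1}" "t \<longlonglongrightarrow> s"
  shows "(\<lambda>n. rect_incr R s (t n) s (t n)) \<longlonglongrightarrow> 0"
proof -
  have X [measurable]: "X u \<in> borel_measurable M" if "u \<in> {0..1}" for u
    using gauss that by (simp add: centered_gaussian_process_def)
  have comb: "centered_gaussian_rv M (\<lambda>\<omega>. \<Sum>k<n. c k * X (\<tau> k) \<omega>)"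
    if "\<forall>k<n. \<tau> k \<in> {0..1}" for n \<tau> and c :: "nat \<Rightarrow> real"
    using gauss that unfolding centered_gaussian_process_def by blast
  have single: "centered_gaussian_rv M (X u)" if "u \<in> {0..1}" for u
    using comb[of 1 "\<lambda>_. u" "\<lambda>_. 1"] that by simp
  have diff: "centered_gaussian_rv M (\<lambda>\<omega>. X u \<omega> - X v \<omega>)" if "u \<in> {0..1}" "v \<in> {0..1}" for u v
    using comb[of 2 "\<lambda>k. if k = 0 then u else v" "\<lambda>k. if k = 0 then 1 else -1"] that
    by (simp add: numeral_2_eq_2)
  have sq: "integrable M (\<lambda>\<omega>. (X u \<omega>)\<^sup>2)" "expectation (X u) = 0" if "u \<in> {0..1}" for u
    using centered_gaussian_rv_moments[OF single X] that by auto
  have prod: "integrable M (\<lambda>\<omega>. X u \<omega> * X v \<omega>)" if "u \<in> {0..1}" "v \<in> {0..1}" for u v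
  proof (rule Bochner_Integration.integrable_bound)
    show "integrable M (\<lambda>\<omega>. (X u \<omega>)\<^sup>2 + (X v \<omega>)\<^sup>2)" using sq that by auto
    show "AE \<omega> in M. norm (X u \<omega> * X v \<omega>) \<le> norm ((X u \<omega>)\<^sup>2 + (X v \<omega>)\<^sup>2)"
    proof (rule AE_I2)
      fix \<omega>
      have "2 * \<bar>X u \<omega> * X v \<omega>\<bar> \<le> (X u \<omega>)\<^sup>2 + (X v \<omega>)\<^sup>2"
        using sum_squares_bound[of "\<bar>X u \<omega>\<bar>" "\<bar>X v \<omega>\<bar>"] by (simp add: abs_mult)
      then show "norm (X u \<omega> * X v \<omega>) \<le> norm ((X u \<omega>)\<^sup>2 + (X v \<omega>)\<^sup>2)" by simp
    qed
  qed (use that in measurable)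
  have cov: "R u v = expectation (\<lambda>\<omega>. X u \<omega> * X v \<omega>)" if "u \<in> {0..1}" "v \<in> {0..1}" for u v
    using R that sq(2) by (simp add: is_covariance_function_def covariance_def)
  define V where "V n = expectation (\<lambda>\<omega>. (X (t n) \<omega> - X s \<omega>)\<^sup>2)" for n
  have "rect_incr R s (t n) s (t n) = V n" for n
  proof -
    have "V n = expectation (\<lambda>\<omega>. X (t n) \<omega> * X (t n) \<omega> - X (t n) \<omega> * X s \<omega> - X s \<omega> * X (t n) \<omega> + X s \<omega> * X s \<omega>)"
      unfolding V_def by (rule arg_cong[of _ _ expectation]) (auto simp: power2_eq_square algebra_simps)
    then show ?thesis using prod t(1)[of n] t(2) by (simp add: rect_incr_def cov mult.commute)
  qed
  moreover have "V \<longlonglongrightarrow> 0"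
  proof -
    have "(\<lambda>n. expectation (\<lambda>\<omega>. cos (X (t n) \<omega> - X s \<omega>))) \<longlonglongrightarrow> expectation (\<lambda>\<omega>. 1)"
    proof (rule integral_dominated_convergence[where w = "\<lambda>_. 1"])
      show "AE \<omega> in M. (\<lambda>n. cos (X (t n) \<omega> - X s \<omega>)) \<longlonglongrightarrow> 1"
        using cont unfolding continuous_process_def
      proof eventually_elim
        fix \<omega> assume "continuous_on {0..1} (\<lambda>u. X u \<omega>)"
        then have "(\<lambda>n. X (t n) \<omega>) \<longlonglongrightarrow> X s \<omega>"
          using continuous_on_tendsto_compose[of "{0..1}" "\<lambda>u. X u \<omega>" t s sequentially] t by simp
        then have "(\<lambda>n. cos (X (t n) \<omega> - X s \<omega>)) \<longlonglongrightarrow> cos (X s \<omega> - X s \<omega>)"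
          by (intro tendsto_intros)
        then show "(\<lambda>n. cos (X (t n) \<omega> - X s \<omega>)) \<longlonglongrightarrow> 1" by simp
      qed
    qed (use X[OF t(1)] X[OF t(2)] in \<open>auto intro!: borel_measurable_cos borel_measurable_diff\<close>)
    moreover have "expectation (\<lambda>\<omega>. cos (X (t n) \<omega> - X s \<omega>)) = exp (- V n / 2)" for n
      unfolding V_def using t by (intro centered_gaussian_rv_moments(3) diff borel_measurable_diff X) auto
    ultimately have "(\<lambda>n. exp (- V n / 2)) \<longlonglongrightarrow> 1" by (simp add: prob_space)
    then have "(\<lambda>n. - 2 * ln (exp (- V n / 2))) \<longlonglongrightarrow> - 2 * ln 1"
      by (intro tendsto_intros) auto
    then show ?thesis by simp
  qed
  ultimately show ?thesis by simp
qed

lemma increment_curve_continuous: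
  assumes "increment_curve e R"
    and "\<And>t s. (\<And>n. t n \<in> {0..1}) \<Longrightarrow> s \<in> {0..1} \<Longrightarrow> t \<longlonglongrightarrow> s \<Longrightarrow>
      (\<lambda>n. rect_incr R s (t n) s (t n)) \<longlonglongrightarrow> 0"
  shows "continuous_on {0..1} e"
  unfolding continuous_on_sequentially
proof (intro allI ballI impI, elim conjE)
  fix t s assume t: "\<forall>n. t n \<in> {0..1::real}" "s \<in> {0..1}" "t \<longlonglongrightarrow> s"
  have "(norm (e (t n) - e s))\<^sup>2 = rect_incr R s (t n) s (t n)" for n
    using assms(1) t(1,2) unfolding increment_curve_def power2_norm_eq_inner by blast
  then have "(\<lambda>n. (norm (e (t n) - e s))\<^sup>2) \<longlonglongrightarrow> 0" using assms(2)[of t s] t by simp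
  then have "(\<lambda>n. sqrt ((norm (e (t n) - e s))\<^sup>2)) \<longlonglongrightarrow> sqrt 0" by (rule tendsto_real_sqrt)
  then have "(\<lambda>n. e (t n) - e s) \<longlonglongrightarrow> 0" by (simp add: tendsto_norm_zero_iff)
  then show "(e \<circ> t) \<longlonglongrightarrow> e s" by (simp add: LIM_zero_iff comp_def)
qed

section \<open>The iterated integral against the Levy kernel\<close>

lemma tagged_sum_shift:
  assumes T: "bilinear T" and t: "is_partition a b n t"
  shows "(\<Sum>k<n. T (e (\<xi> k) - h) (f (t (Suc k)) - f (t k))) = tagged_sum T e f n t \<xi> - T h (f b - f a)"
proof -
  have "(\<Sum>k<n. T h (f (t (Suc k)) - f (t k))) = T h (\<Sum>k<n. f (t (Suc k)) - f (t k))"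
    using T by (simp add: bilinear_def linear_sum)
  also have "(\<Sum>k<n. f (t (Suc k)) - f (t k)) = f b - f a"
    using sum_lessThan_telescope[of "\<lambda>k. f (t k)" n] t by (simp add: is_partition_def)
  finally show ?thesis by (simp add: tagged_sum_def bilinear_lsub[OF T] sum_subtractf)
qed

lemma sum_rect_incr_column:
  assumes "is_partition c d m u"
  shows "(\<Sum>l<m. rect_incr R x y (u l) (u (Suc l))) = rect_incr R x y c d"
  using sum_lessThan_telescope[of "\<lambda>l. R y (u l) - R x (u l)" m] assms
  by (simp add: is_partition_def rect_incr_def algebra_simps)

lemma has_tensor_integralE:
  assumes "has_tensor_integral T e f a b L" "\<epsilon> > 0"
  obtains \<delta> where "\<delta> > 0" "\<And>n t \<xi>. fine_tagged \<delta> a b n t \<xi> \<Longrightarrow> norm (tagged_sum T e f n t \<xi> - L) < \<epsilon>"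
  using assms unfolding has_tensor_integral_def by blast

text \<open>The integrand depends on the first variable only, so the sum over the second partition telescopes and the Riemann sum is
  the inner product of a tensor-valued tagged sum with a fixed tensor.\<close>

lemma has_rs_integral_from_tensor:
  fixes e f :: "real \<Rightarrow> 'h::{real_inner, complete_space}" and T :: "'h \<Rightarrow> 'h \<Rightarrow> 'k::{real_inner, complete_space}"
  assumes T: "hilbert_tensor_square T" and f: "increment_curve f R"
    and L: "has_tensor_integral T e f a b L" and bounds: "0 \<le> a" "b \<le> 1" "c \<in> {0..1}" "d \<in> {0..1}"
  shows "has_rs_integral R a b c d (\<lambda>u v. \<Sum>k\<in>K. w k * inner (e u - h) (\<Phi> k))
    (inner (L - T h (f b - f a)) (\<Sum>k\<in>K. w k *\<^sub>R T (\<Phi> k) (f d - f c)))"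
  unfolding has_rs_integral_def
proof (intro allI impI)
  fix \<epsilon> :: real assume "\<epsilon> > 0"
  let ?W = "\<Sum>k\<in>K. w k *\<^sub>R T (\<Phi> k) (f d - f c)"
  note bil = tensor_bilinear[OF T]
  have W: "norm ?W + 1 > 0" by (simp add: add_nonneg_pos)
  obtain \<delta> where \<delta>: "\<delta> > 0"
    "\<And>n t \<xi>. fine_tagged \<delta> a b n t \<xi> \<Longrightarrow> norm (tagged_sum T e f n t \<xi> - L) < \<epsilon> / (norm ?W + 1)"
    using has_tensor_integralE[OF L divide_pos_pos[OF \<open>\<epsilon> > 0\<close> W]] by blast
  let ?S = "\<lambda>n t \<xi> m u. \<Sum>i<n. \<Sum>l<m. (\<Sum>k\<in>K. w k * inner (e (\<xi> i) - h) (\<Phi> k)) *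
      rect_incr R (t i) (t (Suc i)) (u l) (u (Suc l))"
  have main: "\<bar>?S n t \<xi> m u
      - inner (L - T h (f b - f a)) ?W\<bar> < \<epsilon>"
    if t: "fine_tagged \<delta> a b n t \<xi>" and u: "fine_tagged \<delta> c d m u \<eta>" for n t \<xi> m u \<eta>
  proof -
    have pt: "is_partition a b n t" and pu: "is_partition c d m u" using t u by (auto simp: fine_tagged_def)
    have tb: "t i \<in> {0..1}" if "i \<le> n" for i using partition_bounds[OF pt that] bounds by auto
    have "?S n t \<xi> m u =
      (\<Sum>i<n. (\<Sum>k\<in>K. w k * inner (e (\<xi> i) - h) (\<Phi> k)) * inner (f (t (Suc i)) - f (t i)) (f d - f c))"
      using f tb bounds by (simp add: sum_rect_incr_column[OF pu] increment_curve_def flip: sum_distrib_left)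
    also have "\<dots> = (\<Sum>i<n. inner (T (e (\<xi> i) - h) (f (t (Suc i)) - f (t i))) ?W)"
      by (simp add: inner_sum_right tensor_inner[OF T] sum_distrib_right mult_ac)
    also have "\<dots> = inner (tagged_sum T e f n t \<xi> - T h (f b - f a)) ?W"
      unfolding tagged_sum_shift[OF bil pt, symmetric] by (simp add: inner_sum_left)
    finally have "\<bar>?S n t \<xi> m u
      - inner (L - T h (f b - f a)) ?W\<bar> = \<bar>inner (tagged_sum T e f n t \<xi> - L) ?W\<bar>"
      by (simp add: inner_diff_left)
    also have "\<dots> \<le> norm (tagged_sum T e f n t \<xi> - L) * norm ?W" by (rule Cauchy_Schwarz_ineq2)
    also have "\<dots> \<le> norm (tagged_sum T e f n t \<xi> - L) * (norm ?W + 1)" by (intro mult_left_mono) auto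
    also have "\<dots> < \<epsilon>" using \<delta>(2)[OF t] W by (simp add: pos_less_divide_eq)
    finally show ?thesis .
  qed
  show "\<exists>\<delta>>0. \<forall>n t \<xi> m u \<eta>. fine_tagged \<delta> a b n t \<xi> \<and> fine_tagged \<delta> c d m u \<eta> \<longrightarrow>
    \<bar>?S n t \<xi> m u
      - inner (L - T h (f b - f a)) ?W\<bar> < \<epsilon>"
    by (intro exI[of _ \<delta>] conjI \<delta>(1) allI impI main) auto
qed

lemma has_tensor_integral_tendsto:
  assumes L: "has_tensor_integral T e f a b L"
    and fine: "\<And>\<delta>. \<delta> > 0 \<Longrightarrow> eventually (\<lambda>m. fine_tagged \<delta> a b (n m) (t m) (\<xi> m)) F"
  shows "((\<lambda>m. tagged_sum T e f (n m) (t m) (\<xi> m)) \<longlongrightarrow> L) F"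
proof (rule tendstoI)
  fix \<epsilon> :: real assume "\<epsilon> > 0"
  then obtain \<delta> where \<delta>: "\<delta> > 0" "\<And>n t \<xi>. fine_tagged \<delta> a b n t \<xi> \<Longrightarrow> norm (tagged_sum T e f n t \<xi> - L) < \<epsilon>"
    using L unfolding has_tensor_integral_def by blast
  show "eventually (\<lambda>m. dist (tagged_sum T e f (n m) (t m) (\<xi> m)) L < \<epsilon>) F"
    using fine[OF \<delta>(1)] by eventually_elim (simp add: dist_norm \<delta>(2))
qed

abbreviation dyadic :: "nat \<Rightarrow> nat \<Rightarrow> real" where
  "dyadic n k \<equiv> real k / 2 ^ n"

lemma dyadic_fine:
  assumes "\<delta> > 0"
  shows "eventually (\<lambda>n. fine_tagged \<delta> 0 1 (2 ^ n) (dyadic n) (dyadic n)) sequentially"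
    and "eventually (\<lambda>n. fine_tagged \<delta> 0 1 (2 ^ n) (dyadic n) (\<lambda>k. dyadic n (Suc k))) sequentially"
proof -
  have "(\<lambda>n. (1 / 2) ^ n) \<longlonglongrightarrow> (0::real)" by (rule LIMSEQ_power_zero) simp
  then have ev: "eventually (\<lambda>n. (1 / 2) ^ n < \<delta>) sequentially" using assms by (rule order_tendstoD)
  have *: "fine_tagged \<delta> 0 1 (2 ^ n) (dyadic n) (dyadic n) \<and> fine_tagged \<delta> 0 1 (2 ^ n) (dyadic n) (\<lambda>k. dyadic n (Suc k))"
    if "(1 / 2) ^ n < \<delta>" for n
  proof -
    have "dyadic n (Suc k) - dyadic n k = (1 / 2) ^ n" for k
      by (simp add: power_divide flip: diff_divide_distrib)
    moreover have "dyadic n k < dyadic n (Suc k)" for k by (simp add: divide_strict_right_mono)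
    ultimately show ?thesis using that by (auto simp: fine_tagged_def is_partition_def less_imp_le)
  qed
  show "eventually (\<lambda>n. fine_tagged \<delta> 0 1 (2 ^ n) (dyadic n) (dyadic n)) sequentially"
    using ev by eventually_elim (rule *[THEN conjunct1])
  show "eventually (\<lambda>n. fine_tagged \<delta> 0 1 (2 ^ n) (dyadic n) (\<lambda>k. dyadic n (Suc k))) sequentially"
    using ev by eventually_elim (rule *[THEN conjunct2])
qed

lemma dyadic_partition: "is_partition 0 1 (2 ^ n) (dyadic n)"
  by (simp add: is_partition_def divide_strict_right_mono)

context
  fixes R :: "2 \<Rightarrow> real \<Rightarrow> real \<Rightarrow> real"
    and \<iota> :: "(real \<times> 2 \<Rightarrow> real) \<Rightarrow> 'h::{real_inner, complete_space}"
    and T :: "'h \<Rightarrow> 'h \<Rightarrow> 'k::{real_inner, complete_space}"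
  assumes \<iota>: "hilbert_completion step_functions2 (step_inner2 R) \<iota>"
    and T: "hilbert_tensor_square T"
begin

text \<open>The tensor integral of component \<open>i\<close> against component \<open>j\<close> lies in the \<open>(i,j)\<close> block of the tensor square.\<close>

lemma tensor_integral_orthogonal:
  assumes L: "has_tensor_integral T (curve \<iota> i) (curve \<iota> j) 0 1 L"
    and "\<phi> \<in> step_functions" "\<psi> \<in> step_functions" "i' \<noteq> i \<or> j' \<noteq> j"
  shows "inner L (T (\<iota> (on_component i' \<phi>)) (\<iota> (on_component j' \<psi>))) = 0"
proof -
  let ?S = "\<lambda>n. tagged_sum T (curve \<iota> i) (curve \<iota> j) (2 ^ n) (dyadic n) (dyadic n)"
  have "?S \<longlonglongrightarrow> L" by (rule has_tensor_integral_tendsto[OF L dyadic_fine(1)])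
  then have "(\<lambda>n. inner (?S n) (T (\<iota> (on_component i' \<phi>)) (\<iota> (on_component j' \<psi>)))) \<longlonglongrightarrow>
      inner L (T (\<iota> (on_component i' \<phi>)) (\<iota> (on_component j' \<psi>)))" by (intro tendsto_intros)
  moreover have "inner (?S n) (T (\<iota> (on_component i' \<phi>)) (\<iota> (on_component j' \<psi>))) = 0" for n
  proof -
    have "inner (curve \<iota> i (dyadic n k)) (\<iota> (on_component i' \<phi>)) *
        inner (curve \<iota> j (dyadic n (Suc k)) - curve \<iota> j (dyadic n k)) (\<iota> (on_component j' \<psi>)) = 0" if "k < 2 ^ n" for k
    proof -
      have d: "dyadic n k \<in> {0..1}" "dyadic n (Suc k) \<in> {0..1}"
        using partition_bounds[OF dyadic_partition, of k n] partition_bounds[OF dyadic_partition, of "Suc k" n] that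
        by simp_all
      from assms(4) show ?thesis
      proof
        assume "i' \<noteq> i"
        then have "inner (curve \<iota> i (dyadic n k)) (\<iota> (on_component i' \<phi>)) = 0"
          by (intro curve_orthogonal[OF \<iota> _ d(1) assms(2)]) simp
        then show ?thesis by simp
      next
        assume "j' \<noteq> j"
        then have "inner (curve \<iota> j (dyadic n k)) (\<iota> (on_component j' \<psi>)) = 0"
          "inner (curve \<iota> j (dyadic n (Suc k))) (\<iota> (on_component j' \<psi>)) = 0"
          by (intro curve_orthogonal[OF \<iota> _ d(1) assms(3)] curve_orthogonal[OF \<iota> _ d(2) assms(3)]; simp)+
        then show ?thesis by (simp only: inner_diff_left) simp
      qed
    qed
    then show ?thesis
      unfolding tagged_sum_def inner_sum_left tensor_inner[OF T] by (intro sum.neutral ballI) (simp only: lessThan_iff)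
  qed
  ultimately show ?thesis by (simp add: LIMSEQ_const_iff)
qed

text \<open>For fixed \<open>u\<close> the kernel agrees off the point \<open>u\<close> with half the difference of the indicators of \<open>(0,u]\<close> and \<open>(u,1]\<close>, a
  step function that is embedded as \<open>e\<^sub>i(u) - e\<^sub>i(1)/2\<close>.\<close>

lemma levy_inner_integral:
  assumes u: "u \<in> {0..1}" and \<phi>: "\<And>k. k \<in> K \<Longrightarrow> \<phi> k \<in> step_functions" and fin: "finite K"
    and F: "\<And>s. s \<in> {0..1} \<Longrightarrow> s < u \<Longrightarrow> F s u = 1 / 2" "\<And>s. s \<in> {0..1} \<Longrightarrow> u < s \<Longrightarrow> F s u = - 1 / 2"
    and g: "\<And>t. g t v = (\<Sum>k\<in>K. \<phi> k t * \<psi> k v)"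
  shows "has_pc_integral (R i) (\<lambda>s t. F s u * g t v)
    (\<Sum>k\<in>K. \<psi> k v * inner (curve \<iota> i u - (1 / 2) *\<^sub>R curve \<iota> i 1) (\<iota> (on_component i (\<phi> k))))"
proof -
  define \<sigma> where "\<sigma> = (\<lambda>s. (1 / 2) * indicator {0<..u} s + (- 1 / 2) * indicator {u<..1} s :: real)"
  define w where "w = (\<lambda>t. \<Sum>k\<in>K. \<psi> k v * \<phi> k t)"
  have ind: "indicator {0<..u} \<in> step_functions" "indicator {u<..1} \<in> step_functions"
    using u by (auto intro: step_indicator)
  have "(\<lambda>s. (1 / 2) * indicator {0<..u} s) \<in> step_functions" "(\<lambda>s. (- 1 / 2) * indicator {u<..1} s) \<in> step_functions"
    by (rule step_scale[OF ind(1)], rule step_scale[OF ind(2)])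
  then have \<sigma>: "\<sigma> \<in> step_functions" unfolding \<sigma>_def by (rule step_add)
  have w: "w \<in> step_functions"
  proof -
    obtain P where P: "grid P" "\<forall>k\<in>K. adapted P (\<phi> k)" using common_grid[of K \<phi>, OF fin \<phi>] by blast
    have "\<forall>k\<in>J. adapted P (\<phi> k) \<Longrightarrow> adapted P (\<lambda>t. \<Sum>k\<in>J. \<psi> k v * \<phi> k t)" for J
      by (induction J rule: infinite_finite_induct) (simp_all add: adapted_zero adapted_add adapted_scale)
    then show ?thesis using P step_functions_iff unfolding w_def by blast
  qed
  obtain P1 P2 where P12: "grid P1" "adapted P1 \<sigma>" "grid P2" "adapted P2 w"
    using \<sigma> w step_functions_iff by blast
  define P where "P = insert u (P1 \<union> P2)"
  have P: "grid P" "u \<in> P" using P12 u unfolding P_def by (auto intro!: grid_insert grid_Un)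
  have ad: "adapted P \<sigma>" "adapted P w"
    using P12 P(1) by (auto simp: P_def intro: adapted_mono)
  have "has_pc_integral (R i) (\<lambda>s t. F s u * g t v)
    (gap_sum P (\<lambda>x y. gap_sum P (\<lambda>x' y'. \<sigma> y * w y' * rect_incr (R i) x y x' y')))"
  proof (rule has_pc_integral_cellwise[OF P(1)])
    fix x y x' y' s t
    assume *: "(x, y) \<in> gaps P" "(x', y') \<in> gaps P" "x < s" "s < y" "x' < t" "t < y'"
    have "u \<le> x \<or> y \<le> u" using gapsD(4)[OF *(1) P(2)] .
    then have "F s u = \<sigma> y"
      using F[of s] * grid_gap_bounds[OF P(1) *(1)] by (auto simp: \<sigma>_def indicator_def)
    moreover have "g t v = w y'"
      using adaptedD[OF ad(2) *(2,5)] *(6) g[of t] by (simp add: w_def mult.commute)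
    ultimately show "F s u * g t v = \<sigma> y * w y'" by simp
  qed
  also have "gap_sum P (\<lambda>x y. gap_sum P (\<lambda>x' y'. \<sigma> y * w y' * rect_incr (R i) x y x' y')) =
      inner (\<iota> (on_component i \<sigma>)) (\<iota> (on_component i w))"
    by (simp add: embed_inner[OF \<iota> \<sigma> w] step_inner_eq[OF P(1) ad])
  also have "\<iota> (on_component i \<sigma>) = (1 / 2) *\<^sub>R (curve \<iota> i u - curve \<iota> i 0) + (- 1 / 2) *\<^sub>R (curve \<iota> i 1 - curve \<iota> i u)"
    unfolding \<sigma>_def embed_lincomb[OF \<iota> ind] using u by (simp add: curve_increment[OF \<iota>])
  also have "\<dots> = ((1 / 2) *\<^sub>R curve \<iota> i u + (1 / 2) *\<^sub>R curve \<iota> i u) - (1 / 2) *\<^sub>R curve \<iota> i 1"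
    by (simp add: curve_zero[OF \<iota>] scaleR_diff_right)
  also have "(1 / 2) *\<^sub>R curve \<iota> i u + (1 / 2) *\<^sub>R curve \<iota> i u = curve \<iota> i u"
    by (simp flip: scaleR_left_distrib)
  also have "\<iota> (on_component i w) = (\<Sum>k\<in>K. \<psi> k v *\<^sub>R \<iota> (on_component i (\<phi> k)))"
    unfolding w_def by (rule embed_sum[OF \<iota> \<phi>])
  finally show ?thesis by (simp add: inner_sum_right)
qed

text \<open>On a grid adapted to all \<open>\<psi> k\<close> the integrand depends continuously on \<open>u\<close> alone within each cell, and the integrals over
  the cells exist by the norm convergence of tagged sums. Their sum is identified through midpoint sums over the
  whole square, which are inner products with the tagged sums for \<open>[0,1]\<close>.\<close>

lemma levy_outer_integral:
  assumes e: "continuous_on {0..1} (curve \<iota> i)"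
    and tensor: "\<And>a b. 0 \<le> a \<Longrightarrow> a < b \<Longrightarrow> b \<le> 1 \<Longrightarrow> \<exists>L. has_tensor_integral T (curve \<iota> i) (curve \<iota> j) a b L"
    and L: "has_tensor_integral T (curve \<iota> i) (curve \<iota> j) 0 1 L"
    and fin: "finite K" and \<psi>: "\<And>k. k \<in> K \<Longrightarrow> \<psi> k \<in> step_functions"
  shows "has_young_integral (R j) (\<lambda>u v. \<Sum>k\<in>K. \<psi> k v * inner (curve \<iota> i u - h) (\<Phi> k))
    (inner (L - T h (curve \<iota> j 1)) (\<Sum>k\<in>K. T (\<Phi> k) (\<iota> (on_component j (\<psi> k)))))"
proof -
  let ?e = "curve \<iota> i" and ?f = "curve \<iota> j"
  let ?G = "\<lambda>u v. \<Sum>k\<in>K. \<psi> k v * inner (?e u - h) (\<Phi> k)"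
  let ?W = "\<Sum>k\<in>K. T (\<Phi> k) (\<iota> (on_component j (\<psi> k)))"
  note f = curve_is_increment_curve[OF \<iota>, of j] and bil = tensor_bilinear[OF T]
  obtain Q where Q: "grid Q" "\<forall>k\<in>K. adapted Q (\<psi> k)" using common_grid[of K \<psi>, OF fin \<psi>] by blast
  have ad: "adapted Q (\<psi> k)" if "k \<in> K" for k using Q(2) that by blast
  obtain n t where t: "is_partition 0 1 n t" "t ` {..n} = Q"
    using partition_of_set[of Q 0 1] Q by (auto simp: grid_def)
  have gap: "(t k, t (Suc k)) \<in> gaps Q" if "k < n" for k
    using gaps_partition[OF t(1)] t(2) that by auto
  have "\<exists>L. has_tensor_integral T ?e ?f (t k) (t (Suc k)) L" if "k < n" for k
    using grid_gap_bounds[OF Q(1) gap[OF that]] by (intro tensor) auto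
  then obtain Lc where Lc: "\<And>k. k < n \<Longrightarrow> has_tensor_integral T ?e ?f (t k) (t (Suc k)) (Lc k)" by metis
  define G' where "G' = (\<lambda>(a::nat) b u (v::real). \<Sum>k\<in>K. \<psi> k (t (Suc b)) * inner (?e u - h) (\<Phi> k))"
  define J where "J a b = inner (Lc a - T h (?f (t (Suc a)) - ?f (t a)))
      (\<Sum>k\<in>K. \<psi> k (t (Suc b)) *\<^sub>R T (\<Phi> k) (?f (t (Suc b)) - ?f (t b)))" for a b
  have young: "has_young_integral (R j) ?G (\<Sum>a<n. \<Sum>b<n. J a b)"
    unfolding has_young_integral_def
  proof (rule exI[of _ n], rule exI[of _ t], rule exI[of _ n], rule exI[of _ t], rule exI[of _ G'], rule exI[of _ J],
      intro conjI allI impI t(1) refl)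
    fix a b assume ab: "a < n" "b < n"
    note ga = grid_gap_bounds[OF Q(1) gap[OF ab(1)]] and gb = grid_gap_bounds[OF Q(1) gap[OF ab(2)]]
    have "continuous_on {t a..t (Suc a)} ?e"
      by (rule continuous_on_subset[OF e]) (use ga in auto)
    then have "continuous_on ({t a..t (Suc a)} \<times> {t b..t (Suc b)}) (\<lambda>x. ?e (fst x))"
      by (rule continuous_on_compose2) (auto intro: continuous_intros)
    then show "continuous_on ({t a..t (Suc a)} \<times> {t b..t (Suc b)}) (\<lambda>(x, y). G' a b x y)"
      unfolding G'_def case_prod_unfold by (intro continuous_intros)
    show "\<forall>x\<in>{t a<..<t (Suc a)}. \<forall>y\<in>{t b<..<t (Suc b)}. ?G x y = G' a b x y"
    proof (intro ballI)
      fix x y assume y: "y \<in> {t b<..<t (Suc b)}"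
      have "\<psi> k y = \<psi> k (t (Suc b))" if "k \<in> K" for k
        by (rule adaptedD[OF ad[OF that] gap[OF ab(2)]]) (use y in auto)
      then show "?G x y = G' a b x y" by (simp add: G'_def)
    qed
    show "has_rs_integral (R j) (t a) (t (Suc a)) (t b) (t (Suc b)) (G' a b) (J a b)"
      unfolding G'_def J_def
      by (rule has_rs_integral_from_tensor[OF T f Lc[OF ab(1)]]) (use ga gb in auto)
  qed
  let ?I = "\<Sum>a<n. \<Sum>b<n. J a b"
  have "?I = inner (L - T h (?f 1)) ?W"
  proof (rule ccontr)
    assume ne: "?I \<noteq> inner (L - T h (?f 1)) ?W"
    define \<epsilon> where "\<epsilon> = \<bar>?I - inner (L - T h (?f 1)) ?W\<bar> / 2"
    have \<epsilon>: "\<epsilon> > 0" using ne by (simp add: \<epsilon>_def)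
    define G where "G = ?G"
    define S where "S = ?I"
    have young': "has_young_integral (R j) G S" using young by (simp add: G_def S_def)
    obtain \<delta> P0 where 1: "\<delta> > 0" "grid P0"
      "\<And>P. grid P \<Longrightarrow> P0 \<subseteq> P \<Longrightarrow> (\<And>x y. (x, y) \<in> gaps P \<Longrightarrow> y - x < \<delta>) \<Longrightarrow> \<bar>grid_sum (R j) P P G - S\<bar> < \<epsilon>"
      using young_integral_midpoint_sums[OF young' \<epsilon>] by metis
    have W: "norm ?W + 1 > 0" by (simp add: add_nonneg_pos)
    obtain \<delta>' where 2: "\<delta>' > 0"
      "\<And>n t \<xi>. fine_tagged \<delta>' 0 1 n t \<xi> \<Longrightarrow> norm (tagged_sum T ?e ?f n t \<xi> - L) < \<epsilon> / (norm ?W + 1)"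
      using has_tensor_integralE[OF L divide_pos_pos[OF \<epsilon> W]] by blast
    obtain P where P: "grid P" "P0 \<union> Q \<subseteq> P" "\<And>x y. (x, y) \<in> gaps P \<Longrightarrow> y - x < min \<delta> \<delta>'"
      using fine_grid_exists[OF grid_Un[OF 1(2) Q(1)], of "min \<delta> \<delta>'"] 1 2 by auto
    have adP: "adapted P (\<psi> k)" if "k \<in> K" for k
      by (rule adapted_mono[OF ad[OF that] Q(1) P(1)]) (use P(2) in auto)
    obtain m s where s: "is_partition 0 1 m s" "s ` {..m} = P"
      using partition_of_set[of P 0 1] P(1) by (auto simp: grid_def)
    let ?\<xi> = "\<lambda>i. mid (s i) (s (Suc i))"
    have sgap: "(s i, s (Suc i)) \<in> gaps P" if "i < m" for i
      using gaps_partition[OF s(1)] s(2) that by auto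
    have "fine_tagged \<delta>' 0 1 m s ?\<xi>"
      unfolding fine_tagged_def using s(1) P(3)[OF sgap] gapsD(3)[OF sgap] by (auto simp: less_imp_le)
    note close = 2(2)[OF this]
    have "grid_sum (R j) P P ?G =
        gap_sum P (\<lambda>x y. \<Sum>k\<in>K. inner (?e (mid x y) - h) (\<Phi> k) * inner (?f y - ?f x) (\<iota> (on_component j (\<psi> k))))"
      unfolding grid_sum_def
    proof (rule gap_sum_cong)
      fix x y assume xy: "(x, y) \<in> gaps P"
      have "?G (mid x y) (mid x' y') * rect_incr (R j) x y x' y' =
          (\<Sum>k\<in>K. inner (?e (mid x y) - h) (\<Phi> k) * (\<psi> k y' * inner (?f y - ?f x) (?f y' - ?f x')))"
        if xy': "(x', y') \<in> gaps P" for x' y'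
      proof -
        have "\<psi> k (mid x' y') = \<psi> k y'" if "k \<in> K" for k
          by (rule adaptedD[OF adP[OF that] xy']) (use gapsD(3)[OF xy'] in auto)
        moreover have "inner (?f y - ?f x) (?f y' - ?f x') = rect_incr (R j) x y x' y'"
          using f grid_gap_bounds[OF P(1) xy] grid_gap_bounds[OF P(1) xy'] unfolding increment_curve_def by blast
        ultimately show ?thesis by (simp add: sum_distrib_left mult_ac)
      qed
      then have "gap_sum P (\<lambda>x' y'. ?G (mid x y) (mid x' y') * rect_incr (R j) x y x' y') =
        gap_sum P (\<lambda>x' y'. \<Sum>k\<in>K. inner (?e (mid x y) - h) (\<Phi> k) * (\<psi> k y' * inner (?f y - ?f x) (?f y' - ?f x')))"
        by (rule gap_sum_cong)
      also have "\<dots> = (\<Sum>k\<in>K. inner (?e (mid x y) - h) (\<Phi> k) * inner (?f y - ?f x) (gap_sum P (\<lambda>x' y'. \<psi> k y' *\<^sub>R (?f y' - ?f x'))))"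
        by (simp add: gap_sum_def case_prod_unfold inner_sum_right sum_distrib_left sum.swap[of _ K])
      also have "\<dots> = (\<Sum>k\<in>K. inner (?e (mid x y) - h) (\<Phi> k) * inner (?f y - ?f x) (\<iota> (on_component j (\<psi> k))))"
        by (intro sum.cong refl) (simp add: embed_expand[OF \<iota> P(1) adP])
      finally show "gap_sum P (\<lambda>x' y'. ?G (mid x y) (mid x' y') * rect_incr (R j) x y x' y') = \<dots>" .
    qed
    also have "\<dots> = inner (\<Sum>i<m. T (?e (?\<xi> i) - h) (?f (s (Suc i)) - ?f (s i))) ?W"
      unfolding s(2)[symmetric] gap_sum_partition[OF s(1)]
      by (simp add: inner_sum_left inner_sum_right tensor_inner[OF T]) (rule sum.swap)
    also have "\<dots> = inner (tagged_sum T ?e ?f m s ?\<xi> - T h (?f 1)) ?W"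
      unfolding tagged_sum_shift[OF bil s(1), of ?e ?\<xi> h ?f] by (simp add: curve_zero[OF \<iota>])
    finally have "\<bar>grid_sum (R j) P P ?G - inner (L - T h (?f 1)) ?W\<bar> = \<bar>inner (tagged_sum T ?e ?f m s ?\<xi> - L) ?W\<bar>"
      by (simp add: inner_diff_left)
    also have "\<dots> \<le> norm (tagged_sum T ?e ?f m s ?\<xi> - L) * norm ?W" by (rule Cauchy_Schwarz_ineq2)
    also have "\<dots> \<le> norm (tagged_sum T ?e ?f m s ?\<xi> - L) * (norm ?W + 1)" by (intro mult_left_mono) auto
    also have "\<dots> < \<epsilon>" using close W by (simp add: pos_less_divide_eq)
    finally have "\<bar>grid_sum (R j) P P ?G - inner (L - T h (?f 1)) ?W\<bar> < \<epsilon>" .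
    moreover have "\<bar>grid_sum (R j) P P ?G - ?I\<bar> < \<epsilon>"
      unfolding G_def[symmetric] S_def[symmetric] using P by (intro 1(3)) fastforce+
    moreover have "\<epsilon> + \<epsilon> = \<bar>?I - inner (L - T h (?f 1)) ?W\<bar>" by (simp add: \<epsilon>_def)
    ultimately show False by linarith
  qed
  then show ?thesis using young by simp
qed

lemma levy_quad_integral:
  assumes e: "continuous_on {0..1} (curve \<iota> i)"
    and tensor: "\<And>a b. 0 \<le> a \<Longrightarrow> a < b \<Longrightarrow> b \<le> 1 \<Longrightarrow> \<exists>L. has_tensor_integral T (curve \<iota> i) (curve \<iota> j) a b L"
    and L: "has_tensor_integral T (curve \<iota> i) (curve \<iota> j) 0 1 L"
    and fin: "finite K" and \<phi>: "\<And>k. k \<in> K \<Longrightarrow> \<phi> k \<in> step_functions" and \<psi>: "\<And>k. k \<in> K \<Longrightarrow> \<psi> k \<in> step_functions"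
    and F: "\<And>s u. s \<in> {0..1} \<Longrightarrow> u \<in> {0..1} \<Longrightarrow> s < u \<Longrightarrow> F s u = 1 / 2"
      "\<And>s u. s \<in> {0..1} \<Longrightarrow> u \<in> {0..1} \<Longrightarrow> u < s \<Longrightarrow> F s u = - 1 / 2"
    and g: "\<And>t v. g t v = (\<Sum>k\<in>K. \<phi> k t * \<psi> k v)"
  shows "has_quad_integral (R i) (R j) F g
    (inner (L - (1 / 2) *\<^sub>R T (curve \<iota> i 1) (curve \<iota> j 1))
      (\<Sum>k\<in>K. T (\<iota> (on_component i (\<phi> k))) (\<iota> (on_component j (\<psi> k)))))"
proof -
  let ?h = "(1 / 2) *\<^sub>R curve \<iota> i 1" and ?\<Phi> = "\<lambda>k. \<iota> (on_component i (\<phi> k))"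
  have "has_young_integral (R j) (\<lambda>u v. \<Sum>k\<in>K. \<psi> k v * inner (curve \<iota> i u - ?h) (?\<Phi> k))
    (inner (L - T ?h (curve \<iota> j 1)) (\<Sum>k\<in>K. T (?\<Phi> k) (\<iota> (on_component j (\<psi> k)))))"
    by (rule levy_outer_integral[OF e tensor L fin \<psi>])
  moreover have "T ?h (curve \<iota> j 1) = (1 / 2) *\<^sub>R T (curve \<iota> i 1) (curve \<iota> j 1)"
    using bilinear_lmul[OF tensor_bilinear[OF T]] by simp
  moreover have "has_pc_integral (R i) (\<lambda>s t. F s u * g t v)
      (\<Sum>k\<in>K. \<psi> k v * inner (curve \<iota> i u - ?h) (?\<Phi> k))" if "u \<in> {0..1}" for u v
    using that by (intro levy_inner_integral \<phi> fin F g)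
  ultimately show ?thesis
    unfolding has_quad_integral_def
    by (intro exI[of _ "\<lambda>u v. \<Sum>k\<in>K. \<psi> k v * inner (curve \<iota> i u - ?h) (?\<Phi> k)"]) simp
qed

end

section \<open>The dyadic approximations\<close>

definition other :: "2 \<Rightarrow> 2" where
  "other i = (if i = 1 then 2 else 1)"

text \<open>The sign of the entry \<open>(i, other i)\<close> of the kernel above the diagonal.\<close>

definition orientation :: "2 \<Rightarrow> real" where
  "orientation i = (if i = 1 then 1 else -1)"

lemma dyadic_mono: "k \<le> l \<Longrightarrow> dyadic n k \<le> dyadic n l"
  by (simp add: divide_right_mono)

lemma dyadic_interval_eq: "dyadic_interval n k = {dyadic n k<..dyadic n (Suc k)}"
  by (simp add: dyadic_interval_def)

lemma dyadic_intervals_Union: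
  assumes "k \<le> m"
  shows "(\<Union>j\<in>{k..<m}. dyadic_interval n j) = {dyadic n k<..dyadic n m}"
  using assms
proof (induction m rule: dec_induct)
  case (step m)
  have "{k..<Suc m} = insert m {k..<m}" using step(1) by auto
  then have "(\<Union>j\<in>{k..<Suc m}. dyadic_interval n j) = dyadic_interval n m \<union> {dyadic n k<..dyadic n m}"
    using step.IH by simp
  also have "\<dots> = {dyadic n k<..dyadic n (Suc m)}"
    unfolding dyadic_interval_eq using dyadic_mono[OF step(1), of n] dyadic_mono[of m "Suc m" n] by auto
  finally show ?case .
qed simp

lemma dyadic_intervals_disjoint: "disjoint_family_on (\<lambda>l. A l \<times> dyadic_interval n l) S"
proof -
  have "dyadic_interval n k \<inter> dyadic_interval n l = {}" if "k < l" for k l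
    unfolding dyadic_interval_eq using dyadic_mono[of "Suc k" l n] that by auto
  then have "dyadic_interval n k \<inter> dyadic_interval n l = {}" if "k \<noteq> l" for k l
    using that by (metis inf_commute linorder_neqE_nat)
  then show ?thesis unfolding disjoint_family_on_def by blast
qed

lemma indicator_below_diagonal:
  "indicator (\<Union>l<2 ^ n. \<Union>k<l. dyadic_interval n k \<times> dyadic_interval n l) (s, t) =
     (\<Sum>l<2 ^ n. indicator {0<..dyadic n l} s * indicator {dyadic n l<..dyadic n (Suc l)} t :: real)"
proof -
  have "{0<..dyadic n l} = (\<Union>k<l. dyadic_interval n k)" for l
    using dyadic_intervals_Union[of 0 l n] by (simp add: lessThan_atLeast0)
  then have "(\<Union>l<2 ^ n. \<Union>k<l. dyadic_interval n k \<times> dyadic_interval n l) =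
      (\<Union>l<2 ^ n. {0<..dyadic n l} \<times> dyadic_interval n l)"
    by (intro SUP_cong refl) (simp only:, blast)
  then show ?thesis
    by (simp only: indicator_UN_disjoint[OF finite_lessThan dyadic_intervals_disjoint])
      (simp add: indicator_times dyadic_interval_eq)
qed

lemma Union_below_diagonal_swap:
  "(\<Union>k<N. \<Union>l<k. f k \<times> g l) = (\<Union>l<N::nat. (\<Union>k\<in>{Suc l..<N}. f k) \<times> g l)"
proof (intro equalityI subrelI)
  fix a b assume "(a, b) \<in> (\<Union>k<N. \<Union>l<k. f k \<times> g l)"
  then obtain k l where kl: "k < N" "l < k" "a \<in> f k" "b \<in> g l" by blast
  then have "l \<in> {..<N}" "k \<in> {Suc l..<N}" by auto
  with kl show "(a, b) \<in> (\<Union>l<N::nat. (\<Union>k\<in>{Suc l..<N}. f k) \<times> g l)" by blast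
next
  fix a b assume "(a, b) \<in> (\<Union>l<N::nat. (\<Union>k\<in>{Suc l..<N}. f k) \<times> g l)"
  then obtain k l where kl: "l < N" "k \<in> {Suc l..<N}" "a \<in> f k" "b \<in> g l" by blast
  then have "k \<in> {..<N}" "l \<in> {..<k}" by auto
  with kl show "(a, b) \<in> (\<Union>k<N. \<Union>l<k. f k \<times> g l)" by blast
qed

lemma indicator_above_diagonal:
  "indicator (\<Union>k<2 ^ n. \<Union>l<k. dyadic_interval n k \<times> dyadic_interval n l) (s, t) =
     (\<Sum>l<2 ^ n. indicator {dyadic n (Suc l)<..1} s * indicator {dyadic n l<..dyadic n (Suc l)} t :: real)"
proof -
  have "{dyadic n (Suc l)<..1} = (\<Union>k\<in>{Suc l..<2 ^ n}. dyadic_interval n k)" if "l < 2 ^ n" for l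
    using dyadic_intervals_Union[of "Suc l" "2 ^ n" n] that by simp
  then have "(\<Union>l<2 ^ n. {dyadic n (Suc l)<..1} \<times> dyadic_interval n l) =
      (\<Union>l<2 ^ n. (\<Union>k\<in>{Suc l..<2 ^ n}. dyadic_interval n k) \<times> dyadic_interval n l)"
    by (intro SUP_cong refl) simp
  also have "\<dots> = (\<Union>k<2 ^ n. \<Union>l<k. dyadic_interval n k \<times> dyadic_interval n l)"
    by (rule Union_below_diagonal_swap[symmetric])
  finally have "(\<Union>k<2 ^ n. \<Union>l<k. dyadic_interval n k \<times> dyadic_interval n l) =
      (\<Union>l<2 ^ n. {dyadic n (Suc l)<..1} \<times> dyadic_interval n l)" ..
  then show ?thesis
    by (simp only: indicator_UN_disjoint[OF finite_lessThan dyadic_intervals_disjoint])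
      (simp add: indicator_times dyadic_interval_eq)
qed

text \<open>The first factor that multiplies the indicator of the \<open>l\<close>-th dyadic interval when the entry \<open>(i, other i)\<close> of
  the approximation is written as a sum over the second variable.\<close>

definition approx_row :: "nat \<Rightarrow> 2 \<Rightarrow> nat \<Rightarrow> real \<Rightarrow> real" where
  "approx_row n i l = (\<lambda>s. (orientation i / 2) * indicator {0<..dyadic n l} s +
     (- orientation i / 2) * indicator {dyadic n (Suc l)<..1} s)"

lemma area_kernel_eq:
  "area_kernel A B ((s, i), (t, j)) =
     (if j = other i then orientation i * (indicator A (s, t) - indicator B (s, t)) / 2 else 0)"
  using exhaust_2[of i] exhaust_2[of j]
  by (auto simp: area_kernel_def other_def orientation_def)

lemma levy_approx_expand:
  "levy_approx n (y, z) = (\<Sum>(i, l)\<in>UNIV \<times> {..<2 ^ n}. on_component i (approx_row n i l) y *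
     on_component (other i) (indicator {dyadic n l<..dyadic n (Suc l)}) z)"
proof -
  obtain s i t j where yz: "y = (s, i)" "z = (t, j)" by (cases y, cases z) auto
  have "(\<Sum>(i', l)\<in>UNIV \<times> {..<2 ^ n}. on_component i' (approx_row n i' l) y *
     on_component (other i') (indicator {dyadic n l<..dyadic n (Suc l)}) z) =
     (\<Sum>i'\<in>UNIV. \<Sum>l<2 ^ n. if i' = i then on_component i (approx_row n i l) y *
     on_component (other i) (indicator {dyadic n l<..dyadic n (Suc l)}) z else 0)"
    unfolding sum.cartesian_product[symmetric] by (intro sum.cong refl) (auto simp: on_component_def yz)
  also have "\<dots> = (\<Sum>l<2 ^ n. on_component i (approx_row n i l) y *
     on_component (other i) (indicator {dyadic n l<..dyadic n (Suc l)}) z)"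
    by (subst sum.swap) simp
  also have "\<dots> = (if j = other i then (\<Sum>l<2 ^ n. approx_row n i l s * indicator {dyadic n l<..dyadic n (Suc l)} t) else 0)"
    by (auto simp: on_component_def yz)
  also have "\<dots> = levy_approx n (y, z)"
  proof -
    have "(\<Sum>l<2 ^ n. approx_row n i l s * indicator {dyadic n l<..dyadic n (Suc l)} t) =
      orientation i / 2 * ((\<Sum>l<2 ^ n. indicator {0<..dyadic n l} s * indicator {dyadic n l<..dyadic n (Suc l)} t) -
        (\<Sum>l<2 ^ n. indicator {dyadic n (Suc l)<..1} s * indicator {dyadic n l<..dyadic n (Suc l)} t))"
      unfolding approx_row_def sum_subtractf[symmetric] sum_distrib_left by (intro sum.cong refl) (simp only: algebra_simps)
    then show ?thesis
      unfolding levy_approx_def yz area_kernel_eq indicator_below_diagonal indicator_above_diagonal by simp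
  qed
  finally show ?thesis ..
qed

context
  fixes R :: "2 \<Rightarrow> real \<Rightarrow> real \<Rightarrow> real"
    and \<iota> :: "(real \<times> 2 \<Rightarrow> real) \<Rightarrow> 'h::{real_inner, complete_space}"
    and T :: "'h \<Rightarrow> 'h \<Rightarrow> 'k::{real_inner, complete_space}"
  assumes \<iota>: "hilbert_completion step_functions2 (step_inner2 R) \<iota>"
    and T: "hilbert_tensor_square T"
begin

text \<open>Summation over the first variable collapses each row of squares, which leaves a left and a right tagged sum and a
  boundary term.\<close>

lemma tensor_embed_levy_approx:
  "tensor_embed \<iota> T (levy_approx n) = (\<Sum>i\<in>UNIV. (orientation i / 2) *\<^sub>R
     (tagged_sum T (curve \<iota> i) (curve \<iota> (other i)) (2 ^ n) (dyadic n) (dyadic n) +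
      tagged_sum T (curve \<iota> i) (curve \<iota> (other i)) (2 ^ n) (dyadic n) (\<lambda>k. dyadic n (Suc k)) -
      T (curve \<iota> i 1) (curve \<iota> (other i) 1)))"
proof -
  note bil = tensor_bilinear[OF T]
  let ?e = "curve \<iota>" and ?t = "dyadic n"
  let ?I = "\<lambda>l. indicator {?t l<..?t (Suc l)}"
  have d: "?t l \<in> {0..1}" "?t (Suc l) \<in> {0..1}" "?t l \<le> ?t (Suc l)" if "l < 2 ^ n" for l
    using partition_bounds[OF dyadic_partition, of l n] partition_bounds[OF dyadic_partition, of "Suc l" n]
      dyadic_mono[of l "Suc l" n] that by simp_all
  have row: "approx_row n i l \<in> step_functions" if "l < 2 ^ n" for i l
    unfolding approx_row_def using d[OF that] by (intro step_add step_scale step_indicator) auto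
  have "tensor_embed \<iota> T (levy_approx n) = (\<Sum>x\<in>UNIV \<times> {..<2 ^ n}.
      T (\<iota> (on_component (fst x) (approx_row n (fst x) (snd x))))
        (\<iota> (on_component (other (fst x)) (?I (snd x)))))"
  proof (rule tensor_embed_eq[OF \<iota> bil])
    show "levy_approx n (y, z) = (\<Sum>x\<in>UNIV \<times> {..<2 ^ n}. on_component (fst x) (approx_row n (fst x) (snd x)) y *
        on_component (other (fst x)) (?I (snd x)) z)" for y z
      unfolding levy_approx_expand by (simp only: case_prod_unfold)
  qed (use row d in \<open>auto intro!: on_component_mem step_indicator simp del: of_nat_Suc\<close>)
  also have "\<dots> = (\<Sum>i\<in>UNIV. \<Sum>l<2 ^ n. T (\<iota> (on_component i (approx_row n i l)))
        (\<iota> (on_component (other i) (?I l))))"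
    by (simp only: sum.cartesian_product case_prod_unfold)
  also have "\<dots> = (\<Sum>i\<in>UNIV. \<Sum>l<2 ^ n. (orientation i / 2) *\<^sub>R
       T ((?e i (?t l) + ?e i (?t (Suc l))) - ?e i 1)
         (?e (other i) (?t (Suc l)) - ?e (other i) (?t l)))"
  proof (intro sum.cong refl)
    fix i l assume "l \<in> {..<2 ^ n :: nat}"
    then have l: "l < 2 ^ n" by simp
    have "\<iota> (on_component i (approx_row n i l)) =
      (orientation i / 2) *\<^sub>R (?e i (?t l) - ?e i 0) +
      (- orientation i / 2) *\<^sub>R (?e i 1 - ?e i (?t (Suc l)))"
    proof -
      have "indicator {0<..?t l} \<in> step_functions" "indicator {?t (Suc l)<..1} \<in> step_functions"
        using d[OF l] by (auto intro!: step_indicator)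
      moreover have "\<iota> (on_component i (indicator {0<..?t l})) = ?e i (?t l) - ?e i 0"
        using d[OF l] by (intro curve_increment[OF \<iota>]) auto
      moreover have "\<iota> (on_component i (indicator {?t (Suc l)<..1})) = ?e i 1 - ?e i (?t (Suc l))"
        using d[OF l] by (intro curve_increment[OF \<iota>]) auto
      ultimately show ?thesis unfolding approx_row_def by (simp only: embed_lincomb[OF \<iota>])
    qed
    also have "\<dots> = (orientation i / 2) *\<^sub>R ((?e i (?t l) + ?e i (?t (Suc l))) - ?e i 1)"
      by (simp add: curve_zero[OF \<iota>] scaleR_diff_right scaleR_add_right del: of_nat_Suc)
    finally show "T (\<iota> (on_component i (approx_row n i l)))
        (\<iota> (on_component (other i) (?I l))) = (orientation i / 2) *\<^sub>R
       T ((?e i (?t l) + ?e i (?t (Suc l))) - ?e i 1)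
         (?e (other i) (?t (Suc l)) - ?e (other i) (?t l))"
      by (simp only: curve_increment[OF \<iota> d[OF l]] bilinear_lmul[OF bil])
  qed
  also have "\<dots> = (\<Sum>i\<in>UNIV. (orientation i / 2) *\<^sub>R
     (tagged_sum T (?e i) (?e (other i)) (2 ^ n) ?t ?t +
      tagged_sum T (?e i) (?e (other i)) (2 ^ n) ?t (\<lambda>k. ?t (Suc k)) -
      T (?e i 1) (?e (other i) 1)))"
  proof (intro sum.cong refl)
    fix i
    let ?f = "?e (other i)"
    have "(\<Sum>l<2 ^ n. T ((?e i (?t l) + ?e i (?t (Suc l))) - ?e i 1) (?f (?t (Suc l)) - ?f (?t l))) =
      tagged_sum T (?e i) ?f (2 ^ n) ?t ?t +
      (\<Sum>l<2 ^ n. T (?e i (?t (Suc l)) - ?e i 1) (?f (?t (Suc l)) - ?f (?t l)))"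
      unfolding tagged_sum_def sum.distrib[symmetric] by (simp only: add_diff_eq[symmetric] bilinear_ladd[OF bil])
    also have "(\<Sum>l<2 ^ n. T (?e i (?t (Suc l)) - ?e i 1) (?f (?t (Suc l)) - ?f (?t l))) =
      tagged_sum T (?e i) ?f (2 ^ n) ?t (\<lambda>k. ?t (Suc k)) - T (?e i 1) (?f 1 - ?f 0)"
      by (rule tagged_sum_shift[OF bil dyadic_partition])
    finally show "(\<Sum>l<2 ^ n. (orientation i / 2) *\<^sub>R
       T ((?e i (?t l) + ?e i (?t (Suc l))) - ?e i 1) (?f (?t (Suc l)) - ?f (?t l))) =
      (orientation i / 2) *\<^sub>R (tagged_sum T (?e i) ?f (2 ^ n) ?t ?t +
        tagged_sum T (?e i) ?f (2 ^ n) ?t (\<lambda>k. ?t (Suc k)) - T (?e i 1) (?f 1))"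
      by (simp only: scaleR_sum_right[symmetric] curve_zero[OF \<iota>] diff_zero add_diff_eq)
  qed
  finally show ?thesis .
qed

end

lemma has_quad_integral_zero: "has_quad_integral \<rho> \<sigma> (\<lambda>s u. 0) g 0"
proof -
  have grid: "grid {0, 1}" by (auto simp: grid_def)
  have "has_pc_integral \<rho> (\<lambda>s t. 0) 0"
    using has_pc_integral_cellwise[OF grid, of "\<lambda>s t. 0" "\<lambda>_. 0" "\<lambda>_. 0"] by simp
  moreover have "has_young_integral \<sigma> (\<lambda>u v. 0) 0"
    unfolding has_young_integral_def
    by (rule exI[of _ 1], rule exI[of _ real], rule exI[of _ 1], rule exI[of _ real],
        rule exI[of _ "\<lambda>_ _ _ _. 0"], rule exI[of _ "\<lambda>_ _. 0"])
      (auto simp: is_partition_def has_rs_integral_def intro: exI[of _ 1])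
  ultimately show ?thesis unfolding has_quad_integral_def by (intro exI[of _ "\<lambda>u v. 0"]) simp
qed

text \<open>The kernel and the step function enter the quadruple integral through their product, so a sign can be moved
  from one to the other.\<close>

lemma has_quad_integral_cong:
  assumes "\<And>s u t v. F s u * g t v = F' s u * g' t v"
  shows "has_quad_integral \<rho> \<sigma> F g I \<longleftrightarrow> has_quad_integral \<rho> \<sigma> F' g' I"
  unfolding has_quad_integral_def assms ..

lemma entry_levy_kernel:
  assumes "s \<in> {0..1}" "u \<in> {0..1}"
  shows "s < u \<Longrightarrow> orientation i * entry levy_kernel i (other i) s u = 1 / 2"
    "u < s \<Longrightarrow> orientation i * entry levy_kernel i (other i) s u = - 1 / 2"
  using assms by (simp_all add: entry_def levy_kernel_def area_kernel_eq orientation_def)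

lemma entry_levy_kernel_diagonal: "j \<noteq> other i \<Longrightarrow> entry levy_kernel i j = (\<lambda>s u. 0)"
  by (simp add: fun_eq_iff entry_def levy_kernel_def area_kernel_eq)

section \<open>Convergence and the pairing with step functions\<close>

lemma tensor_embed_step:
  fixes N :: "2 \<times> 2 \<Rightarrow> nat"
  assumes \<iota>: "hilbert_completion step_functions2 (step_inner2 R) \<iota>" and T: "bilinear T"
    and mem: "\<And>x k. k < N x \<Longrightarrow> \<phi> x k \<in> step_functions" "\<And>x k. k < N x \<Longrightarrow> \<psi> x k \<in> step_functions"
    and g: "\<And>x s t. entry g (fst x) (snd x) s t = (\<Sum>k<N x. \<phi> x k s * \<psi> x k t)"
  shows "tensor_embed \<iota> T g = (\<Sum>x\<in>UNIV. \<Sum>k<N x.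
    T (\<iota> (on_component (fst x) (\<phi> x k))) (\<iota> (on_component (snd x) (\<psi> x k))))"
proof -
  have "tensor_embed \<iota> T g = (\<Sum>z\<in>(SIGMA x:UNIV. {..<N x}).
      T (\<iota> (on_component (fst (fst z)) (\<phi> (fst z) (snd z)))) (\<iota> (on_component (snd (fst z)) (\<psi> (fst z) (snd z)))))"
  proof (rule tensor_embed_eq[OF \<iota> T])
    fix y z :: "real \<times> 2"
    obtain s i t j where yz: "y = (s, i)" "z = (t, j)" by (cases y, cases z) auto
    have "(\<Sum>w\<in>(SIGMA x:UNIV. {..<N x}). on_component (fst (fst w)) (\<phi> (fst w) (snd w)) y *
        on_component (snd (fst w)) (\<psi> (fst w) (snd w)) z) =
      (\<Sum>x\<in>UNIV. \<Sum>k<N x. on_component (fst x) (\<phi> x k) y * on_component (snd x) (\<psi> x k) z)"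
      by (subst sum.Sigma) (simp_all add: case_prod_unfold)
    also have "\<dots> = (\<Sum>x\<in>UNIV. if x = (i, j) then \<Sum>k<N x. \<phi> x k s * \<psi> x k t else 0)"
    proof (intro sum.cong refl)
      fix x :: "2 \<times> 2"
      show "(\<Sum>k<N x. on_component (fst x) (\<phi> x k) y * on_component (snd x) (\<psi> x k) z) =
          (if x = (i, j) then \<Sum>k<N x. \<phi> x k s * \<psi> x k t else 0)"
        by (cases "x = (i, j)") (auto simp: on_component_def yz prod_eq_iff intro!: sum.neutral)
    qed
    also have "\<dots> = g (y, z)" using g[of "(i, j)" s t] by (simp add: entry_def yz)
    finally show "g (y, z) = (\<Sum>w\<in>(SIGMA x:UNIV. {..<N x}). on_component (fst (fst w)) (\<phi> (fst w) (snd w)) y *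
        on_component (snd (fst w)) (\<psi> (fst w) (snd w)) z)" ..
  qed (use mem in \<open>auto intro!: on_component_mem\<close>)
  then show ?thesis by (subst sum.Sigma) (simp_all add: case_prod_unfold)
qed

theorem theorem3p10:
  fixes M :: "'w measure"
    and X :: "2 \<Rightarrow> real \<Rightarrow> 'w \<Rightarrow> real"
    and R :: "2 \<Rightarrow> real \<Rightarrow> real \<Rightarrow> real"
    and p q :: real
    and \<iota> :: "(real \<times> 2 \<Rightarrow> real) \<Rightarrow> 'h::{real_inner, complete_space}"
    and T :: "'h \<Rightarrow> 'h \<Rightarrow> 'k::{real_inner, complete_space}"
  assumes "prob_space M"
    and "\<And>i. centered_gaussian_process M (X i)"
    and "\<And>i. continuous_process M (X i)"
    and "\<And>i. AE \<omega> in M. X i 0 \<omega> = 0"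
    and "independent_processes M (X 1) (X 2)"
    and "\<And>i. is_covariance_function M (X i) (R i)"
    and "p \<ge> 1" and "q \<ge> 1"
    and "finite_variation2 p (R 1)"
    and "finite_variation2 q (R 2)"
    and "1 / p + 1 / q > 1"
    and "hilbert_completion step_functions2 (step_inner2 R) \<iota>"
    and "hilbert_tensor_square T"
  shows "Cauchy (\<lambda>n. tensor_embed \<iota> T (levy_approx n)) \<and>
    (\<exists>fhat. (\<lambda>n. tensor_embed \<iota> T (levy_approx n)) \<longlonglongrightarrow> fhat \<and>
       (\<forall>g\<in>tensor_step_functions2.
          (\<forall>i j. quad_integrable (R i) (R j) (entry levy_kernel i j) (entry g i j)) \<and>
          inner fhat (tensor_embed \<iota> T g) =
            (\<Sum>i\<in>UNIV. \<Sum>j\<in>UNIV. quad_integral (R i) (R j) (entry levy_kernel i j) (entry g i j))))"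
proof -
  note \<iota> = assms(12) and T = assms(13)
  note bil = tensor_bilinear[OF T]
  let ?e = "curve \<iota>"
  interpret prob_space M by (rule assms(1))
  have curve: "increment_curve (?e i) (R i)" for i by (rule curve_is_increment_curve[OF \<iota>])
  have cont: "continuous_on {0..1} (?e i)" for i
    by (rule increment_curve_continuous[OF curve gaussian_process_L2_continuous[OF assms(2,3,6)]])
  \<comment> \<open>The variation exponent of \<open>R i\<close>; the assumption on \<open>p\<close> and \<open>q\<close> is symmetric, so both off-diagonal blocks are covered.\<close>
  define pe where "pe i = (if i = 1 then p else q)" for i :: 2
  have pe: "pe i \<ge> 1" "finite_variation2 (pe i) (R i)" "1 / pe i + 1 / pe (other i) > 1" for i
    using assms(7-11) exhaust_2[of i] by (auto simp: pe_def other_def add.commute)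
  have tensor: "\<exists>L. has_tensor_integral T (?e i) (?e (other i)) a b L" if "0 \<le> a" "a < b" "b \<le> 1" for i a b
    using tensor_integral_exists[OF T curve cont curve pe(1) pe(1) pe(3) pe(2) pe(2) that] by blast
  then have "\<exists>L. has_tensor_integral T (?e i) (?e (other i)) 0 1 L" for i by simp
  then obtain L where L: "\<And>i. has_tensor_integral T (?e i) (?e (other i)) 0 1 (L i)" by metis
  define A where "A i = L i - (1 / 2) *\<^sub>R T (?e i 1) (?e (other i) 1)" for i
  define fhat where "fhat = (\<Sum>i\<in>UNIV. orientation i *\<^sub>R A i)"
  have lim: "(\<lambda>n. tensor_embed \<iota> T (levy_approx n)) \<longlonglongrightarrow> fhat"
  proof -
    have "(\<lambda>n. tensor_embed \<iota> T (levy_approx n)) \<longlonglongrightarrow>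
        (\<Sum>i\<in>UNIV. (orientation i / 2) *\<^sub>R (L i + L i - T (?e i 1) (?e (other i) 1)))"
      unfolding tensor_embed_levy_approx[OF \<iota> T]
      by (intro tendsto_intros has_tensor_integral_tendsto[OF L] dyadic_fine)
    also have "(\<Sum>i\<in>UNIV. (orientation i / 2) *\<^sub>R (L i + L i - T (?e i 1) (?e (other i) 1))) = fhat"
      unfolding fhat_def
    proof (intro sum.cong refl)
      fix i
      have "L i + L i - T (?e i 1) (?e (other i) 1) = 2 *\<^sub>R A i"
        by (simp add: A_def scaleR_diff_right scaleR_2)
      then show "(orientation i / 2) *\<^sub>R (L i + L i - T (?e i 1) (?e (other i) 1)) = orientation i *\<^sub>R A i"
        by simp
    qed
    finally show ?thesis .
  qed
  have main: "(\<forall>i j. quad_integrable (R i) (R j) (entry levy_kernel i j) (entry g i j)) \<and>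
      inner fhat (tensor_embed \<iota> T g) =
        (\<Sum>i\<in>UNIV. \<Sum>j\<in>UNIV. quad_integral (R i) (R j) (entry levy_kernel i j) (entry g i j))"
    if g: "g \<in> tensor_step_functions2" for g
  proof -
    define represents where "represents x n \<phi> \<psi> \<longleftrightarrow>
        (\<forall>k<n. \<phi> k \<in> step_functions \<and> \<psi> k \<in> step_functions) \<and>
        entry g (fst x) (snd x) = (\<lambda>s t. \<Sum>k<n. \<phi> k s * \<psi> k t)"
      for x :: "2 \<times> 2" and n :: nat and \<phi> \<psi> :: "nat \<Rightarrow> real \<Rightarrow> real"
    have "\<exists>n \<phi> \<psi>. represents x n \<phi> \<psi>" for x
      using g unfolding represents_def tensor_step_functions2_def tensor_step_functions_def by simp
    then obtain N \<phi> \<psi> where rep: "\<And>x. represents x (N x) (\<phi> x) (\<psi> x)" by metis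
    have mem: "\<phi> x k \<in> step_functions" "\<psi> x k \<in> step_functions" if "k < N x" for x k
      using rep[of x] that by (auto simp: represents_def)
    have ent: "entry g (fst x) (snd x) s t = (\<Sum>k<N x. \<phi> x k s * \<psi> x k t)" for x s t
      using rep[of x] by (simp add: represents_def)
    define W where "W i j = (\<Sum>k<N (i, j). T (\<iota> (on_component i (\<phi> (i, j) k))) (\<iota> (on_component j (\<psi> (i, j) k))))" for i j
    have embed: "tensor_embed \<iota> T g = (\<Sum>i\<in>UNIV. \<Sum>j\<in>UNIV. W i j)"
      using tensor_embed_step[OF \<iota> bil, where N = N and \<phi> = \<phi> and \<psi> = \<psi> and g = g, OF mem ent]
      unfolding W_def sum.cartesian_product by (simp add: case_prod_unfold)
    have orth: "inner (A i) (W i' j') = 0" if "i' \<noteq> i \<or> j' \<noteq> other i" for i i' j'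
    proof -
      have "inner (A i) (T (\<iota> (on_component i' (\<phi> (i', j') k))) (\<iota> (on_component j' (\<psi> (i', j') k)))) = 0"
        if "k < N (i', j')" for k
      proof -
        note m = mem[OF that]
        have "inner (L i) (T (\<iota> (on_component i' (\<phi> (i', j') k))) (\<iota> (on_component j' (\<psi> (i', j') k)))) = 0"
          by (rule tensor_integral_orthogonal[OF \<iota> T L m]) (use \<open>i' \<noteq> i \<or> j' \<noteq> other i\<close> in auto)
        moreover have "inner (?e i 1) (\<iota> (on_component i' (\<phi> (i', j') k))) *
            inner (?e (other i) 1) (\<iota> (on_component j' (\<psi> (i', j') k))) = 0"
          using curve_orthogonal[OF \<iota> _ _ m(1), of i i' 1] curve_orthogonal[OF \<iota> _ _ m(2), of "other i" j' 1]
            \<open>i' \<noteq> i \<or> j' \<noteq> other i\<close> by auto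
        ultimately show ?thesis by (simp add: A_def inner_diff_left tensor_inner[OF T])
      qed
      then show ?thesis by (simp add: W_def inner_sum_right)
    qed
    have quad: "has_quad_integral (R i) (R j) (entry levy_kernel i j) (entry g i j)
        (if j = other i then orientation i * inner (A i) (W i j) else 0)" for i j
    proof (cases "j = other i")
      case True
      \<comment> \<open>The sign of the kernel is moved to the first factors of the step function.\<close>
      have o: "orientation i * orientation i = 1" by (simp add: orientation_def)
      let ?\<phi> = "\<lambda>k s. orientation i * \<phi> (i, j) k s"
      have "has_quad_integral (R i) (R j) (\<lambda>s u. orientation i * entry levy_kernel i j s u)
        (\<lambda>t v. \<Sum>k<N (i, j). ?\<phi> k t * \<psi> (i, j) k v)
        (inner (A i) (\<Sum>k<N (i, j). T (\<iota> (on_component i (?\<phi> k))) (\<iota> (on_component j (\<psi> (i, j) k)))))"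
        unfolding A_def True
        by (rule levy_quad_integral[OF \<iota> T cont tensor L])
          (use mem step_scale entry_levy_kernel in auto)
      also have "(\<Sum>k<N (i, j). T (\<iota> (on_component i (?\<phi> k))) (\<iota> (on_component j (\<psi> (i, j) k)))) = orientation i *\<^sub>R W i j"
        unfolding W_def scaleR_sum_right
      proof (intro sum.cong refl)
        fix k assume "k \<in> {..<N (i, j)}"
        then have "\<iota> (on_component i (?\<phi> k)) = orientation i *\<^sub>R \<iota> (on_component i (\<phi> (i, j) k))"
          using embed_sum[OF \<iota>, of "{k}" "\<phi> (i, j)" i "\<lambda>_. orientation i"] mem by simp
        then show "T (\<iota> (on_component i (?\<phi> k))) (\<iota> (on_component j (\<psi> (i, j) k))) =
          orientation i *\<^sub>R T (\<iota> (on_component i (\<phi> (i, j) k))) (\<iota> (on_component j (\<psi> (i, j) k)))"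
          by (simp add: bilinear_lmul[OF bil])
      qed
      finally have *: "has_quad_integral (R i) (R j) (\<lambda>s u. orientation i * entry levy_kernel i j s u)
        (\<lambda>t v. \<Sum>k<N (i, j). ?\<phi> k t * \<psi> (i, j) k v) (orientation i * inner (A i) (W i j))" by simp
      have "orientation i * entry levy_kernel i j s u * (\<Sum>k<N (i, j). ?\<phi> k t * \<psi> (i, j) k v) =
          entry levy_kernel i j s u * entry g i j t v" for s u t v
      proof -
        have "(\<Sum>k<N (i, j). ?\<phi> k t * \<psi> (i, j) k v) = orientation i * entry g i j t v"
          using ent[of "(i, j)" t v] by (simp add: sum_distrib_left mult_ac)
        then show ?thesis using o by (metis mult.assoc mult.commute mult_1)
      qed
      then show ?thesis
        using * has_quad_integral_cong[of "\<lambda>s u. orientation i * entry levy_kernel i j s u"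
            "\<lambda>t v. \<Sum>k<N (i, j). ?\<phi> k t * \<psi> (i, j) k v" "entry levy_kernel i j" "entry g i j"] True
        by simp
    next
      case False
      then show ?thesis by (simp add: entry_levy_kernel_diagonal has_quad_integral_zero)
    qed
    have "inner fhat (tensor_embed \<iota> T g) =
        (\<Sum>a\<in>UNIV. \<Sum>i\<in>UNIV. \<Sum>j\<in>UNIV. orientation a * inner (A a) (W i j))"
      unfolding fhat_def embed inner_sum_left by (simp add: inner_sum_right sum_distrib_left)
    also have "\<dots> = (\<Sum>a\<in>UNIV. \<Sum>i\<in>UNIV. \<Sum>j\<in>UNIV.
        if i = a then if j = other i then orientation i * inner (A i) (W i j) else 0 else 0)"
      using orth by (intro sum.cong refl) auto
    also have "\<dots> = (\<Sum>i\<in>UNIV. \<Sum>a\<in>UNIV. if i = a then \<Sum>j\<in>UNIV.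
        if j = other i then orientation i * inner (A i) (W i j) else 0 else 0)"
      by (subst sum.swap) (auto intro!: sum.cong)
    also have "\<dots> = (\<Sum>i\<in>UNIV. \<Sum>j\<in>UNIV. if j = other i then orientation i * inner (A i) (W i j) else 0)"
      by simp
    also have "\<dots> = (\<Sum>i\<in>UNIV. \<Sum>j\<in>UNIV. quad_integral (R i) (R j) (entry levy_kernel i j) (entry g i j))"
      using quad_integral_eq(2)[OF quad] by simp
    finally show ?thesis using quad_integral_eq(1)[OF quad] by blast
  qed
  show ?thesis using LIMSEQ_imp_Cauchy[OF lim] lim main by blast
qed

end
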